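(* Let $X$ be a scheme, let $\mathscr{O}_Y$ be a quadratic $\mathscr{O}_X$-algebra, and let $\mathscr{I}$ be a rank-balanced $\mathscr{O}_Y$-module. Then $\mathscr{I}$ is pseudoregular if and only if for all open $U\subseteq X$ and all $\alpha\in\mathscr{O}_Y(U)$, we have $\operatorname{Tr}_{\mathscr{O}_Y(U)}(\alpha)=\operatorname{Tr}_{\mathscr{I}(U)}(\alpha)$.
   Context: A quadratic $\mathscr{O}_X$-algebra is an $\mathscr{O}_X$-algebra that is locally free of rank $2$ as an $\mathscr{O}_X$-module. An $\mathscr{O}_Y$-module $\mathscr{I}$ is rank-balanced if it is locally free of rank $2$ as an $\mathscr{O}_X$-module. $\operatorname{Tr}_{\mathscr{O}_Y(U)}(\alpha)$ and $\operatorname{Tr}_{\mathscr{I}(U)}(\alpha)$ denote the traces in $\mathscr{O}_X(U)$ of the $\mathscr{O}_X$-linear endomorphisms given by multiplication by $\alpha$ on $\mathscr{O}_Y|_U$ and $\mathscr{I}|_U$. A rank-balanced $\mathscr{I}$ is pseudoregular if there is an affine open cover (equivalently, for all affine open) $U\subseteq X$ such that for all $\alpha\in\mathscr{O}_Y(U)$ the characteristic polynomials over $\mathscr{O}_X(U)$ of multiplication by $\alpha$ on $\mathscr{O}_Y(U)$ and on $\mathscr{I}(U)$ are equal. *)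

theory Defs
  imports
    "HOL-Combinatorics.Permutations"
    "HOL-Analysis.Abstract_Topology"
    "HOL-Algebra.QuotRing"
    "HOL-Algebra.UnivPoly"
begin

section \<open>Sheaves\<close>

text \<open>
  A presheaf assigns to an open set an algebraic structure on the type \<open>'s\<close>;
  \<open>res F U V\<close> is the restriction map from \<open>U\<close> to \<open>V\<close>, meaningful for open \<open>V \<subseteq> U\<close>.
\<close>

record ('p, 's, 'o) presheaf =
  sec :: "'p set \<Rightarrow> 'o"
  res :: "'p set \<Rightarrow> 'p set \<Rightarrow> 's \<Rightarrow> 's"

type_synonym ('p, 'r) ring_presheaf = "('p, 'r, 'r ring) presheaf"
type_synonym ('p, 'r, 'm) module_presheaf = "('p, 'm, ('r, 'm) module) presheaf"

definition sheaf ::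
  "'p topology \<Rightarrow> ('p, 's, ('s, 'x) partial_object_scheme) presheaf \<Rightarrow> bool" where
  "sheaf X F \<longleftrightarrow>
     (\<forall>U V. openin X U \<and> openin X V \<and> V \<subseteq> U \<longrightarrow>
        res F U V \<in> carrier (sec F U) \<rightarrow> carrier (sec F V)) \<and>
     (\<forall>U. openin X U \<longrightarrow> (\<forall>s \<in> carrier (sec F U). res F U U s = s)) \<and>
     (\<forall>U V W. openin X U \<and> openin X V \<and> openin X W \<and> W \<subseteq> V \<and> V \<subseteq> U \<longrightarrow>
        (\<forall>s \<in> carrier (sec F U). res F V W (res F U V s) = res F U W s)) \<and>
     (\<forall>\<U> s. (\<forall>V \<in> \<U>. openin X V) \<and>
        (\<forall>V \<in> \<U>. s V \<in> carrier (sec F V)) \<and>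
        (\<forall>V \<in> \<U>. \<forall>W \<in> \<U>. res F V (V \<inter> W) (s V) = res F W (V \<inter> W) (s W)) \<longrightarrow>
        (\<exists>!t. t \<in> carrier (sec F (\<Union>\<U>)) \<and> (\<forall>V \<in> \<U>. res F (\<Union>\<U>) V t = s V)))"

definition sheaf_of_rings ::
  "'p topology \<Rightarrow> ('p, 'r, ('r, 'x) ring_scheme) presheaf \<Rightarrow> bool" where
  "sheaf_of_rings X F \<longleftrightarrow>
     sheaf X F \<and>
     (\<forall>U. openin X U \<longrightarrow> cring (sec F U)) \<and>
     (\<forall>U V. openin X U \<and> openin X V \<and> V \<subseteq> U \<longrightarrow>
        res F U V \<in> ring_hom (sec F U) (sec F V))"

definition sheaf_of_modules ::
  "'p topology \<Rightarrow> ('p, 'r, ('r, 'x) ring_scheme) presheaf \<Rightarrow>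
   ('p, 'r, 'm) module_presheaf \<Rightarrow> bool" where
  "sheaf_of_modules X OX M \<longleftrightarrow>
     sheaf X M \<and>
     (\<forall>U. openin X U \<longrightarrow> Module.module (sec OX U) (sec M U)) \<and>
     (\<forall>U V. openin X U \<and> openin X V \<and> V \<subseteq> U \<longrightarrow>
        (\<forall>x \<in> carrier (sec M U). \<forall>y \<in> carrier (sec M U).
           res M U V (x \<oplus>\<^bsub>sec M U\<^esub> y) = res M U V x \<oplus>\<^bsub>sec M V\<^esub> res M U V y) \<and>
        (\<forall>r \<in> carrier (sec OX U). \<forall>x \<in> carrier (sec M U).
           res M U V (r \<odot>\<^bsub>sec M U\<^esub> x) = res OX U V r \<odot>\<^bsub>sec M V\<^esub> res M U V x))"

definition sheaf_of_algebras ::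
  "'p topology \<Rightarrow> ('p, 'r) ring_presheaf \<Rightarrow> ('p, 'r, 's) module_presheaf \<Rightarrow> bool" where
  "sheaf_of_algebras X OX B \<longleftrightarrow>
     sheaf_of_modules X OX B \<and> sheaf_of_rings X B \<and>
     (\<forall>U. openin X U \<longrightarrow> algebra (sec OX U) (sec B U))"

text \<open>
  The module structure over the base induced along the structure map \<open>r \<mapsto> r \<odot> \<one>\<close>
  of the algebra \<open>B\<close>. The fields \<open>mult\<close> and \<open>one\<close> of a module record carry no meaning.
\<close>

definition restrict_scalars ::
  "('p, 'r, 's) module_presheaf \<Rightarrow> ('p, 's, 'm) module_presheaf \<Rightarrow>
   ('p, 'r, 'm) module_presheaf" where
  "restrict_scalars B M =
     \<lparr> sec = (\<lambda>U. \<lparr> carrier = carrier (sec M U), mult = mult (sec M U), one = one (sec M U),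
                     zero = zero (sec M U), add = add (sec M U),
                     smult = (\<lambda>r m. (r \<odot>\<^bsub>sec B U\<^esub> \<one>\<^bsub>sec B U\<^esub>) \<odot>\<^bsub>sec M U\<^esub> m) \<rparr>),
       res = res M \<rparr>"


section \<open>Spectra and schemes\<close>

text \<open>
  Localization at a multiplicative set \<open>S\<close>: the fraction \<open>a / s\<close> is its equivalence class of pairs.
\<close>

definition fraction ::
  "('r, 'x) ring_scheme \<Rightarrow> 'r set \<Rightarrow> 'r \<Rightarrow> 'r \<Rightarrow> ('r \<times> 'r) set" where
  "fraction A S a s = {(b, t). b \<in> carrier A \<and> t \<in> S \<and>
     (\<exists>u \<in> S. u \<otimes>\<^bsub>A\<^esub> (t \<otimes>\<^bsub>A\<^esub> a \<ominus>\<^bsub>A\<^esub> s \<otimes>\<^bsub>A\<^esub> b) = \<zero>\<^bsub>A\<^esub>)}"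

definition localization ::
  "('r, 'x) ring_scheme \<Rightarrow> 'r set \<Rightarrow> ('r \<times> 'r) set ring" where
  "localization A S =
     \<lparr> carrier = {fraction A S a s | a s. a \<in> carrier A \<and> s \<in> S},
       mult = (\<lambda>x y. \<Union>(a, s) \<in> x. \<Union>(b, t) \<in> y. fraction A S (a \<otimes>\<^bsub>A\<^esub> b) (s \<otimes>\<^bsub>A\<^esub> t)),
       one = fraction A S \<one>\<^bsub>A\<^esub> \<one>\<^bsub>A\<^esub>,
       zero = fraction A S \<zero>\<^bsub>A\<^esub> \<one>\<^bsub>A\<^esub>,
       add = (\<lambda>x y. \<Union>(a, s) \<in> x. \<Union>(b, t) \<in> y.
                fraction A S (a \<otimes>\<^bsub>A\<^esub> t \<oplus>\<^bsub>A\<^esub> b \<otimes>\<^bsub>A\<^esub> s) (s \<otimes>\<^bsub>A\<^esub> t)) \<rparr>"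

abbreviation local_ring_at :: "('r, 'x) ring_scheme \<Rightarrow> 'r set \<Rightarrow> ('r \<times> 'r) set ring" where
  "local_ring_at A P \<equiv> localization A (carrier A - P)"

definition spec_open :: "('r, 'x) ring_scheme \<Rightarrow> 'r set set \<Rightarrow> bool" where
  "spec_open A U \<longleftrightarrow> (\<exists>S \<subseteq> carrier A. U = {P. primeideal P A \<and> \<not> S \<subseteq> P})"

definition spec_topology :: "('r, 'x) ring_scheme \<Rightarrow> 'r set topology" where
  "spec_topology A = topology (spec_open A)"

lemma istopology_spec_open: "istopology (spec_open A)"
proof -
  have int: "spec_open A (U \<inter> V)" if U: "spec_open A U" and V: "spec_open A V" for U V
  proof -
    obtain S T where S: "S \<subseteq> carrier A" "U = {P. primeideal P A \<and> \<not> S \<subseteq> P}"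
      and T: "T \<subseteq> carrier A" "V = {P. primeideal P A \<and> \<not> T \<subseteq> P}"
      using U V unfolding spec_open_def by auto
    let ?W = "{s \<otimes>\<^bsub>A\<^esub> t | s t. s \<in> S \<and> t \<in> T}"
    have eq: "\<not> ?W \<subseteq> P \<longleftrightarrow> \<not> S \<subseteq> P \<and> \<not> T \<subseteq> P" if P: "primeideal P A" for P
    proof -
      interpret primeideal P A by (rule P)
      show ?thesis
        using S(1) T(1) I_prime I_l_closed I_r_closed by blast
    qed
    show ?thesis
    proof (cases "\<exists>P. primeideal P A")
      case True
      then obtain P where "primeideal P A" ..
      then interpret primeideal P A .
      have "?W \<subseteq> carrier A" using S(1) T(1) by auto
      moreover have "U \<inter> V = {P. primeideal P A \<and> \<not> ?W \<subseteq> P}"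
        using eq S(2) T(2) by blast
      ultimately show ?thesis unfolding spec_open_def by blast
    next
      case False
      then have "U \<inter> V = U" using S(2) by auto
      then show ?thesis using U by simp
    qed
  qed
  have un: "spec_open A (\<Union>\<K>)" if K: "\<forall>U \<in> \<K>. spec_open A U" for \<K>
  proof -
    have "\<forall>U \<in> \<K>. \<exists>S. S \<subseteq> carrier A \<and> U = {P. primeideal P A \<and> \<not> S \<subseteq> P}"
      using K unfolding spec_open_def by blast
    then obtain S where S: "\<And>U. U \<in> \<K> \<Longrightarrow> S U \<subseteq> carrier A \<and> U = {P. primeideal P A \<and> \<not> S U \<subseteq> P}"
      by metis
    have "\<Union>(S ` \<K>) \<subseteq> carrier A" using S by blast
    moreover have "\<Union>\<K> = {P. primeideal P A \<and> \<not> \<Union>(S ` \<K>) \<subseteq> P}"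
    proof (rule Set.set_eqI)
      fix P
      have "P \<in> \<Union>\<K> \<longleftrightarrow> (\<exists>U \<in> \<K>. P \<in> U)" by blast
      also have "\<dots> \<longleftrightarrow> (\<exists>U \<in> \<K>. primeideal P A \<and> \<not> S U \<subseteq> P)"
        using S by blast
      finally show "P \<in> \<Union>\<K> \<longleftrightarrow> P \<in> {P. primeideal P A \<and> \<not> \<Union>(S ` \<K>) \<subseteq> P}" by blast
    qed
    ultimately show ?thesis unfolding spec_open_def by blast
  qed
  show ?thesis unfolding istopology_def using int un by blast
qed

lemma openin_spec_topology: "openin (spec_topology A) U \<longleftrightarrow> spec_open A U"
  by (simp add: spec_topology_def topology_inverse' istopology_spec_open)

text \<open>
  Sections over \<open>U\<close> are the families of germs in the local rings that are locally given by
  a single fraction.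
\<close>

definition spec_sheaf ::
  "('r, 'x) ring_scheme \<Rightarrow> ('r set, 'r set \<Rightarrow> ('r \<times> 'r) set) ring_presheaf" where
  "spec_sheaf A =
     \<lparr> sec = (\<lambda>U. \<lparr>
         carrier = {\<sigma> \<in> (\<Pi>\<^sub>E P \<in> U. carrier (local_ring_at A P)).
           \<forall>P \<in> U. \<exists>V. openin (spec_topology A) V \<and> P \<in> V \<and> V \<subseteq> U \<and>
             (\<exists>a \<in> carrier A. \<exists>f \<in> carrier A. \<forall>Q \<in> V.
                f \<notin> Q \<and> \<sigma> Q = fraction A (carrier A - Q) a f)},
         mult = (\<lambda>\<sigma> \<tau>. \<lambda>P \<in> U. \<sigma> P \<otimes>\<^bsub>local_ring_at A P\<^esub> \<tau> P),
         one = (\<lambda>P \<in> U. \<one>\<^bsub>local_ring_at A P\<^esub>),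
         zero = (\<lambda>P \<in> U. \<zero>\<^bsub>local_ring_at A P\<^esub>),
         add = (\<lambda>\<sigma> \<tau>. \<lambda>P \<in> U. \<sigma> P \<oplus>\<^bsub>local_ring_at A P\<^esub> \<tau> P) \<rparr>),
       res = (\<lambda>U V \<sigma>. restrict \<sigma> V) \<rparr>"

text \<open>
  \<open>U\<close> with the restricted structure sheaf is isomorphic to the spectrum of a commutative ring.
  Up to isomorphism that ring is the ring of sections over \<open>U\<close>, so it is no restriction
  to take it on the type \<open>'r\<close>. An isomorphism of ringed spaces induces isomorphisms on stalks, so
  locality of the stalk maps need not be required separately.
\<close>

definition affine_open :: "'p topology \<Rightarrow> ('p, 'r) ring_presheaf \<Rightarrow> 'p set \<Rightarrow> bool" where
  "affine_open X OX U \<longleftrightarrow>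
     openin X U \<and>
     (\<exists>(A :: 'r ring) h \<psi>.
        cring A \<and>
        homeomorphic_map (subtopology X U) (spec_topology A) h \<and>
        (\<forall>V. openin (spec_topology A) V \<longrightarrow>
           \<psi> V \<in> ring_iso (sec (spec_sheaf A) V) (sec OX (U \<inter> h -` V))) \<and>
        (\<forall>V W. openin (spec_topology A) V \<and> openin (spec_topology A) W \<and> W \<subseteq> V \<longrightarrow>
           (\<forall>\<sigma> \<in> carrier (sec (spec_sheaf A) V).
              \<psi> W (res (spec_sheaf A) V W \<sigma>) =
              res OX (U \<inter> h -` V) (U \<inter> h -` W) (\<psi> V \<sigma>))))"

definition scheme :: "'p topology \<Rightarrow> ('p, 'r) ring_presheaf \<Rightarrow> bool" where
  "scheme X OX \<longleftrightarrow>
     sheaf_of_rings X OX \<and> (\<forall>x \<in> topspace X. \<exists>U. affine_open X OX U \<and> x \<in> U)"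


section \<open>Traces and characteristic polynomials of endomorphisms of locally free sheaves\<close>

text \<open>
  \<open>e\<^sub>0, \<dots>, e\<^sub>n\<^sub>-\<^sub>1\<close> induce an isomorphism from the free sheaf of rank \<open>n\<close> on \<open>V\<close>
  onto the restriction of \<open>M\<close> to \<open>V\<close>.
\<close>

definition free_basis ::
  "'p topology \<Rightarrow> ('p, 'r) ring_presheaf \<Rightarrow> ('p, 'r, 'm) module_presheaf \<Rightarrow>
   nat \<Rightarrow> 'p set \<Rightarrow> (nat \<Rightarrow> 'm) \<Rightarrow> bool" where
  "free_basis X OX M n V e \<longleftrightarrow>
     openin X V \<and> (\<forall>i < n. e i \<in> carrier (sec M V)) \<and>
     (\<forall>W. openin X W \<and> W \<subseteq> V \<longrightarrow>
        (\<forall>m \<in> carrier (sec M W). \<exists>!c. c \<in> {..<n} \<rightarrow>\<^sub>E carrier (sec OX W) \<and>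
           m = (\<Oplus>\<^bsub>sec M W\<^esub>i \<in> {..<n}. c i \<odot>\<^bsub>sec M W\<^esub> res M V W (e i))))"

definition locally_free ::
  "'p topology \<Rightarrow> ('p, 'r) ring_presheaf \<Rightarrow> ('p, 'r, 'm) module_presheaf \<Rightarrow> nat \<Rightarrow> bool" where
  "locally_free X OX M n \<longleftrightarrow>
     (\<forall>x \<in> topspace X. \<exists>V e. x \<in> V \<and> free_basis X OX M n V e)"

definition basis_coords ::
  "('r, 'x) ring_scheme \<Rightarrow> ('r, 'm) module \<Rightarrow> nat \<Rightarrow> (nat \<Rightarrow> 'm) \<Rightarrow> 'm \<Rightarrow> nat \<Rightarrow> 'r" where
  "basis_coords R M n e m =
     (THE c. c \<in> {..<n} \<rightarrow>\<^sub>E carrier R \<and> m = (\<Oplus>\<^bsub>M\<^esub>i \<in> {..<n}. c i \<odot>\<^bsub>M\<^esub> e i))"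

definition endo_matrix ::
  "('r, 'x) ring_scheme \<Rightarrow> ('r, 'm) module \<Rightarrow> nat \<Rightarrow> (nat \<Rightarrow> 'm) \<Rightarrow> ('m \<Rightarrow> 'm) \<Rightarrow>
   nat \<Rightarrow> nat \<Rightarrow> 'r" where
  "endo_matrix R M n e \<phi> = (\<lambda>i j. basis_coords R M n e (\<phi> (e j)) i)"

definition matrix_trace :: "('r, 'x) ring_scheme \<Rightarrow> nat \<Rightarrow> (nat \<Rightarrow> nat \<Rightarrow> 'r) \<Rightarrow> 'r" where
  "matrix_trace R n A = (\<Oplus>\<^bsub>R\<^esub>i \<in> {..<n}. A i i)"

definition matrix_det :: "('r, 'x) ring_scheme \<Rightarrow> nat \<Rightarrow> (nat \<Rightarrow> nat \<Rightarrow> 'r) \<Rightarrow> 'r" where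
  "matrix_det R n A =
     (\<Oplus>\<^bsub>R\<^esub>\<pi> \<in> {\<pi>. \<pi> permutes {..<n}}.
        (if evenperm \<pi> then \<one>\<^bsub>R\<^esub> else \<ominus>\<^bsub>R\<^esub> \<one>\<^bsub>R\<^esub>) \<otimes>\<^bsub>R\<^esub> (\<Otimes>\<^bsub>R\<^esub>i \<in> {..<n}. A i (\<pi> i)))"

definition matrix_charpoly ::
  "('r, 'x) ring_scheme \<Rightarrow> nat \<Rightarrow> (nat \<Rightarrow> nat \<Rightarrow> 'r) \<Rightarrow> nat \<Rightarrow> 'r" where
  "matrix_charpoly R n A =
     matrix_det (UP R) n (\<lambda>i j.
       (if i = j then monom (UP R) \<one>\<^bsub>R\<^esub> 1 else \<zero>\<^bsub>UP R\<^esub>) \<ominus>\<^bsub>UP R\<^esub> monom (UP R) (A i j) 0)"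

text \<open>
  For an endomorphism \<open>\<phi>\<close> of the restriction to \<open>U\<close> of a sheaf that is locally free of rank \<open>n\<close>,
  given by its components \<open>\<phi> V\<close> for open \<open>V \<subseteq> U\<close>, the traces and characteristic polynomials
  of its matrices glue to a unique section, respectively polynomial, over \<open>U\<close>.
\<close>

definition endo_trace ::
  "'p topology \<Rightarrow> ('p, 'r) ring_presheaf \<Rightarrow> ('p, 'r, 'm) module_presheaf \<Rightarrow> nat \<Rightarrow> 'p set \<Rightarrow>
   ('p set \<Rightarrow> 'm \<Rightarrow> 'm) \<Rightarrow> 'r" where
  "endo_trace X OX M n U \<phi> =
     (THE t. t \<in> carrier (sec OX U) \<and>
        (\<forall>V e. V \<subseteq> U \<and> free_basis X OX M n V e \<longrightarrow>
           res OX U V t = matrix_trace (sec OX V) n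
             (endo_matrix (sec OX V) (sec M V) n e (\<phi> V))))"

definition endo_charpoly ::
  "'p topology \<Rightarrow> ('p, 'r) ring_presheaf \<Rightarrow> ('p, 'r, 'm) module_presheaf \<Rightarrow> nat \<Rightarrow> 'p set \<Rightarrow>
   ('p set \<Rightarrow> 'm \<Rightarrow> 'm) \<Rightarrow> nat \<Rightarrow> 'r" where
  "endo_charpoly X OX M n U \<phi> =
     (THE p. p \<in> carrier (UP (sec OX U)) \<and>
        (\<forall>V e. V \<subseteq> U \<and> free_basis X OX M n V e \<longrightarrow>
           (\<forall>k. res OX U V (coeff (UP (sec OX U)) p k) =
              coeff (UP (sec OX V)) (matrix_charpoly (sec OX V) n
                (endo_matrix (sec OX V) (sec M V) n e (\<phi> V))) k)))"


section \<open>Quadratic algebras and pseudoregular modules\<close>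

definition quadratic_algebra ::
  "'p topology \<Rightarrow> ('p, 'r) ring_presheaf \<Rightarrow> ('p, 'r, 's) module_presheaf \<Rightarrow> bool" where
  "quadratic_algebra X OX OY \<longleftrightarrow> sheaf_of_algebras X OX OY \<and> locally_free X OX OY 2"

definition rank_balanced ::
  "'p topology \<Rightarrow> ('p, 'r) ring_presheaf \<Rightarrow> ('p, 'r, 's) module_presheaf \<Rightarrow>
   ('p, 's, 'm) module_presheaf \<Rightarrow> bool" where
  "rank_balanced X OX OY I \<longleftrightarrow>
     sheaf_of_modules X OY I \<and> locally_free X OX (restrict_scalars OY I) 2"

definition algebra_mult ::
  "('p, 'r, 's) module_presheaf \<Rightarrow> 'p set \<Rightarrow> 's \<Rightarrow> 'p set \<Rightarrow> 's \<Rightarrow> 's" where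
  "algebra_mult OY U \<alpha> = (\<lambda>V y. res OY U V \<alpha> \<otimes>\<^bsub>sec OY V\<^esub> y)"

definition module_mult ::
  "('p, 'r, 's) module_presheaf \<Rightarrow> ('p, 's, 'm) module_presheaf \<Rightarrow>
   'p set \<Rightarrow> 's \<Rightarrow> 'p set \<Rightarrow> 'm \<Rightarrow> 'm" where
  "module_mult OY I U \<alpha> = (\<lambda>V m. res OY U V \<alpha> \<odot>\<^bsub>sec I V\<^esub> m)"

definition pseudoregular ::
  "'p topology \<Rightarrow> ('p, 'r) ring_presheaf \<Rightarrow> ('p, 'r, 's) module_presheaf \<Rightarrow>
   ('p, 's, 'm) module_presheaf \<Rightarrow> bool" where
  "pseudoregular X OX OY I \<longleftrightarrow>
     (\<exists>\<U>. (\<forall>U \<in> \<U>. affine_open X OX U) \<and> \<Union>\<U> = topspace X \<and>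
        (\<forall>U \<in> \<U>. \<forall>\<alpha> \<in> carrier (sec OY U).
           endo_charpoly X OX OY 2 U (algebra_mult OY U \<alpha>) =
           endo_charpoly X OX (restrict_scalars OY I) 2 U (module_mult OY I U \<alpha>)))"

end

theory Submission
  imports
    Defs
    "HOL-Algebra.Ring_Divisibility"
begin

text \<open>
  In rank two the characteristic polynomial is \<open>T\<^sup>2 - t T + n\<close>, so it determines the trace \<open>t\<close>. Conversely,
  by Cayley-Hamilton multiplication by \<open>\<alpha>\<close> on the module satisfies both \<open>\<alpha>\<^sup>2 - t \<alpha> + n = 0\<close>, inherited
  from the algebra, and its own characteristic equation; if the traces agree, the two determinants
  act equally on a free module and hence agree.

  Pseudoregularity only compares sections over the members of an affine cover, whereas the trace
  condition concerns all open sets. On an affine open set, a section of a locally free sheaf over a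
  basic open \<open>D(f)\<close> extends to the whole set after multiplication by a power of \<open>f\<close>; since \<open>f\<close> is
  invertible on \<open>D(f)\<close> and the trace is linear over the base, equality of the traces passes from
  sections over the affine open set to local sections.
\<close>

section \<open>Sections of the structure sheaf of a spectrum\<close>

text \<open>Trace and characteristic polynomial are defined by \<open>THE\<close>, as sections that
  restrict to a matrix expression in every local basis. Nothing can be said about them until these
  expressions are known to be independent of the basis and compatible with restriction, so that they
  glue. The determinant is glued as well, to name the constant coefficient.

  The serious step is the extension of sections. Finite subcovers never occur in it: the elements
  \<open>r\<close> of the chart ring for which a suitable assertion holds over \<open>D r\<close>
  form an ideal, and an ideal whose basic open sets cover \<open>D g\<close> contains a power of
  \<open>g\<close>. Two local extensions agree on an overlap only after a further power of
  \<open>f\<close>, so extension rests on a companion statement: a section vanishing where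
  \<open>f\<close> is invertible is killed by a power of \<open>f\<close>. Both are proved for the
  structure sheaf, then coordinatewise for free modules, then by the ideal argument for locally free
  ones.

  Extension is applied only to the two members of a basis of the algebra over a small
  \<open>D r\<close>; additivity and linearity of the trace reach all other sections.\<close>

lemma (in abelian_group) minus_eq_zero_iff:
  assumes "x \<in> carrier G" "y \<in> carrier G"
  shows "x \<ominus> y = \<zero> \<longleftrightarrow> x = y"
  using assms by (metis a_inv_closed a_minus_def minus_equality minus_minus r_neg)

section \<open>Prime ideals avoiding the powers of an element\<close>

context cring
begin

text \<open>An ideal that is maximal among those containing \<open>J\<close> and avoiding the powers
  of \<open>f\<close> is prime: if neither \<open>a\<close> nor \<open>b\<close> lies in it,
  adjoining either one captures a power of \<open>f\<close>, and the product of these two powers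
  lies in the ideal generated by it and \<open>a \<otimes> b\<close>.\<close>

lemma exists_primeideal_avoiding_powers:
  assumes J: "ideal J R" and f: "f \<in> carrier R" and avoid: "\<And>n::nat. f [^] n \<notin> J"
  shows "\<exists>P. primeideal P R \<and> J \<subseteq> P \<and> f \<notin> P"
proof -
  define S where "S = {K. ideal K R \<and> J \<subseteq> K \<and> (\<forall>n::nat. f [^] n \<notin> K)}"
  have "\<exists>P\<in>S. \<forall>K\<in>S. P \<subseteq> K \<longrightarrow> K = P"
  proof (rule subset_Zorn)
    fix C assume C: "subset.chain S C"
    show "\<exists>U\<in>S. \<forall>K\<in>C. K \<subseteq> U"
    proof (cases "C = {}")
      case True
      then show ?thesis using J avoid S_def by blast
    next
      case False
      have CS: "C \<subseteq> S" using C by (simp add: pred_on.chain_def)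
      then have "subset.chain {K. ideal K R} C"
        using C by (auto simp: pred_on.chain_def S_def)
      then have "ideal (\<Union>C) R" using chain_Union_is_ideal[of C] False by simp
      then have "\<Union>C \<in> S" using False CS by (auto simp: S_def)
      then show ?thesis by blast
    qed
  qed
  then obtain P where PS: "P \<in> S" and max: "\<forall>K\<in>S. P \<subseteq> K \<longrightarrow> K = P" ..
  have P: "ideal P R" "J \<subseteq> P" "\<And>n::nat. f [^] n \<notin> P" using PS by (auto simp: S_def)
  \<comment> \<open>Maximality of \<open>P\<close>: the ideal generated by \<open>P\<close> and
    \<open>a\<close> is strictly larger, so it meets the powers of \<open>f\<close>.\<close>
  have hit: "\<exists>n::nat. \<exists>p\<in>P. \<exists>x\<in>carrier R. f [^] n = x \<otimes> a \<oplus> p" if a: "a \<in> carrier R" "a \<notin> P" for a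
  proof -
    let ?K = "PIdl a <+>\<^bsub>R\<^esub> P"
    have K: "ideal ?K R" by (rule add_ideals[OF cgenideal_ideal[OF a(1)] P(1)])
    have PK: "P \<subseteq> ?K"
    proof
      fix p assume p: "p \<in> P"
      then have "p \<in> carrier R" using P(1) ideal.Icarr by metis
      then have "p = \<zero> \<oplus> p" by simp
      moreover have "\<zero> \<in> PIdl a"
        by (rule additive_subgroup.zero_closed[OF ideal.axioms(1)[OF cgenideal_ideal[OF a(1)]]])
      ultimately show "p \<in> ?K" using p by (auto simp: set_add_def')
    qed
    have "a \<in> ?K"
    proof -
      have "a = a \<oplus> \<zero>" using a by simp
      moreover have "\<zero> \<in> P" by (rule additive_subgroup.zero_closed[OF ideal.axioms(1)[OF P(1)]])
      ultimately show ?thesis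
        using cgenideal_self[OF a(1)] by (auto simp: set_add_def')
    qed
    then have "?K \<noteq> P" using a by blast
    then have "?K \<notin> S" using max PK by blast
    then obtain n :: nat where "f [^] n \<in> ?K" using K PK P(2) by (auto simp: S_def)
    then show ?thesis by (auto simp: set_add_def' cgenideal_def)
  qed
  have "primeideal P R"
  proof (rule primeidealI[OF P(1) is_cring])
    \<comment> \<open>The zeroth power of \<open>f\<close> is the unit, so avoiding all powers
      includes being proper.\<close>
    show "carrier R \<noteq> P" using P(3)[of 0] by auto
  next
    fix a b assume ab: "a \<in> carrier R" "b \<in> carrier R" "a \<otimes> b \<in> P"
    show "a \<in> P \<or> b \<in> P"
    proof (rule ccontr)
      assume "\<not> (a \<in> P \<or> b \<in> P)"
      then obtain m n :: nat and p q x y where mn: "p \<in> P" "q \<in> P" "x \<in> carrier R" "y \<in> carrier R"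
        "f [^] m = x \<otimes> a \<oplus> p" "f [^] n = y \<otimes> b \<oplus> q"
        using hit[of a] hit[of b] ab by metis
      interpret P: ideal P R by (rule P(1))
      have pq: "p \<in> carrier R" "q \<in> carrier R" using mn by auto
      have "f [^] (m + n) = (x \<otimes> a \<oplus> p) \<otimes> (y \<otimes> b \<oplus> q)"
        using f mn by (simp add: nat_pow_mult[symmetric])
      \<comment> \<open>Only the first summand is without a factor \<open>p\<close> or
        \<open>q\<close>, and there the assumption on \<open>a \<otimes> b\<close> applies.\<close>
      also have "\<dots> = (x \<otimes> y) \<otimes> (a \<otimes> b) \<oplus> ((x \<otimes> a \<oplus> p) \<otimes> q \<oplus> (y \<otimes> b) \<otimes> p)"
        using ab(1,2) mn(3,4) pq by algebra
      also have "\<dots> \<in> P"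
        by (intro P.a_closed P.I_l_closed m_closed a_closed ab mn pq)
      finally show False using P(3) by blast
    qed
  qed
  moreover have "f \<notin> P" using P(3)[of 1] f by simp
  ultimately show ?thesis using P(2) by blast
qed

text \<open>Quasi-compactness in algebraic form: the last hypothesis says that the basic open sets
  of the members of \<open>J\<close> cover that of \<open>f\<close>. Local statements on the
  spectrum become global through this fact.\<close>

lemma power_mem_idealI:
  assumes "ideal J R" "f \<in> carrier R" "\<And>P. primeideal P R \<Longrightarrow> f \<notin> P \<Longrightarrow> \<not> J \<subseteq> P"
  shows "\<exists>n::nat. f [^] n \<in> J"
proof (rule ccontr)
  assume "\<not> (\<exists>n::nat. f [^] n \<in> J)"
  then obtain P where "primeideal P R" "J \<subseteq> P" "f \<notin> P"
    using exists_primeideal_avoiding_powers[OF assms(1,2)] by metis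
  then show False using assms(3) by simp
qed

end

section \<open>Germs of fractions and their arithmetic\<close>

abbreviation germ :: "('r, 'x) ring_scheme \<Rightarrow> 'r set \<Rightarrow> 'r \<Rightarrow> 'r \<Rightarrow> ('r \<times> 'r) set" where
  "germ A P a s \<equiv> fraction A (carrier A - P) a s"

context cring
begin

text \<open>Transitivity of equality of fractions. The witness contains the middle denominator
  \<open>t\<close> besides \<open>u\<close> and \<open>v\<close>, because \<open>b\<close> is
  eliminated by cross multiplication and \<open>t\<close> cannot be cancelled in the presence of
  zero divisors.\<close>

lemma fraction_rel_trans:
  assumes c: "a \<in> carrier R" "b \<in> carrier R" "c \<in> carrier R" "s \<in> carrier R" "t \<in> carrier R"
    "r \<in> carrier R" "u \<in> carrier R" "v \<in> carrier R"
    and u: "u \<otimes> (t \<otimes> a \<ominus> s \<otimes> b) = \<zero>" and v: "v \<otimes> (r \<otimes> b \<ominus> t \<otimes> c) = \<zero>"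
  shows "(u \<otimes> v \<otimes> t) \<otimes> (r \<otimes> a \<ominus> s \<otimes> c) = \<zero>"
proof -
  have "(u \<otimes> v \<otimes> t) \<otimes> (r \<otimes> a \<ominus> s \<otimes> c) =
    (v \<otimes> r) \<otimes> (u \<otimes> (t \<otimes> a \<ominus> s \<otimes> b)) \<oplus> (u \<otimes> s) \<otimes> (v \<otimes> (r \<otimes> b \<ominus> t \<otimes> c))"
    using c by algebra
  then show ?thesis using c by (simp add: u v)
qed

lemma germ_complement_mult_closed:
  assumes "primeideal P R" "u \<in> carrier R - P" "v \<in> carrier R - P"
  shows "u \<otimes> v \<in> carrier R - P"
proof -
  interpret primeideal P R by (rule assms(1))
  show ?thesis using assms(2,3) I_prime by blast
qed

lemma one_notin_primeideal:
  assumes "primeideal P R" shows "\<one> \<in> carrier R - P"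
proof -
  interpret primeideal P R by (rule assms)
  show ?thesis using one_imp_carrier I_notcarr by blast
qed

lemma germ_self:
  assumes "primeideal P R" "a \<in> carrier R" "s \<in> carrier R - P"
  shows "(a, s) \<in> germ R P a s"
proof -
  have "\<one> \<otimes> (s \<otimes> a \<ominus> s \<otimes> a) = \<zero>" using assms by (simp add: a_minus_def r_neg)
  then show ?thesis
    using assms one_notin_primeideal[OF assms(1)] unfolding fraction_def by blast
qed

text \<open>A germ is a set of pairs, so equality means two inclusions. Each is transitivity of the
  relation, and the product of the witnesses stays outside \<open>P\<close> by primality; the second
  inclusion follows from the first because exchanging the fractions only changes a sign.\<close>

lemma germ_eqI:
  assumes P: "primeideal P R" and c: "a \<in> carrier R" "b \<in> carrier R" "s \<in> carrier R - P" "t \<in> carrier R - P"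
    and u: "u \<in> carrier R - P" "u \<otimes> (t \<otimes> a \<ominus> s \<otimes> b) = \<zero>"
  shows "germ R P a s = germ R P b t"
proof -
  have sub: "germ R P b t \<subseteq> germ R P a s"
    if c: "a \<in> carrier R" "b \<in> carrier R" "s \<in> carrier R - P" "t \<in> carrier R - P"
    and u: "u \<in> carrier R - P" "u \<otimes> (t \<otimes> a \<ominus> s \<otimes> b) = \<zero>" for a b s t
  proof
    fix x assume "x \<in> germ R P b t"
    then obtain d r v where x: "x = (d, r)" "d \<in> carrier R" "r \<in> carrier R - P" "v \<in> carrier R - P"
      "v \<otimes> (r \<otimes> b \<ominus> t \<otimes> d) = \<zero>" unfolding fraction_def by blast
    have "(u \<otimes> v \<otimes> t) \<otimes> (r \<otimes> a \<ominus> s \<otimes> d) = \<zero>"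
      by (rule fraction_rel_trans[of _ b]) (use c x u in auto)
    moreover have "u \<otimes> v \<otimes> t \<in> carrier R - P"
      using germ_complement_mult_closed[OF P] u(1) x(4) c(4) by blast
    ultimately show "x \<in> germ R P a s" using x c unfolding fraction_def by blast
  qed
  have cc: "s \<in> carrier R" "t \<in> carrier R" "u \<in> carrier R" using c u by auto
  have "u \<otimes> (s \<otimes> b \<ominus> t \<otimes> a) = \<ominus> (u \<otimes> (t \<otimes> a \<ominus> s \<otimes> b))"
    using c cc by algebra
  then have "u \<otimes> (s \<otimes> b \<ominus> t \<otimes> a) = \<zero>" by (simp add: u(2))
  then show ?thesis using sub[of a b s t] sub[of b a t s] c u by blast
qed

lemma germ_eqD:
  assumes P: "primeideal P R" and c: "b \<in> carrier R" "t \<in> carrier R - P"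
    and eq: "germ R P a s = germ R P b t"
  shows "\<exists>u \<in> carrier R - P. u \<otimes> (t \<otimes> a \<ominus> s \<otimes> b) = \<zero>"
proof -
  have "(b, t) \<in> germ R P a s" using germ_self[OF P c] eq by simp
  then show ?thesis unfolding fraction_def by blast
qed

lemma germ_eqI':
  assumes "primeideal P R" "a \<in> carrier R" "b \<in> carrier R" "s \<in> carrier R - P" "t \<in> carrier R - P"
    and "t \<otimes> a = s \<otimes> b"
  shows "germ R P a s = germ R P b t"
proof (rule germ_eqI[OF assms(1-5) one_notin_primeideal[OF assms(1)]])
  show "\<one> \<otimes> (t \<otimes> a \<ominus> s \<otimes> b) = \<zero>" using assms(2-6) by (simp add: a_minus_def r_neg)
qed

text \<open>Independence of the representatives. In both cases the witness is
  \<open>u \<otimes> v\<close>: the difference of the cross products is a combination of the two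
  given relations.\<close>

lemma germ_mult_cong:
  assumes P: "primeideal P R"
    and c: "a \<in> carrier R" "b \<in> carrier R" "s \<in> carrier R - P" "t \<in> carrier R - P"
      "a' \<in> carrier R" "b' \<in> carrier R" "s' \<in> carrier R - P" "t' \<in> carrier R - P"
    and eq: "germ R P a s = germ R P a' s'" "germ R P b t = germ R P b' t'"
  shows "germ R P (a \<otimes> b) (s \<otimes> t) = germ R P (a' \<otimes> b') (s' \<otimes> t')"
    and "germ R P (a \<otimes> t \<oplus> b \<otimes> s) (s \<otimes> t) = germ R P (a' \<otimes> t' \<oplus> b' \<otimes> s') (s' \<otimes> t')"
proof -
  obtain u v where uv: "u \<in> carrier R - P" "u \<otimes> (s' \<otimes> a \<ominus> s \<otimes> a') = \<zero>"
    "v \<in> carrier R - P" "v \<otimes> (t' \<otimes> b \<ominus> t \<otimes> b') = \<zero>"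
    using germ_eqD[OF P _ _ eq(1)] germ_eqD[OF P _ _ eq(2)] c by blast
  have cc: "s \<in> carrier R" "t \<in> carrier R" "s' \<in> carrier R" "t' \<in> carrier R"
    "u \<in> carrier R" "v \<in> carrier R" using c uv by auto
  have st: "s \<otimes> t \<in> carrier R - P" "s' \<otimes> t' \<in> carrier R - P" "u \<otimes> v \<in> carrier R - P"
    using germ_complement_mult_closed[OF P] c uv by auto
  have "u \<otimes> v \<otimes> ((s' \<otimes> t') \<otimes> (a \<otimes> b) \<ominus> (s \<otimes> t) \<otimes> (a' \<otimes> b')) =
    v \<otimes> t' \<otimes> b \<otimes> (u \<otimes> (s' \<otimes> a \<ominus> s \<otimes> a')) \<oplus> u \<otimes> s \<otimes> a' \<otimes> (v \<otimes> (t' \<otimes> b \<ominus> t \<otimes> b'))"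
    using c cc by algebra
  then have "u \<otimes> v \<otimes> ((s' \<otimes> t') \<otimes> (a \<otimes> b) \<ominus> (s \<otimes> t) \<otimes> (a' \<otimes> b')) = \<zero>"
    using c cc by (simp add: uv)
  then show "germ R P (a \<otimes> b) (s \<otimes> t) = germ R P (a' \<otimes> b') (s' \<otimes> t')"
    using c st by (intro germ_eqI[OF P]) auto
  have "u \<otimes> v \<otimes> ((s' \<otimes> t') \<otimes> (a \<otimes> t \<oplus> b \<otimes> s) \<ominus> (s \<otimes> t) \<otimes> (a' \<otimes> t' \<oplus> b' \<otimes> s')) =
    v \<otimes> t \<otimes> t' \<otimes> (u \<otimes> (s' \<otimes> a \<ominus> s \<otimes> a')) \<oplus> u \<otimes> s \<otimes> s' \<otimes> (v \<otimes> (t' \<otimes> b \<ominus> t \<otimes> b'))"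
    using c cc by algebra
  then have "u \<otimes> v \<otimes> ((s' \<otimes> t') \<otimes> (a \<otimes> t \<oplus> b \<otimes> s) \<ominus> (s \<otimes> t) \<otimes> (a' \<otimes> t' \<oplus> b' \<otimes> s')) = \<zero>"
    using c cc by (simp add: uv)
  then show "germ R P (a \<otimes> t \<oplus> b \<otimes> s) (s \<otimes> t) = germ R P (a' \<otimes> t' \<oplus> b' \<otimes> s') (s' \<otimes> t')"
    using c cc st by (intro germ_eqI[OF P]) auto
qed

lemma germ_memD:
  assumes P: "primeideal P R" and c: "a \<in> carrier R" "s \<in> carrier R - P" and x: "(b, t) \<in> germ R P a s"
  shows "b \<in> carrier R" "t \<in> carrier R - P" "germ R P a s = germ R P b t"
proof -
  show b: "b \<in> carrier R" "t \<in> carrier R - P" using x unfolding fraction_def by auto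
  obtain u where "u \<in> carrier R - P" "u \<otimes> (t \<otimes> a \<ominus> s \<otimes> b) = \<zero>"
    using x unfolding fraction_def by auto
  then show "germ R P a s = germ R P b t" using germ_eqI[OF P] c b by blast
qed

text \<open>The operations of \<open>localization\<close> are unions over all representatives of
  both arguments. Such a union collapses to one class when the result does not depend on the
  representatives and both classes are inhabited.\<close>

lemma UN_pairs_constant:
  assumes "x \<noteq> {}" "y \<noteq> {}" "\<And>a s b t. (a, s) \<in> x \<Longrightarrow> (b, t) \<in> y \<Longrightarrow> F a s b t = c"
  shows "(\<Union>(a, s) \<in> x. \<Union>(b, t) \<in> y. F a s b t) = c"
proof (rule equalityI)
  show "(\<Union>(a, s) \<in> x. \<Union>(b, t) \<in> y. F a s b t) \<subseteq> c" using assms(3) by auto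
  obtain a s b t where "(a, s) \<in> x" "(b, t) \<in> y" using assms(1,2) by auto
  then show "c \<subseteq> (\<Union>(a, s) \<in> x. \<Union>(b, t) \<in> y. F a s b t)" using assms(3) by blast
qed

lemma germ_mult:
  assumes P: "primeideal P R"
    and c: "a \<in> carrier R" "b \<in> carrier R" "s \<in> carrier R - P" "t \<in> carrier R - P"
  shows "germ R P a s \<otimes>\<^bsub>local_ring_at R P\<^esub> germ R P b t = germ R P (a \<otimes> b) (s \<otimes> t)"
proof -
  have "germ R P (a' \<otimes> b') (s' \<otimes> t') = germ R P (a \<otimes> b) (s \<otimes> t)"
    if "(a', s') \<in> germ R P a s" "(b', t') \<in> germ R P b t" for a' s' b' t'
    using germ_mult_cong(1)[OF P] germ_memD[OF P _ _ that(1)] germ_memD[OF P _ _ that(2)] c by metis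
  moreover have "germ R P a s \<noteq> {}" "germ R P b t \<noteq> {}"
    using germ_self[OF P c(1,3)] germ_self[OF P c(2,4)] by blast+
  ultimately show ?thesis
    by (simp add: localization_def UN_pairs_constant)
qed

lemma germ_add:
  assumes P: "primeideal P R"
    and c: "a \<in> carrier R" "b \<in> carrier R" "s \<in> carrier R - P" "t \<in> carrier R - P"
  shows "germ R P a s \<oplus>\<^bsub>local_ring_at R P\<^esub> germ R P b t = germ R P (a \<otimes> t \<oplus> b \<otimes> s) (s \<otimes> t)"
proof -
  have "germ R P (a' \<otimes> t' \<oplus> b' \<otimes> s') (s' \<otimes> t') = germ R P (a \<otimes> t \<oplus> b \<otimes> s) (s \<otimes> t)"
    if "(a', s') \<in> germ R P a s" "(b', t') \<in> germ R P b t" for a' s' b' t'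
    using germ_mult_cong(2)[OF P] germ_memD[OF P _ _ that(1)] germ_memD[OF P _ _ that(2)] c by metis
  moreover have "germ R P a s \<noteq> {}" "germ R P b t \<noteq> {}"
    using germ_self[OF P c(1,3)] germ_self[OF P c(2,4)] by blast+
  ultimately show ?thesis
    by (simp add: localization_def UN_pairs_constant)
qed

end

section \<open>Basic open sets and sections given by a single fraction\<close>

definition basic_open :: "('r, 'x) ring_scheme \<Rightarrow> 'r \<Rightarrow> 'r set set" where
  "basic_open A f = {P. primeideal P A \<and> f \<notin> P}"

text \<open>The section \<open>a / s\<close> over \<open>W\<close>, meaningful when \<open>s\<close>
  lies outside every prime in \<open>W\<close>. The restriction to \<open>W\<close> makes it
  extensional, as membership in the carrier of \<open>spec_sheaf\<close> demands.\<close>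

definition frac_section ::
  "('r, 'x) ring_scheme \<Rightarrow> 'r set set \<Rightarrow> 'r \<Rightarrow> 'r \<Rightarrow> 'r set \<Rightarrow> ('r \<times> 'r) set" where
  "frac_section A W a s = (\<lambda>P \<in> W. germ A P a s)"

context cring
begin

lemma openin_spec_primeideal: "openin (spec_topology R) W \<Longrightarrow> P \<in> W \<Longrightarrow> primeideal P R"
  unfolding openin_spec_topology spec_open_def by blast

lemma openin_basic_open: "f \<in> carrier R \<Longrightarrow> openin (spec_topology R) (basic_open R f)"
  unfolding openin_spec_topology spec_open_def basic_open_def by (rule exI[of _ "{f}"]) auto

lemma basic_open_basis:
  assumes "openin (spec_topology R) W" "P \<in> W"
  shows "\<exists>f \<in> carrier R. P \<in> basic_open R f \<and> basic_open R f \<subseteq> W"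
  using assms unfolding openin_spec_topology spec_open_def basic_open_def by blast

lemma basic_open_mult:
  assumes "f \<in> carrier R" "g \<in> carrier R"
  shows "basic_open R (f \<otimes> g) = basic_open R f \<inter> basic_open R g"
proof -
  have "f \<otimes> g \<in> P \<longleftrightarrow> f \<in> P \<or> g \<in> P" if "primeideal P R" for P
  proof -
    interpret primeideal P R by (rule that)
    show ?thesis using I_prime[OF assms] I_l_closed[OF _ assms(1), of g] I_r_closed[OF _ assms(2), of f] by blast
  qed
  then show ?thesis unfolding basic_open_def by blast
qed

text \<open>The exponent is positive because the zeroth power is the unit, whose basic open set is
  the whole spectrum.\<close>

lemma basic_open_pow_Suc: "f \<in> carrier R \<Longrightarrow> basic_open R (f [^] Suc n) = basic_open R f"
  by (induction n) (auto simp: basic_open_mult)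

lemma basic_open_pow:
  assumes "f \<in> carrier R" "primeideal P R" "f \<notin> P"
  shows "f [^] (n::nat) \<in> carrier R - P"
proof (cases n)
  case 0
  then show ?thesis using one_notin_primeideal[OF assms(2)] by simp
next
  case (Suc m)
  then show ?thesis using basic_open_pow_Suc[OF assms(1), of m] assms unfolding basic_open_def by auto
qed

lemma basic_open_add:
  assumes "f \<in> carrier R" "g \<in> carrier R"
  shows "basic_open R (f \<oplus> g) \<subseteq> basic_open R f \<union> basic_open R g"
proof -
  have "f \<oplus> g \<in> P" if "primeideal P R" "f \<in> P" "g \<in> P" for P
  proof -
    interpret primeideal P R by (rule that(1))
    show ?thesis using that(2,3) a_closed by simp
  qed
  then show ?thesis unfolding basic_open_def by blast
qed

lemma basic_open_one: "basic_open R \<one> = topspace (spec_topology R)"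
proof
  show "basic_open R \<one> \<subseteq> topspace (spec_topology R)"
    using openin_basic_open[OF one_closed] openin_subset by blast
  show "topspace (spec_topology R) \<subseteq> basic_open R \<one>"
    using openin_spec_primeideal[OF openin_topspace] one_notin_primeideal unfolding basic_open_def by blast
qed

lemma basic_open_zero: "basic_open R \<zero> = {}"
proof -
  have "\<zero> \<in> P" if "primeideal P R" for P
  proof -
    interpret primeideal P R by (rule that(1))
    show ?thesis by (rule zero_closed)
  qed
  then show ?thesis unfolding basic_open_def by blast
qed

lemma frac_section_closed:
  assumes "openin (spec_topology R) W" "W \<subseteq> basic_open R s" "a \<in> carrier R" "s \<in> carrier R"
  shows "frac_section R W a s \<in> carrier (sec (spec_sheaf R) W)"
proof -
  have s: "s \<notin> P" if "P \<in> W" for P using that assms(2) unfolding basic_open_def by blast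
  have "\<exists>V. openin (spec_topology R) V \<and> P \<in> V \<and> V \<subseteq> W \<and>
      (\<exists>b \<in> carrier R. \<exists>f \<in> carrier R. \<forall>Q \<in> V. f \<notin> Q \<and> frac_section R W a s Q = germ R Q b f)"
    if "P \<in> W" for P
    using that assms s unfolding frac_section_def
    by (intro exI[of _ W] conjI bexI[of _ a] bexI[of _ s]) auto
  moreover have "frac_section R W a s \<in> (\<Pi>\<^sub>E P \<in> W. carrier (local_ring_at R P))"
    using assms(3,4) s unfolding frac_section_def localization_def by auto
  ultimately show ?thesis
    unfolding spec_sheaf_def by simp
qed

lemma frac_section_mult:
  assumes "W \<subseteq> basic_open R s" "W \<subseteq> basic_open R t"
    "a \<in> carrier R" "s \<in> carrier R" "b \<in> carrier R" "t \<in> carrier R"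
  shows "frac_section R W a s \<otimes>\<^bsub>sec (spec_sheaf R) W\<^esub> frac_section R W b t =
    frac_section R W (a \<otimes> b) (s \<otimes> t)"
proof -
  have "germ R P a s \<otimes>\<^bsub>local_ring_at R P\<^esub> germ R P b t = germ R P (a \<otimes> b) (s \<otimes> t)" if "P \<in> W" for P
    using that assms unfolding basic_open_def by (intro germ_mult) auto
  then show ?thesis unfolding spec_sheaf_def frac_section_def by (auto intro!: restrict_ext)
qed

lemma frac_section_add:
  assumes "W \<subseteq> basic_open R s" "W \<subseteq> basic_open R t"
    "a \<in> carrier R" "s \<in> carrier R" "b \<in> carrier R" "t \<in> carrier R"
  shows "frac_section R W a s \<oplus>\<^bsub>sec (spec_sheaf R) W\<^esub> frac_section R W b t =
    frac_section R W (a \<otimes> t \<oplus> b \<otimes> s) (s \<otimes> t)"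
proof -
  have "germ R P a s \<oplus>\<^bsub>local_ring_at R P\<^esub> germ R P b t = germ R P (a \<otimes> t \<oplus> b \<otimes> s) (s \<otimes> t)" if "P \<in> W" for P
    using that assms unfolding basic_open_def by (intro germ_add) auto
  then show ?thesis unfolding spec_sheaf_def frac_section_def by (auto intro!: restrict_ext)
qed

lemma frac_section_one: "frac_section R W \<one> \<one> = \<one>\<^bsub>sec (spec_sheaf R) W\<^esub>"
  unfolding frac_section_def spec_sheaf_def localization_def by simp

lemma frac_section_eqI:
  assumes "W \<subseteq> basic_open R s" "W \<subseteq> basic_open R t"
    "a \<in> carrier R" "s \<in> carrier R" "b \<in> carrier R" "t \<in> carrier R" "t \<otimes> a = s \<otimes> b"
  shows "frac_section R W a s = frac_section R W b t"
proof -
  have "germ R P a s = germ R P b t" if "P \<in> W" for P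
    using that assms unfolding basic_open_def by (intro germ_eqI') auto
  then show ?thesis unfolding frac_section_def by (auto intro!: restrict_ext)
qed

lemma res_frac_section: "V \<subseteq> W \<Longrightarrow> res (spec_sheaf R) W V (frac_section R W a s) = frac_section R V a s"
  by (simp add: frac_section_def spec_sheaf_def Int_absorb1)

lemma annihilator_ideal:
  assumes a: "a \<in> carrier R" shows "ideal {r \<in> carrier R. r \<otimes> a = \<zero>} R"
proof (rule idealI[OF ring_axioms])
  show "subgroup {r \<in> carrier R. r \<otimes> a = \<zero>} (add_monoid R)"
  proof (rule add.subgroupI)
    show "{r \<in> carrier R. r \<otimes> a = \<zero>} \<noteq> {}" using l_null[OF a] by blast
  qed (use a in \<open>auto simp: l_minus l_distr\<close>)
qed (use a in \<open>auto simp: m_assoc, metis a m_lcomm r_null\<close>)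

text \<open>The annihilator of \<open>a\<close> is contained in no prime of
  \<open>basic_open R f\<close>, so it contains a power of \<open>f\<close>.\<close>

lemma germ_vanishing:
  assumes a: "a \<in> carrier R" and f: "f \<in> carrier R"
    and eq: "\<And>P. P \<in> basic_open R f \<Longrightarrow> \<exists>u \<in> carrier R - P. u \<otimes> a = \<zero>"
  shows "\<exists>n::nat. f [^] n \<otimes> a = \<zero>"
proof -
  have "\<exists>n::nat. f [^] n \<in> {r \<in> carrier R. r \<otimes> a = \<zero>}"
    using eq unfolding basic_open_def
    by (intro power_mem_idealI[OF annihilator_ideal[OF a] f]) blast
  then show ?thesis by blast
qed

end

section \<open>Sections over a basic open set are fractions\<close>

context cring
begin

text \<open>
  The elements \<open>h\<close> such that \<open>\<sigma>\<close> is a single fraction on \<open>D(h)\<close> form an ideal; this replaces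
  the usual appeal to the quasi-compactness of \<open>D(f)\<close>.
\<close>

lemma section_basic_open:
  assumes f: "f \<in> carrier R" and \<sigma>: "\<sigma> \<in> carrier (sec (spec_sheaf R) (basic_open R f))"
  shows "\<exists>n::nat. \<exists>a \<in> carrier R. \<sigma> = frac_section R (basic_open R f) a (f [^] n)"
proof -
  have ext: "\<sigma> \<in> extensional (basic_open R f)"
    using \<sigma> unfolding spec_sheaf_def by (simp add: PiE_def)
  \<comment> \<open>Denominators may be any power of \<open>h\<close>: multiples of \<open>h\<close>
    and sums of two members then keep the same shape, with a new exponent.\<close>
  define J where "J = {h \<in> carrier R. basic_open R h \<subseteq> basic_open R f \<and>
    (\<exists>N::nat. \<exists>a \<in> carrier R. \<forall>P \<in> basic_open R h. \<sigma> P = germ R P a (h [^] N))}"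
  have carr: "h \<in> carrier R" if "h \<in> J" for h using that J_def by blast
  \<comment> \<open>Over the smaller basic open set, \<open>a / h [^] N\<close> is expanded by
    \<open>r [^] N\<close>.\<close>
  have mult: "r \<otimes> h \<in> J" if h: "h \<in> J" and r: "r \<in> carrier R" for r h
  proof -
    obtain N :: nat and a where Na: "a \<in> carrier R" "\<forall>P \<in> basic_open R h. \<sigma> P = germ R P a (h [^] N)"
      using h unfolding J_def by blast
    have hR: "h \<in> carrier R" using carr[OF h] .
    have "\<sigma> P = germ R P (r [^] N \<otimes> a) ((r \<otimes> h) [^] N)" if P: "P \<in> basic_open R (r \<otimes> h)" for P
    proof -
      have P': "primeideal P R" "P \<in> basic_open R h" "h \<notin> P" "r \<otimes> h \<notin> P"
        using P basic_open_mult[OF r hR] unfolding basic_open_def by auto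
      have "germ R P a (h [^] N) = germ R P (r [^] N \<otimes> a) ((r \<otimes> h) [^] N)"
      proof (rule germ_eqI'[OF P'(1)])
        show "h [^] N \<in> carrier R - P" "(r \<otimes> h) [^] N \<in> carrier R - P"
          using basic_open_pow[OF _ P'(1)] P' hR r by auto
        show "(r \<otimes> h) [^] N \<otimes> a = h [^] N \<otimes> (r [^] N \<otimes> a)"
          using hR r Na(1) by (simp add: nat_pow_distrib m_assoc m_lcomm)
      qed (use Na r in auto)
      then show ?thesis using Na(2) P' by simp
    qed
    moreover have "basic_open R (r \<otimes> h) \<subseteq> basic_open R f"
      using h basic_open_mult[OF r hR] unfolding J_def by blast
    moreover have "r [^] N \<otimes> a \<in> carrier R" "r \<otimes> h \<in> carrier R" using r Na hR by auto
    ultimately show ?thesis unfolding J_def by blast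
  qed
  have add: "h \<oplus> l \<in> J" if h: "h \<in> J" and l: "l \<in> J" for h l
  proof -
    obtain N a where Na: "a \<in> carrier R" "\<forall>P \<in> basic_open R h. \<sigma> P = germ R P a (h [^] (N::nat))"
      using h unfolding J_def by blast
    obtain M b where Mb: "b \<in> carrier R" "\<forall>P \<in> basic_open R l. \<sigma> P = germ R P b (l [^] (M::nat))"
      using l unfolding J_def by blast
    have hl: "h \<in> carrier R" "l \<in> carrier R" using carr h l by auto
    \<comment> \<open>Where both \<open>h\<close> and \<open>l\<close> are outside the prime, both
      fractions represent \<open>\<sigma>\<close>. The difference of the cross products thus
      vanishes in all these local rings, and one power of \<open>h \<otimes> l\<close> kills
      it.\<close>
    have "\<exists>K::nat. (h \<otimes> l) [^] K \<otimes> (l [^] M \<otimes> a \<ominus> h [^] N \<otimes> b) = \<zero>"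
    proof (rule germ_vanishing)
      fix P assume "P \<in> basic_open R (h \<otimes> l)"
      then have P: "P \<in> basic_open R h" "P \<in> basic_open R l" "primeideal P R" "h \<notin> P" "l \<notin> P"
        using basic_open_mult[OF hl] unfolding basic_open_def by auto
      show "\<exists>u\<in>carrier R - P. u \<otimes> (l [^] M \<otimes> a \<ominus> h [^] N \<otimes> b) = \<zero>"
        using Na(2) Mb(2) P basic_open_pow[OF hl(2) P(3,5)] by (intro germ_eqD[OF P(3) Mb(1)]) auto
    qed (use hl Na Mb in auto)
    then obtain K :: nat where K: "(h \<otimes> l) [^] K \<otimes> (l [^] M \<otimes> a \<ominus> h [^] N \<otimes> b) = \<zero>" ..
    \<comment> \<open>Expanding the two fractions by \<open>h [^] K\<close> and
      \<open>l [^] K\<close> absorbs the annihilating power: the cross products of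
      \<open>a' / s\<close> and \<open>b' / t\<close> agree in the ring itself.\<close>
    define a' b' s t where "a' = h [^] K \<otimes> a" and "b' = l [^] K \<otimes> b"
      and "s = h [^] (K + N)" and "t = l [^] (K + M)"
    have cc: "a' \<in> carrier R" "b' \<in> carrier R" "s \<in> carrier R" "t \<in> carrier R"
      using hl Na Mb by (auto simp: a'_def b'_def s_def t_def)
    have st: "t \<otimes> a' = s \<otimes> b'"
    proof -
      define hK lK hN lM where p: "hK = h [^] K" "lK = l [^] K" "hN = h [^] N" "lM = l [^] M"
      have pc: "hK \<in> carrier R" "lK \<in> carrier R" "hN \<in> carrier R" "lM \<in> carrier R"
        using hl by (auto simp: p)
      have ac: "a \<in> carrier R" "b \<in> carrier R" using Na Mb by auto
      have "t \<otimes> a' \<ominus> s \<otimes> b' = (lK \<otimes> lM) \<otimes> (hK \<otimes> a) \<ominus> (hK \<otimes> hN) \<otimes> (lK \<otimes> b)"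
        by (simp add: a'_def b'_def s_def t_def p hl nat_pow_mult)
      also have "\<dots> = (hK \<otimes> lK) \<otimes> (lM \<otimes> a \<ominus> hN \<otimes> b)"
        using pc ac by algebra
      also have "\<dots> = \<zero>" using K hl by (simp add: p nat_pow_distrib)
      finally show ?thesis using cc by simp
    qed
    \<comment> \<open>A prime that misses \<open>h \<oplus> l\<close> misses \<open>s\<close> or
      \<open>t\<close>, so a power of \<open>h \<oplus> l\<close> is a combination of
      \<open>s\<close> and \<open>t\<close>. This plays the role of a partition of unity.\<close>
    have "\<exists>n::nat. (h \<oplus> l) [^] n \<in> PIdl s <+>\<^bsub>R\<^esub> PIdl t"
    proof (rule power_mem_idealI)
      show "ideal (PIdl s <+>\<^bsub>R\<^esub> PIdl t) R"
        by (rule add_ideals[OF cgenideal_ideal[OF cc(3)] cgenideal_ideal[OF cc(4)]])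
      fix P assume P: "primeideal P R" "h \<oplus> l \<notin> P"
      have "s \<in> PIdl s <+>\<^bsub>R\<^esub> PIdl t" "t \<in> PIdl s <+>\<^bsub>R\<^esub> PIdl t"
      proof -
        have "s = \<one> \<otimes> s \<oplus> \<zero> \<otimes> t" "t = \<zero> \<otimes> s \<oplus> \<one> \<otimes> t" using cc by auto
        then show "s \<in> PIdl s <+>\<^bsub>R\<^esub> PIdl t" "t \<in> PIdl s <+>\<^bsub>R\<^esub> PIdl t"
          unfolding set_add_def' cgenideal_def using one_closed zero_closed by blast+
      qed
      moreover have "s \<notin> P \<or> t \<notin> P"
        using basic_open_add[OF hl] P basic_open_pow[OF hl(1) P(1)] basic_open_pow[OF hl(2) P(1)]
        unfolding basic_open_def s_def t_def by blast
      ultimately show "\<not> PIdl s <+>\<^bsub>R\<^esub> PIdl t \<subseteq> P" by blast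
    qed (use hl in auto)
    then obtain n :: nat and u v where uv: "u \<in> carrier R" "v \<in> carrier R" "(h \<oplus> l) [^] n = u \<otimes> s \<oplus> v \<otimes> t"
      by (auto simp: set_add_def' cgenideal_def)
    \<comment> \<open>The same combination, applied to the numerators. By \<open>st\<close>, the
      fraction with numerator \<open>c\<close> and denominator \<open>(h \<oplus> l) [^] n\<close>
      equals \<open>a' / s\<close> where \<open>s\<close> is a unit and \<open>b' / t\<close> where
      \<open>t\<close> is.\<close>
    define c where "c = u \<otimes> a' \<oplus> v \<otimes> b'"
    have c: "c \<in> carrier R" using cc uv by (simp add: c_def)
    have sc: "s \<otimes> c = (h \<oplus> l) [^] n \<otimes> a'"
    proof -
      have "s \<otimes> c = u \<otimes> s \<otimes> a' \<oplus> v \<otimes> (s \<otimes> b')" using cc uv by (simp add: c_def r_distr m_lcomm m_assoc)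
      also have "\<dots> = (u \<otimes> s \<oplus> v \<otimes> t) \<otimes> a'" using cc uv by (simp add: st[symmetric] l_distr m_assoc)
      finally show ?thesis by (simp add: uv)
    qed
    have tc: "t \<otimes> c = (h \<oplus> l) [^] n \<otimes> b'"
    proof -
      have "t \<otimes> c = u \<otimes> (t \<otimes> a') \<oplus> v \<otimes> t \<otimes> b'" using cc uv by (simp add: c_def r_distr m_lcomm m_assoc)
      also have "\<dots> = (u \<otimes> s \<oplus> v \<otimes> t) \<otimes> b'" using cc uv by (simp add: st l_distr m_assoc)
      finally show ?thesis by (simp add: uv)
    qed
    have "\<sigma> P = germ R P c ((h \<oplus> l) [^] n)" if P: "P \<in> basic_open R (h \<oplus> l)" for P
    proof -
      have pP: "primeideal P R" "h \<oplus> l \<notin> P" using P unfolding basic_open_def by auto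
      have n: "(h \<oplus> l) [^] n \<in> carrier R - P" using basic_open_pow[OF _ pP] hl by simp
      consider "P \<in> basic_open R h" | "P \<in> basic_open R l" using basic_open_add[OF hl] P by blast
      then show ?thesis
      proof cases
        case 1
        then have "h \<notin> P" unfolding basic_open_def by simp
        note pw = basic_open_pow[OF hl(1) pP(1) this]
        have "\<sigma> P = germ R P a (h [^] N)" using Na(2) 1 by blast
        also have "\<dots> = germ R P a' s"
          using pw[of "K + N"] pw[of N] Na(1) cc hl
          by (intro germ_eqI'[OF pP(1)]) (auto simp: a'_def s_def nat_pow_mult[symmetric] m_ac)
        also have "\<dots> = germ R P c ((h \<oplus> l) [^] n)"
          using pw[of "K + N"] cc c n sc by (intro germ_eqI'[OF pP(1)]) (auto simp: s_def)
        finally show ?thesis .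
      next
        case 2
        then have "l \<notin> P" unfolding basic_open_def by simp
        note pw = basic_open_pow[OF hl(2) pP(1) this]
        have "\<sigma> P = germ R P b (l [^] M)" using Mb(2) 2 by blast
        also have "\<dots> = germ R P b' t"
          using pw[of "K + M"] pw[of M] Mb(1) cc hl
          by (intro germ_eqI'[OF pP(1)]) (auto simp: b'_def t_def nat_pow_mult[symmetric] m_ac)
        also have "\<dots> = germ R P c ((h \<oplus> l) [^] n)"
          using pw[of "K + M"] cc c n tc by (intro germ_eqI'[OF pP(1)]) (auto simp: t_def)
        finally show ?thesis .
      qed
    qed
    moreover have "basic_open R (h \<oplus> l) \<subseteq> basic_open R f"
      using basic_open_add[OF hl] h l unfolding J_def by blast
    ultimately show ?thesis using hl c unfolding J_def by blast
  qed
  have zero: "\<zero> \<in> J" unfolding J_def using basic_open_zero by auto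
  have J: "ideal J R"
  proof (rule idealI[OF ring_axioms])
    show "subgroup J (add_monoid R)"
    proof (rule add.subgroupI)
      show "J \<subseteq> carrier R" using carr by blast
      show "J \<noteq> {}" using zero by blast
      show "\<ominus> a \<in> J" if "a \<in> J" for a
        using mult[OF that, of "\<ominus> \<one>"] carr[OF that] by (simp add: l_minus)
    qed (use add in auto)
    show "x \<otimes> a \<in> J" if "a \<in> J" "x \<in> carrier R" for a x using mult that by blast
    then show "a \<otimes> x \<in> J" if "a \<in> J" "x \<in> carrier R" for a x using that carr by (metis m_comm)
  qed
  have "\<exists>n::nat. f [^] n \<in> J"
  proof (rule power_mem_idealI[OF J f])
    fix P assume P: "primeideal P R" "f \<notin> P"
    then have "P \<in> basic_open R f" unfolding basic_open_def by simp
    then obtain V a g where V: "openin (spec_topology R) V" "P \<in> V" "V \<subseteq> basic_open R f"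
      and ag: "a \<in> carrier R" "g \<in> carrier R" "\<forall>Q\<in>V. g \<notin> Q \<and> \<sigma> Q = germ R Q a g"
      using \<sigma> unfolding spec_sheaf_def by auto
    obtain k where k: "k \<in> carrier R" "P \<in> basic_open R k" "basic_open R k \<subseteq> V"
      using basic_open_basis[OF V(1,2)] by blast
    \<comment> \<open>The local representation \<open>a / g\<close> holds on \<open>V\<close>, which
      need not be basic. It is cut down by \<open>k\<close> and expanded by \<open>k\<close>, so
      that its denominator \<open>g \<otimes> k\<close> is the element whose basic open set is
      considered.\<close>
    have P': "P \<in> basic_open R (g \<otimes> k)"
      using basic_open_mult[OF ag(2) k(1)] k V ag P unfolding basic_open_def by auto
    have "\<sigma> Q = germ R Q (a \<otimes> k) ((g \<otimes> k) [^] (1::nat))" if Q: "Q \<in> basic_open R (g \<otimes> k)" for Q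
    proof -
      have Q': "primeideal Q R" "g \<notin> Q" "g \<otimes> k \<notin> Q" "Q \<in> V"
        using Q k basic_open_mult[OF ag(2) k(1)] unfolding basic_open_def by auto
      have "germ R Q a g = germ R Q (a \<otimes> k) (g \<otimes> k)"
        using Q' ag k by (intro germ_eqI') (auto simp: m_ac)
      then show ?thesis using ag Q' k by simp
    qed
    moreover have "basic_open R (g \<otimes> k) \<subseteq> basic_open R f"
      using basic_open_mult[OF ag(2) k(1)] k V by blast
    ultimately have "g \<otimes> k \<in> J" unfolding J_def using ag k by blast
    then show "\<not> J \<subseteq> P" using P' unfolding basic_open_def by blast
  qed
  then obtain m :: nat where "f [^] m \<in> J" ..
  \<comment> \<open>One more factor makes the exponent positive, so that the basic open set of the
    power is that of \<open>f\<close>.\<close>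
  then have "f \<otimes> f [^] m \<in> J" using mult f by blast
  then have "f [^] Suc m \<in> J" using f by (simp add: m_comm)
  then obtain N :: nat and a where Na: "a \<in> carrier R"
    "\<forall>P \<in> basic_open R f. \<sigma> P = germ R P a ((f [^] Suc m) [^] N)"
    using basic_open_pow_Suc[OF f, of m] unfolding J_def by blast
  have "\<sigma> = frac_section R (basic_open R f) a (f [^] (Suc m * N))"
    unfolding nat_pow_pow[OF f, symmetric] frac_section_def
    by (rule extensionalityI[OF ext restrict_extensional]) (use Na(2) in simp)
  then show ?thesis using Na by blast
qed

end

section \<open>Sheaves\<close>

lemma sheaf_res_closed:
  assumes "sheaf X F" "openin X U" "openin X V" "V \<subseteq> U" "s \<in> carrier (sec F U)"
  shows "res F U V s \<in> carrier (sec F V)"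
  using assms(1)[unfolded sheaf_def, THEN conjunct1] assms(2-) by blast

lemma sheaf_res_id:
  assumes "sheaf X F" "openin X U" "s \<in> carrier (sec F U)"
  shows "res F U U s = s"
  using assms(1)[unfolded sheaf_def, THEN conjunct2, THEN conjunct1] assms(2-) by blast

lemma sheaf_res_trans:
  assumes "sheaf X F" "openin X U" "openin X V" "openin X W" "W \<subseteq> V" "V \<subseteq> U" "s \<in> carrier (sec F U)"
  shows "res F V W (res F U V s) = res F U W s"
  using assms(1)[unfolded sheaf_def, THEN conjunct2, THEN conjunct2, THEN conjunct1] assms(2-) by blast

lemma sheaf_glue:
  assumes "sheaf X F" "\<And>V. V \<in> \<U> \<Longrightarrow> openin X V" "\<And>V. V \<in> \<U> \<Longrightarrow> s V \<in> carrier (sec F V)"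
    "\<And>V W. V \<in> \<U> \<Longrightarrow> W \<in> \<U> \<Longrightarrow> res F V (V \<inter> W) (s V) = res F W (V \<inter> W) (s W)"
  shows "\<exists>!t. t \<in> carrier (sec F (\<Union>\<U>)) \<and> (\<forall>V \<in> \<U>. res F (\<Union>\<U>) V t = s V)"
  by (rule assms(1)[unfolded sheaf_def, THEN conjunct2, THEN conjunct2, THEN conjunct2, THEN spec,
        THEN spec, of \<U> s, THEN mp]) (use assms(2-) in blast)

text \<open>Uniqueness of glueing, applied to the family of restrictions of \<open>s\<close>: both
  \<open>s\<close> and \<open>t\<close> glue it.\<close>

lemma sheaf_separated:
  assumes F: "sheaf X F" and \<U>: "\<And>V. V \<in> \<U> \<Longrightarrow> openin X V" "U = \<Union>\<U>"
    and st: "s \<in> carrier (sec F U)" "t \<in> carrier (sec F U)"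
    and eq: "\<And>V. V \<in> \<U> \<Longrightarrow> res F U V s = res F U V t"
  shows "s = t"
proof -
  have U: "openin X U" using \<U> openin_Union by blast
  have "\<exists>!x. x \<in> carrier (sec F (\<Union>\<U>)) \<and> (\<forall>V \<in> \<U>. res F (\<Union>\<U>) V x = res F U V s)"
  proof (rule sheaf_glue[OF F \<U>(1)])
    fix V W assume V: "V \<in> \<U>" and W: "W \<in> \<U>"
    note o = \<U>(1)[OF V] \<U>(1)[OF W] openin_Int[OF \<U>(1)[OF V] \<U>(1)[OF W]]
    show "res F U V s \<in> carrier (sec F V)"
      using sheaf_res_closed[OF F U o(1) _ st(1)] V \<U>(2) by blast
    have VU: "V \<subseteq> U" "W \<subseteq> U" using V W \<U>(2) by auto
    show "res F V (V \<inter> W) (res F U V s) = res F W (V \<inter> W) (res F U W s)"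
      using sheaf_res_trans[OF F U o(1,3) _ VU(1) st(1)] sheaf_res_trans[OF F U o(2,3) _ VU(2) st(1)]
      by simp
  qed
  then show ?thesis using st eq \<U>(2) by metis
qed

lemma sheaf_separated2:
  assumes F: "sheaf X F" and o: "openin X V" "openin X V1" "openin X V2" "V \<subseteq> V1 \<union> V2"
    and st: "s \<in> carrier (sec F V)" "t \<in> carrier (sec F V)"
    and eq: "res F V (V \<inter> V1) s = res F V (V \<inter> V1) t" "res F V (V \<inter> V2) s = res F V (V \<inter> V2) t"
  shows "s = t"
  by (rule sheaf_separated[OF F, of "{V \<inter> V1, V \<inter> V2}"]) (use assms in auto)

lemma sheaf_glue2:
  assumes F: "sheaf X F" and o: "openin X V1" "openin X V2"
    and st: "s \<in> carrier (sec F V1)" "t \<in> carrier (sec F V2)"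
    and eq: "res F V1 (V1 \<inter> V2) s = res F V2 (V1 \<inter> V2) t"
  shows "\<exists>x \<in> carrier (sec F (V1 \<union> V2)). res F (V1 \<union> V2) V1 x = s \<and> res F (V1 \<union> V2) V2 x = t"
proof -
  \<comment> \<open>The family to be glued is indexed by open sets, so for equal sets the two
    sections must coincide; compatibility on the intersection then says just that.\<close>
  have V12: "s = t" if "V1 = V2" using that eq sheaf_res_id[OF F o(1)] st by simp
  define z where "z V = (if V = V1 then s else t)" for V
  have z: "z V1 = s" "z V2 = t" using V12 by (auto simp: z_def)
  have "\<exists>!x. x \<in> carrier (sec F (\<Union>{V1, V2})) \<and> (\<forall>V \<in> {V1, V2}. res F (\<Union>{V1, V2}) V x = z V)"
  proof (rule sheaf_glue[OF F])
    show "openin X V" "z V \<in> carrier (sec F V)" if "V \<in> {V1, V2}" for V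
      using that o st z by auto
    show "res F V (V \<inter> W) (z V) = res F W (V \<inter> W) (z W)" if "V \<in> {V1, V2}" "W \<in> {V1, V2}" for V W
      using that eq z by (auto simp: Int_commute)
  qed
  then show ?thesis using z by auto
qed

locale ring_sheaf =
  fixes X :: "'p topology" and OX :: "('p, 'r) ring_presheaf"
  assumes OX_rings: "sheaf_of_rings X OX"
begin

lemma OX_sheaf: "sheaf X OX" using OX_rings unfolding sheaf_of_rings_def by (elim conjE)

lemma OX_cring: "openin X V \<Longrightarrow> cring (sec OX V)"
  using OX_rings[unfolded sheaf_of_rings_def, THEN conjunct2, THEN conjunct1] by blast

lemma OX_res_hom:
  assumes "openin X U" "openin X V" "V \<subseteq> U"
  shows "ring_hom_cring (sec OX U) (sec OX V) (res OX U V)"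
  using OX_rings[unfolded sheaf_of_rings_def, THEN conjunct2, THEN conjunct2] assms
  by (intro ring_hom_cring.intro ring_hom_cring_axioms.intro OX_cring) blast+

lemmas OX_res_closed = sheaf_res_closed[OF OX_sheaf]
lemmas OX_res_trans = sheaf_res_trans[OF OX_sheaf]
lemmas OX_separated = sheaf_separated[OF OX_sheaf]

end

section \<open>Affine charts\<close>

text \<open>What is used of an affine open set \<open>U\<close> once the spectrum is eliminated. In
  the intended instance \<open>D f\<close> is the preimage of the basic open set of
  \<open>f\<close>, and \<open>\<phi> a\<close> is the section given by \<open>a / 1\<close>.
  \<open>D_unit\<close>, \<open>D_section\<close> and \<open>D_vanish\<close> together say that
  sections over \<open>D f\<close> behave like the localization of \<open>A\<close> at
  \<open>f\<close>; \<open>D_cover\<close> is quasi-compactness in terms of ideals.\<close>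

locale affine_chart = ring_sheaf X OX
  for X :: "'p topology" and OX :: "('p, 'r) ring_presheaf" +
  fixes U :: "'p set" and A :: "'r ring" and D :: "'r \<Rightarrow> 'p set" and \<phi> :: "'r \<Rightarrow> 'r"
  assumes U_open: "openin X U"
    and A_cring: "cring A"
    and \<phi>_hom: "\<phi> \<in> ring_hom A (sec OX U)"
    and D_open: "f \<in> carrier A \<Longrightarrow> openin X (D f)"
    and D_one: "D \<one>\<^bsub>A\<^esub> = U"
    and D_zero: "D \<zero>\<^bsub>A\<^esub> = {}"
    and D_mult: "f \<in> carrier A \<Longrightarrow> g \<in> carrier A \<Longrightarrow> D (f \<otimes>\<^bsub>A\<^esub> g) = D f \<inter> D g"
    and D_add: "f \<in> carrier A \<Longrightarrow> g \<in> carrier A \<Longrightarrow> D (f \<oplus>\<^bsub>A\<^esub> g) \<subseteq> D f \<union> D g"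
    and D_basis: "openin X W \<Longrightarrow> W \<subseteq> U \<Longrightarrow> x \<in> W \<Longrightarrow> \<exists>f \<in> carrier A. x \<in> D f \<and> D f \<subseteq> W"
    and D_unit: "f \<in> carrier A \<Longrightarrow> \<exists>g \<in> carrier (sec OX (D f)).
      g \<otimes>\<^bsub>sec OX (D f)\<^esub> res OX U (D f) (\<phi> f) = \<one>\<^bsub>sec OX (D f)\<^esub>"
    and D_section: "f \<in> carrier A \<Longrightarrow> c \<in> carrier (sec OX (D f)) \<Longrightarrow>
      \<exists>n::nat. \<exists>a \<in> carrier A. res OX U (D f) (\<phi> (f [^]\<^bsub>A\<^esub> n)) \<otimes>\<^bsub>sec OX (D f)\<^esub> c = res OX U (D f) (\<phi> a)"
    and D_vanish: "f \<in> carrier A \<Longrightarrow> a \<in> carrier A \<Longrightarrow> res OX U (D f) (\<phi> a) = \<zero>\<^bsub>sec OX (D f)\<^esub> \<Longrightarrow>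
      \<exists>n::nat. f [^]\<^bsub>A\<^esub> n \<otimes>\<^bsub>A\<^esub> a = \<zero>\<^bsub>A\<^esub>"
    and D_cover: "ideal J A \<Longrightarrow> f \<in> carrier A \<Longrightarrow> D f \<subseteq> \<Union>(D ` J) \<Longrightarrow> \<exists>n::nat. f [^]\<^bsub>A\<^esub> n \<in> J"

text \<open>The isomorphisms \<open>\<psi>\<close> commute with restriction, so the restriction of
  \<open>\<phi> a\<close> to \<open>D f\<close> corresponds to \<open>a / 1\<close> on the basic
  open set of \<open>f\<close>. Each property of the chart is thereby a property of
  fractions.\<close>

lemma affine_open_chart:
  fixes X :: "'p topology" and OX :: "('p, 'r) ring_presheaf"
  assumes rings: "sheaf_of_rings X OX" and aff: "affine_open X OX U"
  shows "\<exists>A D \<phi>. affine_chart X OX U A D \<phi>"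
proof -
  obtain A :: "'r ring" and h \<psi> where A: "cring A"
    and h: "homeomorphic_map (subtopology X U) (spec_topology A) h"
    and \<psi>: "\<And>V. openin (spec_topology A) V \<Longrightarrow>
      \<psi> V \<in> ring_iso (sec (spec_sheaf A) V) (sec OX (U \<inter> h -` V))"
    and nat: "\<And>V W \<sigma>. openin (spec_topology A) V \<Longrightarrow> openin (spec_topology A) W \<Longrightarrow> W \<subseteq> V \<Longrightarrow>
      \<sigma> \<in> carrier (sec (spec_sheaf A) V) \<Longrightarrow> \<psi> W (res (spec_sheaf A) V W \<sigma>) =
              res OX (U \<inter> h -` V) (U \<inter> h -` W) (\<psi> V \<sigma>)"
    and U: "openin X U"
    using aff unfolding affine_open_def by metis
  interpret A: cring A by (rule A)
  let ?S = "topspace (spec_topology A)"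
  define D where "D f = U \<inter> h -` basic_open A f" for f
  define \<phi> where "\<phi> a = \<psi> ?S (frac_section A ?S a \<one>\<^bsub>A\<^esub>)" for a
  have top: "topspace (subtopology X U) = U" using openin_subset[OF U] by auto
  have him: "h ` U = ?S" using homeomorphic_imp_surjective_map[OF h] top by simp
  have inj: "inj_on h U" using homeomorphic_imp_injective_map[OF h] top by simp
  have US: "U \<inter> h -` ?S = U" using him by blast
  have pull: "openin X (U \<inter> h -` W)" if "openin (spec_topology A) W" for W
  proof -
    have "openin (subtopology X U) {x \<in> U. h x \<in> W}"
      using openin_continuous_map_preimage[OF homeomorphic_imp_continuous_map[OF h] that] unfolding top .
    then have "openin (subtopology X U) (U \<inter> h -` W)" by (simp add: Int_def vimage_def)
    then show ?thesis using openin_trans_full[OF _ U] by blast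
  qed
  have hom: "\<psi> V \<in> ring_hom (sec (spec_sheaf A) V) (sec OX (U \<inter> h -` V))"
    and bij: "bij_betw (\<psi> V) (carrier (sec (spec_sheaf A) V)) (carrier (sec OX (U \<inter> h -` V)))"
    if "openin (spec_topology A) V" for V
    using \<psi>[OF that] by (auto simp: ring_iso_def)
  have So: "openin (spec_topology A) ?S" by simp
  have S1: "?S \<subseteq> basic_open A \<one>\<^bsub>A\<^esub>" using A.basic_open_one by simp
  have sub1: "W \<subseteq> basic_open A \<one>\<^bsub>A\<^esub>" if "openin (spec_topology A) W" for W
    using A.basic_open_one openin_subset[OF that] by simp
  have \<phi>c: "frac_section A ?S a \<one>\<^bsub>A\<^esub> \<in> carrier (sec (spec_sheaf A) ?S)" if "a \<in> carrier A" for a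
    using that by (intro A.frac_section_closed So S1) auto
  have bo: "openin (spec_topology A) (basic_open A f)" if "f \<in> carrier A" for f
    using A.openin_basic_open[OF that] .
  have res\<phi>: "res OX U (D f) (\<phi> a) = \<psi> (basic_open A f) (frac_section A (basic_open A f) a \<one>\<^bsub>A\<^esub>)"
    if "f \<in> carrier A" "a \<in> carrier A" for f a
    using nat[OF So bo[OF that(1)] openin_subset[OF bo[OF that(1)]] \<phi>c[OF that(2)]]
      A.res_frac_section[OF openin_subset[OF bo[OF that(1)]]] US
    unfolding D_def \<phi>_def by simp
  have frc: "frac_section A (basic_open A f) a (f [^]\<^bsub>A\<^esub> (n::nat)) \<in> carrier (sec (spec_sheaf A) (basic_open A f))"
    and frs: "basic_open A f \<subseteq> basic_open A (f [^]\<^bsub>A\<^esub> n)"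
    and fr1: "frac_section A (basic_open A f) a \<one>\<^bsub>A\<^esub> \<in> carrier (sec (spec_sheaf A) (basic_open A f))"
    if "f \<in> carrier A" "a \<in> carrier A" for f a n
  proof -
    show *: "basic_open A f \<subseteq> basic_open A (f [^]\<^bsub>A\<^esub> n)"
      using A.basic_open_pow[OF that(1), of _ n] unfolding basic_open_def by auto
    show "frac_section A (basic_open A f) a (f [^]\<^bsub>A\<^esub> n) \<in> carrier (sec (spec_sheaf A) (basic_open A f))"
      using that * by (intro A.frac_section_closed bo) auto
    show "frac_section A (basic_open A f) a \<one>\<^bsub>A\<^esub> \<in> carrier (sec (spec_sheaf A) (basic_open A f))"
      using that sub1[OF bo] by (intro A.frac_section_closed bo) auto
  qed
  have ringD: "cring (sec OX (D f))" "cring (sec OX U)" if "f \<in> carrier A" for f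
    using rings pull[OF bo[OF that]] U unfolding sheaf_of_rings_def D_def by auto
  have \<phi>hom: "\<phi> \<in> ring_hom A (sec OX U)"
  proof (rule ring_hom_memI)
    note H = hom[OF So, unfolded US]
    show "\<phi> x \<in> carrier (sec OX U)" if "x \<in> carrier A" for x
      using ring_hom_closed[OF H \<phi>c[OF that]] unfolding \<phi>_def .
    show "\<phi> (x \<otimes>\<^bsub>A\<^esub> y) = \<phi> x \<otimes>\<^bsub>sec OX U\<^esub> \<phi> y" if "x \<in> carrier A" "y \<in> carrier A" for x y
      using ring_hom_mult[OF H \<phi>c[OF that(1)] \<phi>c[OF that(2)]] A.frac_section_mult[OF S1 S1] that
      unfolding \<phi>_def by simp
    show "\<phi> (x \<oplus>\<^bsub>A\<^esub> y) = \<phi> x \<oplus>\<^bsub>sec OX U\<^esub> \<phi> y" if "x \<in> carrier A" "y \<in> carrier A" for x y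
      using ring_hom_add[OF H \<phi>c[OF that(1)] \<phi>c[OF that(2)]] A.frac_section_add[OF S1 S1] that
      unfolding \<phi>_def by simp
    show "\<phi> \<one>\<^bsub>A\<^esub> = \<one>\<^bsub>sec OX U\<^esub>"
      using ring_hom_one[OF H] A.frac_section_one unfolding \<phi>_def by simp
  qed
  have "affine_chart X OX U A D \<phi>"
  proof (rule affine_chart.intro[OF ring_sheaf.intro[OF rings] affine_chart_axioms.intro[OF U A \<phi>hom]])
    show "openin X (D f)" if "f \<in> carrier A" for f
      using pull[OF bo[OF that]] unfolding D_def .
    show "D \<one>\<^bsub>A\<^esub> = U" unfolding D_def A.basic_open_one by (rule US)
    show "D \<zero>\<^bsub>A\<^esub> = {}" unfolding D_def A.basic_open_zero by simp
    show "D (f \<otimes>\<^bsub>A\<^esub> g) = D f \<inter> D g" if "f \<in> carrier A" "g \<in> carrier A" for f g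
      unfolding D_def A.basic_open_mult[OF that] by blast
    show "D (f \<oplus>\<^bsub>A\<^esub> g) \<subseteq> D f \<union> D g" if "f \<in> carrier A" "g \<in> carrier A" for f g
      using A.basic_open_add[OF that] unfolding D_def by blast
    show "\<exists>f \<in> carrier A. x \<in> D f \<and> D f \<subseteq> W" if W: "openin X W" "W \<subseteq> U" "x \<in> W" for W x
    proof -
      have "openin (subtopology X U) W" using W by (metis openin_subtopology inf.absorb_iff1)
      then have "openin (spec_topology A) (h ` W)"
        using homeomorphic_imp_open_map[OF h] unfolding open_map_def by blast
      then obtain f where f: "f \<in> carrier A" "h x \<in> basic_open A f" "basic_open A f \<subseteq> h ` W"
        using A.basic_open_basis W(3) by blast
      have "D f \<subseteq> W"
        using f(3) W(2) inj unfolding D_def inj_on_def by blast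
      then show ?thesis using f W unfolding D_def by blast
    qed
    fix f assume f: "f \<in> carrier A"
    note H = hom[OF bo[OF f], folded D_def]
    note B = bij[OF bo[OF f], folded D_def]
    have s1: "basic_open A f \<subseteq> basic_open A \<one>\<^bsub>A\<^esub>" by (rule sub1[OF bo[OF f]])
    show "\<exists>g \<in> carrier (sec OX (D f)).
      g \<otimes>\<^bsub>sec OX (D f)\<^esub> res OX U (D f) (\<phi> f) = \<one>\<^bsub>sec OX (D f)\<^esub>"
    proof
      \<comment> \<open>The inverse is \<open>1 / f\<close>, with denominator written as a first
        power so that \<open>frc\<close> and \<open>frs\<close> apply.\<close>
      let ?g = "frac_section A (basic_open A f) \<one>\<^bsub>A\<^esub> (f [^]\<^bsub>A\<^esub> (1::nat))"
      let ?f = "frac_section A (basic_open A f) f \<one>\<^bsub>A\<^esub>"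
      have g: "?g \<in> carrier (sec (spec_sheaf A) (basic_open A f))" using frc[OF f, of _ 1] by simp
      show "\<psi> (basic_open A f) ?g \<in> carrier (sec OX (D f))" by (rule ring_hom_closed[OF H g])
      have "?g \<otimes>\<^bsub>sec (spec_sheaf A) (basic_open A f)\<^esub> ?f = frac_section A (basic_open A f) f f"
        using A.frac_section_mult[OF frs[OF f, of _ 1] s1] f by simp
      also have "\<dots> = \<one>\<^bsub>sec (spec_sheaf A) (basic_open A f)\<^esub>"
        unfolding A.frac_section_one[symmetric] using f s1 by (intro A.frac_section_eqI) auto
      finally show "\<psi> (basic_open A f) ?g \<otimes>\<^bsub>sec OX (D f)\<^esub> res OX U (D f) (\<phi> f) = \<one>\<^bsub>sec OX (D f)\<^esub>"
        unfolding res\<phi>[OF f f] ring_hom_mult[OF H g fr1[OF f f], symmetric]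
        using ring_hom_one[OF H] by simp
    qed
    show "\<exists>n::nat. \<exists>a \<in> carrier A. res OX U (D f) (\<phi> (f [^]\<^bsub>A\<^esub> n)) \<otimes>\<^bsub>sec OX (D f)\<^esub> c = res OX U (D f) (\<phi> a)"
      if c: "c \<in> carrier (sec OX (D f))" for c
    proof -
      obtain \<sigma> where \<sigma>: "\<sigma> \<in> carrier (sec (spec_sheaf A) (basic_open A f))" "c = \<psi> (basic_open A f) \<sigma>"
        using B c unfolding bij_betw_def by blast
      then obtain n :: nat and a where a: "a \<in> carrier A" "\<sigma> = frac_section A (basic_open A f) a (f [^]\<^bsub>A\<^esub> n)"
        using A.section_basic_open[OF f] by blast
      have fn: "f [^]\<^bsub>A\<^esub> n \<in> carrier A" using f by simp
      have "frac_section A (basic_open A f) (f [^]\<^bsub>A\<^esub> n) \<one>\<^bsub>A\<^esub> \<otimes>\<^bsub>sec (spec_sheaf A) (basic_open A f)\<^esub> \<sigma> =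
        frac_section A (basic_open A f) a \<one>\<^bsub>A\<^esub>"
        unfolding a(2) using A.frac_section_mult[OF s1 frs[OF f a(1)], of "f [^]\<^bsub>A\<^esub> n" a n] fn a
          A.frac_section_eqI[OF _ s1, of "f [^]\<^bsub>A\<^esub> n" "f [^]\<^bsub>A\<^esub> n \<otimes>\<^bsub>A\<^esub> a" a] frs[OF f a(1), of n] by simp
      then have "res OX U (D f) (\<phi> (f [^]\<^bsub>A\<^esub> n)) \<otimes>\<^bsub>sec OX (D f)\<^esub> c = res OX U (D f) (\<phi> a)"
        unfolding res\<phi>[OF f fn] res\<phi>[OF f a(1)] \<sigma>(2)
        using ring_hom_mult[OF H fr1[OF f fn] \<sigma>(1)] by simp
      then show ?thesis using a(1) by blast
    qed
    show "\<exists>n::nat. f [^]\<^bsub>A\<^esub> n \<otimes>\<^bsub>A\<^esub> a = \<zero>\<^bsub>A\<^esub>"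
      if a: "a \<in> carrier A" and z: "res OX U (D f) (\<phi> a) = \<zero>\<^bsub>sec OX (D f)\<^esub>" for a
    proof -
      interpret OXD: cring "sec OX (D f)" by (rule ringD(1)[OF f])
      let ?z = "frac_section A (basic_open A f) \<zero>\<^bsub>A\<^esub> \<one>\<^bsub>A\<^esub>"
      note zc = fr1[OF f A.zero_closed]
      \<comment> \<open>The sections of \<open>spec_sheaf\<close> are not shown to form a ring. That
        zero goes to zero is instead read off from \<open>?z\<close> being additively idempotent, in
        the target ring.\<close>
      have "?z \<oplus>\<^bsub>sec (spec_sheaf A) (basic_open A f)\<^esub> ?z = ?z"
        using A.frac_section_add[OF s1 s1] by simp
      then have "\<psi> (basic_open A f) ?z \<oplus>\<^bsub>sec OX (D f)\<^esub> \<psi> (basic_open A f) ?z = \<psi> (basic_open A f) ?z"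
        using ring_hom_add[OF H zc zc] by simp
      then have "\<psi> (basic_open A f) ?z = \<zero>\<^bsub>sec OX (D f)\<^esub>"
        using ring_hom_closed[OF H zc] by (simp add: OXD.add.l_cancel_one')
      then have "\<psi> (basic_open A f) (frac_section A (basic_open A f) a \<one>\<^bsub>A\<^esub>) = \<psi> (basic_open A f) ?z"
        using z res\<phi>[OF f a] by simp
      then have eq: "frac_section A (basic_open A f) a \<one>\<^bsub>A\<^esub> = ?z"
        using B fr1[OF f a] zc unfolding bij_betw_def inj_on_def by blast
      show ?thesis
      proof (rule A.germ_vanishing[OF a f])
        fix P assume P: "P \<in> basic_open A f"
        then have pP: "primeideal P A" unfolding basic_open_def by simp
        have "germ A P a \<one>\<^bsub>A\<^esub> = germ A P \<zero>\<^bsub>A\<^esub> \<one>\<^bsub>A\<^esub>"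
          using fun_cong[OF eq, of P] P unfolding frac_section_def by simp
        then obtain u where "u \<in> carrier A - P" "u \<otimes>\<^bsub>A\<^esub> (\<one>\<^bsub>A\<^esub> \<otimes>\<^bsub>A\<^esub> a \<ominus>\<^bsub>A\<^esub> \<one>\<^bsub>A\<^esub> \<otimes>\<^bsub>A\<^esub> \<zero>\<^bsub>A\<^esub>) = \<zero>\<^bsub>A\<^esub>"
          using A.germ_eqD[OF pP A.zero_closed A.one_notin_primeideal[OF pP]] by blast
        then show "\<exists>u\<in>carrier A - P. u \<otimes>\<^bsub>A\<^esub> a = \<zero>\<^bsub>A\<^esub>"
          using a by (intro bexI[of _ u]) (auto simp: a_minus_def)
      qed
    qed
    show "\<exists>n::nat. f [^]\<^bsub>A\<^esub> n \<in> J" if J: "ideal J A" and cov: "D f \<subseteq> \<Union>(D ` J)" for J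
    \<comment> \<open>A prime missing \<open>f\<close> is the image of a point of
      \<open>D f\<close>. The cover puts that point into \<open>D g\<close> for some
      \<open>g \<in> J\<close>, and this \<open>g\<close> lies outside the prime.\<close>
    proof (rule A.power_mem_idealI[OF J f])
      fix P assume P: "primeideal P A" "f \<notin> P"
      then have Pf: "P \<in> basic_open A f" unfolding basic_open_def by simp
      then have "P \<in> h ` U" using him openin_subset[OF bo[OF f]] by blast
      then obtain x where x: "x \<in> U" "h x = P" by blast
      then have "x \<in> D f" using Pf unfolding D_def by simp
      then obtain g where "g \<in> J" "x \<in> D g" using cov by blast
      then show "\<not> J \<subseteq> P" using x unfolding D_def basic_open_def by blast
    qed
  qed
  then show ?thesis by blast
qed

section \<open>Sheaves of modules\<close>

lemma ex1_unique: "\<lbrakk>\<exists>!x. P x; P a; P b\<rbrakk> \<Longrightarrow> a = b"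
  by blast

lemma ex1_cong_conj:
  assumes "\<exists>!c. P c \<and> m = F c" "\<And>c. P c \<Longrightarrow> F c = G c"
  shows "\<exists>!c. P c \<and> m = G c"
  using assms by metis

locale module_sheaf = ring_sheaf X OX
  for X :: "'p topology" and OX :: "('p, 'r) ring_presheaf" +
  fixes M :: "('p, 'r, 'm) module_presheaf"
  assumes M_modules: "sheaf_of_modules X OX M"
begin

lemma M_sheaf: "sheaf X M" using M_modules unfolding sheaf_of_modules_def by (elim conjE)

lemma M_module: "openin X V \<Longrightarrow> Module.module (sec OX V) (sec M V)"
  using M_modules[unfolded sheaf_of_modules_def, THEN conjunct2, THEN conjunct1] by blast

lemmas res_closed = sheaf_res_closed[OF M_sheaf]
lemmas res_id = sheaf_res_id[OF M_sheaf]
lemmas res_trans = sheaf_res_trans[OF M_sheaf]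
lemmas separated = sheaf_separated[OF M_sheaf]

lemma res_add:
  "\<lbrakk>openin X U; openin X V; V \<subseteq> U; x \<in> carrier (sec M U); y \<in> carrier (sec M U)\<rbrakk> \<Longrightarrow>
    res M U V (x \<oplus>\<^bsub>sec M U\<^esub> y) = res M U V x \<oplus>\<^bsub>sec M V\<^esub> res M U V y"
  using M_modules[unfolded sheaf_of_modules_def, THEN conjunct2, THEN conjunct2, rule_format, of U V, THEN conjunct1] by simp

lemma res_smult:
  "\<lbrakk>openin X U; openin X V; V \<subseteq> U; r \<in> carrier (sec OX U); x \<in> carrier (sec M U)\<rbrakk> \<Longrightarrow>
    res M U V (r \<odot>\<^bsub>sec M U\<^esub> x) = res OX U V r \<odot>\<^bsub>sec M V\<^esub> res M U V x"
  using M_modules[unfolded sheaf_of_modules_def, THEN conjunct2, THEN conjunct2, rule_format, of U V, THEN conjunct2] by simp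

text \<open>Restriction is only assumed to be additive, and an additively idempotent element of a
  group is zero.\<close>

lemma res_zero:
  assumes "openin X U" "openin X V" "V \<subseteq> U"
  shows "res M U V \<zero>\<^bsub>sec M U\<^esub> = \<zero>\<^bsub>sec M V\<^esub>"
proof -
  interpret U: Module.module "sec OX U" "sec M U" by (rule M_module[OF assms(1)])
  interpret V: Module.module "sec OX V" "sec M V" by (rule M_module[OF assms(2)])
  note c = res_closed[OF assms U.M.zero_closed]
  have "res M U V \<zero>\<^bsub>sec M U\<^esub> \<oplus>\<^bsub>sec M V\<^esub> res M U V \<zero>\<^bsub>sec M U\<^esub> = res M U V \<zero>\<^bsub>sec M U\<^esub>"
    using res_add[OF assms U.M.zero_closed U.M.zero_closed] by simp
  then show ?thesis using c by (simp add: V.M.add.l_cancel_one')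
qed

lemma res_finsum:
  assumes o: "openin X U" "openin X V" "V \<subseteq> U" and f: "finite I" "f \<in> I \<rightarrow> carrier (sec M U)"
  shows "res M U V (\<Oplus>\<^bsub>sec M U\<^esub>i \<in> I. f i) = (\<Oplus>\<^bsub>sec M V\<^esub>i \<in> I. res M U V (f i))"
proof -
  interpret U: Module.module "sec OX U" "sec M U" by (rule M_module[OF o(1)])
  interpret V: Module.module "sec OX V" "sec M V" by (rule M_module[OF o(2)])
  show ?thesis using f
  proof (induction I rule: finite_induct)
    case empty
    then show ?case using res_zero[OF o] by simp
  next
    case (insert x I)
    have "(\<lambda>i. res M U V (f i)) \<in> I \<rightarrow> carrier (sec M V)" "res M U V (f x) \<in> carrier (sec M V)"
      using insert.prems res_closed[OF o] by auto
    then show ?case using insert by (simp add: res_add[OF o])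
  qed
qed

lemma res_minus:
  assumes o: "openin X U" "openin X V" "V \<subseteq> U" and x: "x \<in> carrier (sec M U)" "y \<in> carrier (sec M U)"
  shows "res M U V (x \<ominus>\<^bsub>sec M U\<^esub> y) = res M U V x \<ominus>\<^bsub>sec M V\<^esub> res M U V y"
proof -
  interpret U: Module.module "sec OX U" "sec M U" by (rule M_module[OF o(1)])
  interpret V: Module.module "sec OX V" "sec M V" by (rule M_module[OF o(2)])
  have "res M U V (x \<ominus>\<^bsub>sec M U\<^esub> y) \<oplus>\<^bsub>sec M V\<^esub> res M U V y = res M U V ((x \<ominus>\<^bsub>sec M U\<^esub> y) \<oplus>\<^bsub>sec M U\<^esub> y)"
    using x by (intro res_add[OF o, symmetric]) auto
  also have "(x \<ominus>\<^bsub>sec M U\<^esub> y) \<oplus>\<^bsub>sec M U\<^esub> y = x"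
    using x by (simp add: a_minus_def U.M.a_assoc U.M.l_neg)
  finally have "res M U V (x \<ominus>\<^bsub>sec M U\<^esub> y) \<oplus>\<^bsub>sec M V\<^esub> res M U V y = res M U V x" .
  then show ?thesis using x res_closed[OF o] unfolding a_minus_def
    by (intro V.M.add.inv_solve_right[THEN iffD2]) auto
qed

lemma free_basis_open: "free_basis X OX M n V e \<Longrightarrow> openin X V"
  unfolding free_basis_def by (elim conjE)

lemma free_basis_closed: "free_basis X OX M n V e \<Longrightarrow> i < n \<Longrightarrow> e i \<in> carrier (sec M V)"
  unfolding free_basis_def by blast

lemma free_basis_ex1:
  assumes "free_basis X OX M n V e" "openin X W" "W \<subseteq> V" "m \<in> carrier (sec M W)"
  shows "\<exists>!c. c \<in> {..<n} \<rightarrow>\<^sub>E carrier (sec OX W) \<and>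
      m = (\<Oplus>\<^bsub>sec M W\<^esub>i \<in> {..<n}. c i \<odot>\<^bsub>sec M W\<^esub> res M V W (e i))"
  using assms(1)[unfolded free_basis_def, THEN conjunct2, THEN conjunct2, rule_format, OF _ assms(4)]
    assms(2,3) by simp

text \<open>\<open>free_basis\<close> asks for coordinates over every smaller open set, so only the
  composite of two restrictions has to be identified with one.\<close>

lemma free_basis_restrict:
  assumes b: "free_basis X OX M n V e" and W: "openin X W" "W \<subseteq> V"
  shows "free_basis X OX M n W (\<lambda>i. res M V W (e i))"
proof -
  note V = free_basis_open[OF b] free_basis_closed[OF b]
  have "\<exists>!c. c \<in> {..<n} \<rightarrow>\<^sub>E carrier (sec OX W') \<and>
      m = (\<Oplus>\<^bsub>sec M W'\<^esub>i \<in> {..<n}. c i \<odot>\<^bsub>sec M W'\<^esub> res M W W' (res M V W (e i)))"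
    if W': "openin X W'" "W' \<subseteq> W" and m: "m \<in> carrier (sec M W')" for W' m
  proof -
    interpret W': Module.module "sec OX W'" "sec M W'" by (rule M_module[OF W'(1)])
    have rr: "res M W W' (res M V W (e i)) = res M V W' (e i)" if "i < n" for i
      using res_trans[OF V(1) W(1) W'(1) W'(2) W(2) V(2)[OF that]] .
    have rc: "res M V W' (e i) \<in> carrier (sec M W')" if "i < n" for i
      using res_closed[OF V(1) W'(1) _ V(2)[OF that]] W W' by auto
    have eq: "(\<Oplus>\<^bsub>sec M W'\<^esub>i \<in> {..<n}. c i \<odot>\<^bsub>sec M W'\<^esub> res M W W' (res M V W (e i))) =
      (\<Oplus>\<^bsub>sec M W'\<^esub>i \<in> {..<n}. c i \<odot>\<^bsub>sec M W'\<^esub> res M V W' (e i))"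
      if "c \<in> {..<n} \<rightarrow>\<^sub>E carrier (sec OX W')" for c
      using rr rc that by (intro W'.M.finsum_cong') (auto simp: PiE_def Pi_def)
    have "\<exists>!c. c \<in> {..<n} \<rightarrow>\<^sub>E carrier (sec OX W') \<and>
      m = (\<Oplus>\<^bsub>sec M W'\<^esub>i \<in> {..<n}. c i \<odot>\<^bsub>sec M W'\<^esub> res M V W' (e i))"
      using free_basis_ex1[OF b W'(1) subset_trans[OF W'(2) W(2)] m] .
    then show ?thesis by (rule ex1_cong_conj) (use eq in simp)
  qed
  then show ?thesis
    unfolding free_basis_def by (intro conjI allI impI ballI W(1) res_closed[OF V(1) W] V(2)) simp_all
qed

lemma free_basis_coords:
  assumes b: "free_basis X OX M n V e" and m: "m \<in> carrier (sec M V)"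
  shows "\<exists>!c. c \<in> {..<n} \<rightarrow>\<^sub>E carrier (sec OX V) \<and> m = (\<Oplus>\<^bsub>sec M V\<^esub>i \<in> {..<n}. c i \<odot>\<^bsub>sec M V\<^esub> e i)"
proof -
  note V = free_basis_open[OF b] free_basis_closed[OF b]
  interpret V: Module.module "sec OX V" "sec M V" by (rule M_module[OF V(1)])
  have eq: "(\<Oplus>\<^bsub>sec M V\<^esub>i \<in> {..<n}. c i \<odot>\<^bsub>sec M V\<^esub> res M V V (e i)) =
      (\<Oplus>\<^bsub>sec M V\<^esub>i \<in> {..<n}. c i \<odot>\<^bsub>sec M V\<^esub> e i)"
    if "c \<in> {..<n} \<rightarrow>\<^sub>E carrier (sec OX V)" for c
    using res_id[OF V(1)] V(2) that by (intro V.M.finsum_cong') (auto simp: PiE_def Pi_def)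
  have "\<exists>!c. c \<in> {..<n} \<rightarrow>\<^sub>E carrier (sec OX V) \<and>
      m = (\<Oplus>\<^bsub>sec M V\<^esub>i \<in> {..<n}. c i \<odot>\<^bsub>sec M V\<^esub> res M V V (e i))"
    using free_basis_ex1[OF b V(1) subset_refl m] .
  then show ?thesis by (rule ex1_cong_conj) (use eq in simp)
qed

text \<open>The unique coordinates are extensional functions; cutting arbitrary families down to the
  indices below \<open>n\<close> brings them into that form.\<close>

lemma free_basis_unique:
  assumes b: "free_basis X OX M n V e"
    and c: "\<And>i. i < n \<Longrightarrow> c i \<in> carrier (sec OX V)" "\<And>i. i < n \<Longrightarrow> d i \<in> carrier (sec OX V)"
    and eq: "(\<Oplus>\<^bsub>sec M V\<^esub>i \<in> {..<n}. c i \<odot>\<^bsub>sec M V\<^esub> e i) = (\<Oplus>\<^bsub>sec M V\<^esub>i \<in> {..<n}. d i \<odot>\<^bsub>sec M V\<^esub> e i)"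
    and i: "i < n"
  shows "c i = d i"
proof -
  note V = free_basis_open[OF b] free_basis_closed[OF b]
  interpret V: Module.module "sec OX V" "sec M V" by (rule M_module[OF V(1)])
  have r: "(\<Oplus>\<^bsub>sec M V\<^esub>i \<in> {..<n}. restrict x {..<n} i \<odot>\<^bsub>sec M V\<^esub> e i) = (\<Oplus>\<^bsub>sec M V\<^esub>i \<in> {..<n}. x i \<odot>\<^bsub>sec M V\<^esub> e i)"
    and m: "(\<Oplus>\<^bsub>sec M V\<^esub>i \<in> {..<n}. x i \<odot>\<^bsub>sec M V\<^esub> e i) \<in> carrier (sec M V)"
    if "\<And>i. i < n \<Longrightarrow> x i \<in> carrier (sec OX V)" for x
    using that V by (auto intro!: V.M.finsum_cong' V.M.finsum_closed)
  have "restrict c {..<n} = restrict d {..<n}"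
  proof (rule ex1_unique[OF free_basis_coords[OF b m[OF c(1)]]])
    show "restrict c {..<n} \<in> {..<n} \<rightarrow>\<^sub>E carrier (sec OX V) \<and> (\<Oplus>\<^bsub>sec M V\<^esub>i \<in> {..<n}. c i \<odot>\<^bsub>sec M V\<^esub> e i) =
        (\<Oplus>\<^bsub>sec M V\<^esub>i \<in> {..<n}. restrict c {..<n} i \<odot>\<^bsub>sec M V\<^esub> e i)"
      using c(1) by (intro conjI r[OF c(1), symmetric]) simp_all
    show "restrict d {..<n} \<in> {..<n} \<rightarrow>\<^sub>E carrier (sec OX V) \<and> (\<Oplus>\<^bsub>sec M V\<^esub>i \<in> {..<n}. c i \<odot>\<^bsub>sec M V\<^esub> e i) =
        (\<Oplus>\<^bsub>sec M V\<^esub>i \<in> {..<n}. restrict d {..<n} i \<odot>\<^bsub>sec M V\<^esub> e i)"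
      using c(2) by (intro conjI trans[OF eq r[OF c(2), symmetric]]) simp_all
  qed
  then have "restrict c {..<n} i = restrict d {..<n} i" by simp
  then show ?thesis using i by simp
qed

lemma free_basis_expand:
  assumes b: "free_basis X OX M n V e" and m: "m \<in> carrier (sec M V)"
  shows "\<exists>c. (\<forall>i < n. c i \<in> carrier (sec OX V)) \<and> m = (\<Oplus>\<^bsub>sec M V\<^esub>i \<in> {..<n}. c i \<odot>\<^bsub>sec M V\<^esub> e i)"
proof -
  obtain c where "c \<in> {..<n} \<rightarrow>\<^sub>E carrier (sec OX V) \<and> m = (\<Oplus>\<^bsub>sec M V\<^esub>i \<in> {..<n}. c i \<odot>\<^bsub>sec M V\<^esub> e i)"
    using ex1_implies_ex[OF free_basis_coords[OF assms]] by (elim exE)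
  then show ?thesis by (intro exI[of _ c]) (auto dest: PiE_mem)
qed

end

section \<open>Extending sections of a locally free sheaf over an affine chart\<close>

context affine_chart
begin

sublocale A: cring A by (rule A_cring)

lemma D_sub: "f \<in> carrier A \<Longrightarrow> D f \<subseteq> U"
  using D_mult[OF _ A.one_closed, of f] D_one by auto

lemma D_pow_Suc: "f \<in> carrier A \<Longrightarrow> D (f [^]\<^bsub>A\<^esub> Suc n) = D f"
  by (induction n) (auto simp: D_mult)

text \<open>Local-to-global induction on a chart. The elements \<open>r\<close> with
  \<open>Q r\<close> form an ideal: \<open>join\<close> with both arguments equal gives multiples,
  and with \<open>D_add\<close> it gives sums. By \<open>local\<close> and \<open>D_cover\<close>
  this ideal contains a power of \<open>g\<close>.\<close>

lemma chart_induct [consumes 1, case_names zero join local]: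
  assumes g: "g \<in> carrier A" and zero: "Q \<zero>\<^bsub>A\<^esub>"
    and join: "\<And>a b r. \<lbrakk>a \<in> carrier A; b \<in> carrier A; r \<in> carrier A; Q a; Q b; D r \<subseteq> D a \<union> D b\<rbrakk> \<Longrightarrow> Q r"
    and local: "\<And>x. x \<in> D g \<Longrightarrow> \<exists>r \<in> carrier A. x \<in> D r \<and> Q r"
  shows "Q g"
proof -
  let ?J = "{r \<in> carrier A. Q r}"
  have mult: "r \<otimes>\<^bsub>A\<^esub> a \<in> ?J" if "a \<in> ?J" "r \<in> carrier A" for a r
  proof -
    have "D (r \<otimes>\<^bsub>A\<^esub> a) \<subseteq> D a \<union> D a" using that D_mult[of r a] by auto
    then show ?thesis using join[of a a "r \<otimes>\<^bsub>A\<^esub> a"] that by simp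
  qed
  have J: "ideal ?J A"
  proof (rule idealI[OF A.ring_axioms])
    show "subgroup ?J (add_monoid A)"
    proof (rule A.add.subgroupI)
      show "?J \<noteq> {}" using zero A.zero_closed by blast
      show "\<ominus>\<^bsub>A\<^esub> a \<in> ?J" if "a \<in> ?J" for a
        using mult[OF that, of "\<ominus>\<^bsub>A\<^esub> \<one>\<^bsub>A\<^esub>"] that by (simp add: A.l_minus)
      show "a \<oplus>\<^bsub>A\<^esub> b \<in> ?J" if "a \<in> ?J" "b \<in> ?J" for a b
        using join[of a b "a \<oplus>\<^bsub>A\<^esub> b"] D_add[of a b] that by simp
    qed blast
    show "x \<otimes>\<^bsub>A\<^esub> a \<in> ?J" if "a \<in> ?J" "x \<in> carrier A" for a x using mult that by blast
    then show "a \<otimes>\<^bsub>A\<^esub> x \<in> ?J" if "a \<in> ?J" "x \<in> carrier A" for a x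
      using that A.m_comm[of a x] by simp
  qed
  have "D g \<subseteq> \<Union>(D ` ?J)" using local by blast
  then obtain n :: nat where "g [^]\<^bsub>A\<^esub> n \<in> ?J" using D_cover[OF J g] by blast
  then have "g \<otimes>\<^bsub>A\<^esub> g [^]\<^bsub>A\<^esub> n \<in> ?J" using mult g by blast
  \<comment> \<open>A positive exponent makes \<open>D\<close> of the power equal to
    \<open>D g\<close>, and a last use of \<open>join\<close> descends from the power to
    \<open>g\<close>.\<close>
  then have n: "g [^]\<^bsub>A\<^esub> Suc n \<in> ?J" using g by (simp add: A.m_comm)
  then show ?thesis
    using join[of "g [^]\<^bsub>A\<^esub> Suc n" "g [^]\<^bsub>A\<^esub> Suc n" g] D_pow_Suc[OF g] g by blast
qed

section \<open>Vanishing and extension for sections of the structure sheaf\<close>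

definition \<rho> :: "'p set \<Rightarrow> 'r \<Rightarrow> 'r" where "\<rho> V f = res OX U V (\<phi> f)"

lemma \<rho>_hom:
  assumes "openin X V" "V \<subseteq> U" shows "ring_hom_cring A (sec OX V) (\<rho> V)"
proof (intro ring_hom_cring.intro ring_hom_cring_axioms.intro A_cring OX_cring[OF assms(1)])
  have "res OX U V \<in> ring_hom (sec OX U) (sec OX V)"
    using ring_hom_cring.homh[OF OX_res_hom[OF U_open assms]] .
  from ring_hom_trans[OF \<phi>_hom this] show "\<rho> V \<in> ring_hom A (sec OX V)"
    unfolding \<rho>_def by (simp add: comp_def)
qed

lemma res_\<rho>: "\<lbrakk>openin X V; openin X W; V \<subseteq> U; W \<subseteq> V; f \<in> carrier A\<rbrakk> \<Longrightarrow> res OX V W (\<rho> V f) = \<rho> W f"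
  unfolding \<rho>_def by (rule OX_res_trans[OF U_open _ _ _ _ ring_hom_closed[OF \<phi>_hom]])

lemma \<rho>_unit:
  assumes f: "f \<in> carrier A"
  shows "\<exists>u \<in> carrier (sec OX (D f)). u \<otimes>\<^bsub>sec OX (D f)\<^esub> \<rho> (D f) (f [^]\<^bsub>A\<^esub> (n::nat)) = \<one>\<^bsub>sec OX (D f)\<^esub>"
proof -
  interpret O: cring "sec OX (D f)" by (rule OX_cring[OF D_open[OF f]])
  interpret h: ring_hom_cring A "sec OX (D f)" "\<rho> (D f)" by (rule \<rho>_hom[OF D_open[OF f] D_sub[OF f]])
  obtain u where u: "u \<in> carrier (sec OX (D f))" "u \<otimes>\<^bsub>sec OX (D f)\<^esub> \<rho> (D f) f = \<one>\<^bsub>sec OX (D f)\<^esub>"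
    using D_unit[OF f] unfolding \<rho>_def by blast
  have "u [^]\<^bsub>sec OX (D f)\<^esub> n \<otimes>\<^bsub>sec OX (D f)\<^esub> \<rho> (D f) (f [^]\<^bsub>A\<^esub> n) = \<one>\<^bsub>sec OX (D f)\<^esub>"
    using u f h.hom_closed[OF f] by (simp add: O.nat_pow_distrib[symmetric])
  then show ?thesis using u by blast
qed

text \<open>A power of \<open>g\<close> turns \<open>c\<close> into an element \<open>a\<close> of
  the chart ring that vanishes over \<open>D (f \<otimes> g)\<close>, so a power of
  \<open>f \<otimes> g\<close> kills \<open>a\<close>. All powers of \<open>g\<close> are units over
  \<open>D g\<close> and cancel, which leaves a power of \<open>f\<close>.\<close>

lemma ring_section_vanish:
  assumes f: "f \<in> carrier A" and g: "g \<in> carrier A" and c: "c \<in> carrier (sec OX (D g))"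
    and z: "res OX (D g) (D (f \<otimes>\<^bsub>A\<^esub> g)) c = \<zero>\<^bsub>sec OX (D (f \<otimes>\<^bsub>A\<^esub> g))\<^esub>"
  shows "\<exists>n::nat. \<rho> (D g) (f [^]\<^bsub>A\<^esub> n) \<otimes>\<^bsub>sec OX (D g)\<^esub> c = \<zero>\<^bsub>sec OX (D g)\<^esub>"
proof -
  let ?W = "D (f \<otimes>\<^bsub>A\<^esub> g)"
  have fg: "f \<otimes>\<^bsub>A\<^esub> g \<in> carrier A" "?W \<subseteq> D g" using f g D_mult by auto
  interpret O: cring "sec OX (D g)" by (rule OX_cring[OF D_open[OF g]])
  interpret h: ring_hom_cring A "sec OX (D g)" "\<rho> (D g)" by (rule \<rho>_hom[OF D_open[OF g] D_sub[OF g]])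
  interpret r: ring_hom_cring "sec OX (D g)" "sec OX ?W" "res OX (D g) ?W"
    by (rule OX_res_hom[OF D_open[OF g] D_open[OF fg(1)] fg(2)])
  obtain n :: nat and a where a: "a \<in> carrier A" "\<rho> (D g) (g [^]\<^bsub>A\<^esub> n) \<otimes>\<^bsub>sec OX (D g)\<^esub> c = \<rho> (D g) a"
    using D_section[OF g c] unfolding \<rho>_def by blast
  have "\<rho> ?W a = res OX (D g) ?W (\<rho> (D g) a)"
    using res_\<rho>[OF D_open[OF g] D_open[OF fg(1)] D_sub[OF g] fg(2) a(1)] by simp
  also have "\<dots> = \<zero>\<^bsub>sec OX ?W\<^esub>"
    unfolding a(2)[symmetric] using g c z by simp
  finally obtain K :: nat where K: "(f \<otimes>\<^bsub>A\<^esub> g) [^]\<^bsub>A\<^esub> K \<otimes>\<^bsub>A\<^esub> a = \<zero>\<^bsub>A\<^esub>"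
    using D_vanish[OF fg(1) a(1)] unfolding \<rho>_def by blast
  \<comment> \<open>The exponent collects \<open>n\<close> factors of \<open>g\<close> from clearing
    the denominator of \<open>c\<close> and \<open>K\<close> from the annihilation of
    \<open>a\<close>.\<close>
  obtain u where u: "u \<in> carrier (sec OX (D g))"
      "u \<otimes>\<^bsub>sec OX (D g)\<^esub> \<rho> (D g) (g [^]\<^bsub>A\<^esub> (K + n)) = \<one>\<^bsub>sec OX (D g)\<^esub>"
    using \<rho>_unit[OF g] by blast
  define F G G' where p: "F = \<rho> (D g) (f [^]\<^bsub>A\<^esub> K)" "G = \<rho> (D g) (g [^]\<^bsub>A\<^esub> K)" "G' = \<rho> (D g) (g [^]\<^bsub>A\<^esub> n)"
  have pc: "F \<in> carrier (sec OX (D g))" "G \<in> carrier (sec OX (D g))" "G' \<in> carrier (sec OX (D g))"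
    using f g unfolding p by auto
  have uG: "u \<otimes>\<^bsub>sec OX (D g)\<^esub> (G \<otimes>\<^bsub>sec OX (D g)\<^esub> G') = \<one>\<^bsub>sec OX (D g)\<^esub>"
    using u g unfolding p by (simp add: A.nat_pow_mult[symmetric])
  have "\<rho> (D g) ((f \<otimes>\<^bsub>A\<^esub> g) [^]\<^bsub>A\<^esub> K \<otimes>\<^bsub>A\<^esub> a) = \<zero>\<^bsub>sec OX (D g)\<^esub>" unfolding K by simp
  then have "F \<otimes>\<^bsub>sec OX (D g)\<^esub> G \<otimes>\<^bsub>sec OX (D g)\<^esub> (G' \<otimes>\<^bsub>sec OX (D g)\<^esub> c) = \<zero>\<^bsub>sec OX (D g)\<^esub>"
    using f g a unfolding p by (simp add: A.nat_pow_distrib)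
  then have "u \<otimes>\<^bsub>sec OX (D g)\<^esub> (F \<otimes>\<^bsub>sec OX (D g)\<^esub> G \<otimes>\<^bsub>sec OX (D g)\<^esub> (G' \<otimes>\<^bsub>sec OX (D g)\<^esub> c)) = \<zero>\<^bsub>sec OX (D g)\<^esub>"
    using u by simp
  moreover have "u \<otimes>\<^bsub>sec OX (D g)\<^esub> (F \<otimes>\<^bsub>sec OX (D g)\<^esub> G \<otimes>\<^bsub>sec OX (D g)\<^esub> (G' \<otimes>\<^bsub>sec OX (D g)\<^esub> c)) =
    (u \<otimes>\<^bsub>sec OX (D g)\<^esub> (G \<otimes>\<^bsub>sec OX (D g)\<^esub> G')) \<otimes>\<^bsub>sec OX (D g)\<^esub> (F \<otimes>\<^bsub>sec OX (D g)\<^esub> c)"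
    using u(1) pc c by (simp add: O.m_ac)
  ultimately have "F \<otimes>\<^bsub>sec OX (D g)\<^esub> c = \<zero>\<^bsub>sec OX (D g)\<^esub>" using uG pc c by simp
  then show ?thesis unfolding p by blast
qed

text \<open>Clearing denominators on the smaller set costs a power of \<open>f \<otimes> g\<close>.
  Its \<open>g\<close>-part can be divided out already over \<open>D g\<close>, so only the power of
  \<open>f\<close> remains.\<close>

lemma ring_section_extend:
  assumes f: "f \<in> carrier A" and g: "g \<in> carrier A" and c: "c \<in> carrier (sec OX (D (f \<otimes>\<^bsub>A\<^esub> g)))"
  shows "\<exists>n::nat. \<exists>d \<in> carrier (sec OX (D g)).
    res OX (D g) (D (f \<otimes>\<^bsub>A\<^esub> g)) d = \<rho> (D (f \<otimes>\<^bsub>A\<^esub> g)) (f [^]\<^bsub>A\<^esub> n) \<otimes>\<^bsub>sec OX (D (f \<otimes>\<^bsub>A\<^esub> g))\<^esub> c"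
proof -
  let ?W = "D (f \<otimes>\<^bsub>A\<^esub> g)"
  have fg: "f \<otimes>\<^bsub>A\<^esub> g \<in> carrier A" "?W \<subseteq> D g" using f g D_mult by auto
  interpret O: cring "sec OX (D g)" by (rule OX_cring[OF D_open[OF g]])
  interpret O': cring "sec OX ?W" by (rule OX_cring[OF D_open[OF fg(1)]])
  interpret h: ring_hom_cring A "sec OX (D g)" "\<rho> (D g)" by (rule \<rho>_hom[OF D_open[OF g] D_sub[OF g]])
  interpret h': ring_hom_cring A "sec OX ?W" "\<rho> ?W"
    by (rule \<rho>_hom[OF D_open[OF fg(1)] D_sub[OF fg(1)]])
  interpret r: ring_hom_cring "sec OX (D g)" "sec OX ?W" "res OX (D g) ?W"
    by (rule OX_res_hom[OF D_open[OF g] D_open[OF fg(1)] fg(2)])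
  note rr = res_\<rho>[OF D_open[OF g] D_open[OF fg(1)] D_sub[OF g] fg(2)]
  obtain n :: nat and a where a: "a \<in> carrier A"
      "\<rho> ?W ((f \<otimes>\<^bsub>A\<^esub> g) [^]\<^bsub>A\<^esub> n) \<otimes>\<^bsub>sec OX ?W\<^esub> c = \<rho> ?W a"
    using D_section[OF fg(1) c] unfolding \<rho>_def by blast
  obtain u where u: "u \<in> carrier (sec OX (D g))"
      "u \<otimes>\<^bsub>sec OX (D g)\<^esub> \<rho> (D g) (g [^]\<^bsub>A\<^esub> n) = \<one>\<^bsub>sec OX (D g)\<^esub>"
    using \<rho>_unit[OF g] by blast
  let ?r = "res OX (D g) ?W"
  define F G where p: "F = \<rho> ?W (f [^]\<^bsub>A\<^esub> n)" "G = \<rho> ?W (g [^]\<^bsub>A\<^esub> n)"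
  have pc: "F \<in> carrier (sec OX ?W)" "G \<in> carrier (sec OX ?W)" "?r u \<in> carrier (sec OX ?W)"
    using f g u unfolding p by auto
  have "?r (u \<otimes>\<^bsub>sec OX (D g)\<^esub> \<rho> (D g) (g [^]\<^bsub>A\<^esub> n)) = ?r \<one>\<^bsub>sec OX (D g)\<^esub>" unfolding u(2) ..
  then have uG: "?r u \<otimes>\<^bsub>sec OX ?W\<^esub> G = \<one>\<^bsub>sec OX ?W\<^esub>"
    using u(1) g rr[of "g [^]\<^bsub>A\<^esub> n"] unfolding p by (simp del: h.hom_pow h'.hom_pow)
  have "?r (u \<otimes>\<^bsub>sec OX (D g)\<^esub> \<rho> (D g) a) = ?r u \<otimes>\<^bsub>sec OX ?W\<^esub> \<rho> ?W a"
    using u a rr by simp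
  also have "\<dots> = ?r u \<otimes>\<^bsub>sec OX ?W\<^esub> (F \<otimes>\<^bsub>sec OX ?W\<^esub> G \<otimes>\<^bsub>sec OX ?W\<^esub> c)"
    unfolding a(2)[symmetric] p using f g by (simp add: A.nat_pow_distrib)
  also have "\<dots> = (?r u \<otimes>\<^bsub>sec OX ?W\<^esub> G) \<otimes>\<^bsub>sec OX ?W\<^esub> (F \<otimes>\<^bsub>sec OX ?W\<^esub> c)"
    using pc c by (simp add: O'.m_ac)
  also have "\<dots> = F \<otimes>\<^bsub>sec OX ?W\<^esub> c" using uG pc c by simp
  finally show ?thesis using u a unfolding p by blast
qed

end

text \<open>Each coordinate of a section comes with its own exponent. Since exponents may be
  enlarged, a sum of them serves all coordinates at once.\<close>

lemma ex_uniform_bound: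
  fixes P :: "nat \<Rightarrow> nat \<Rightarrow> bool"
  assumes "\<And>i. i < n \<Longrightarrow> \<exists>K. P i K" "\<And>i K L. i < n \<Longrightarrow> P i K \<Longrightarrow> P i (K + L)"
  shows "\<exists>K. \<forall>i < n. P i K"
  using assms
proof (induction n)
  case (Suc n)
  obtain K where K: "\<forall>i < n. P i K" using Suc.IH Suc.prems by (metis less_SucI)
  obtain L where L: "P n L" using Suc.prems(1) by blast
  have "P i (K + L)" if "i < Suc n" for i
  proof (cases "i = n")
    case True
    then show ?thesis using Suc.prems(2)[of n L K] L by (simp add: add.commute)
  next
    case False
    then show ?thesis using Suc.prems(2)[of i K L] K that by simp
  qed
  then show ?case by blast
qed simp

section \<open>Vanishing and extension for sections of a locally free module\<close>

locale chart_module = affine_chart X OX U A D \<phi> + module_sheaf X OX M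
  for X :: "'p topology" and OX :: "('p, 'r) ring_presheaf" and U A D \<phi>
    and M :: "('p, 'r, 'm) module_presheaf"
begin

definition act :: "'p set \<Rightarrow> 'r \<Rightarrow> 'm \<Rightarrow> 'm" where
  "act V f m = \<rho> V f \<odot>\<^bsub>sec M V\<^esub> m"

lemma \<rho>_closed: "\<lbrakk>openin X V; V \<subseteq> U; f \<in> carrier A\<rbrakk> \<Longrightarrow> \<rho> V f \<in> carrier (sec OX V)"
  using ring_hom_closed[OF ring_hom_cring.homh[OF \<rho>_hom]] by blast

lemma act_closed: "\<lbrakk>openin X V; V \<subseteq> U; f \<in> carrier A; m \<in> carrier (sec M V)\<rbrakk> \<Longrightarrow> act V f m \<in> carrier (sec M V)"
  unfolding act_def by (rule module.smult_closed[OF M_module \<rho>_closed])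

lemma act_mult:
  assumes "openin X V" "V \<subseteq> U" "f \<in> carrier A" "g \<in> carrier A" "m \<in> carrier (sec M V)"
  shows "act V (f \<otimes>\<^bsub>A\<^esub> g) m = act V f (act V g m)"
  using module.smult_assoc1[OF M_module[OF assms(1)] \<rho>_closed[OF assms(1,2,3)] \<rho>_closed[OF assms(1,2,4)] assms(5)]
    ring_hom_mult[OF ring_hom_cring.homh[OF \<rho>_hom[OF assms(1,2)]] assms(3,4)]
  unfolding act_def by simp

lemma act_pow_add:
  assumes "openin X V" "V \<subseteq> U" "f \<in> carrier A" "m \<in> carrier (sec M V)"
  shows "act V (f [^]\<^bsub>A\<^esub> (K + L :: nat)) m = act V (f [^]\<^bsub>A\<^esub> K) (act V (f [^]\<^bsub>A\<^esub> L) m)"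
  using act_mult[OF assms(1,2), of "f [^]\<^bsub>A\<^esub> K" "f [^]\<^bsub>A\<^esub> L" m] assms by (simp add: A.nat_pow_mult)

lemma act_zero: "\<lbrakk>openin X V; V \<subseteq> U; f \<in> carrier A\<rbrakk> \<Longrightarrow> act V f \<zero>\<^bsub>sec M V\<^esub> = \<zero>\<^bsub>sec M V\<^esub>"
  unfolding act_def by (rule module.smult_r_null[OF M_module \<rho>_closed])

lemma act_minus:
  assumes "openin X V" "V \<subseteq> U" "f \<in> carrier A" "x \<in> carrier (sec M V)" "y \<in> carrier (sec M V)"
  shows "act V f (x \<ominus>\<^bsub>sec M V\<^esub> y) = act V f x \<ominus>\<^bsub>sec M V\<^esub> act V f y"
proof -
  interpret V: Module.module "sec OX V" "sec M V" by (rule M_module[OF assms(1)])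
  show ?thesis unfolding act_def a_minus_def
    using assms \<rho>_closed[OF assms(1-3)] by (simp add: V.smult_r_distr V.smult_r_minus)
qed

lemma res_act:
  assumes "openin X V" "openin X W" "V \<subseteq> U" "W \<subseteq> V" "f \<in> carrier A" "m \<in> carrier (sec M V)"
  shows "res M V W (act V f m) = act W f (res M V W m)"
  unfolding act_def res_smult[OF assms(1,2,4) \<rho>_closed[OF assms(1,3,5)] assms(6)]
  by (simp add: res_\<rho>[OF assms(1,2,3,4,5)])

lemma act_finsum:
  assumes "openin X V" "V \<subseteq> U" "f \<in> carrier A" "finite I"
    "\<And>i. i \<in> I \<Longrightarrow> c i \<in> carrier (sec OX V)" "\<And>i. i \<in> I \<Longrightarrow> e i \<in> carrier (sec M V)"
  shows "act V f (\<Oplus>\<^bsub>sec M V\<^esub>i \<in> I. c i \<odot>\<^bsub>sec M V\<^esub> e i) =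
    (\<Oplus>\<^bsub>sec M V\<^esub>i \<in> I. (\<rho> V f \<otimes>\<^bsub>sec OX V\<^esub> c i) \<odot>\<^bsub>sec M V\<^esub> e i)"
proof -
  interpret V: Module.module "sec OX V" "sec M V" by (rule M_module[OF assms(1)])
  note r = \<rho>_closed[OF assms(1-3)]
  show ?thesis unfolding act_def
    using assms(4-) r by (subst V.finsum_smult_ldistr) (auto intro!: V.M.finsum_cong' simp: V.smult_assoc1)
qed

lemma \<rho>_pow_add:
  assumes "openin X V" "V \<subseteq> U" "f \<in> carrier A"
  shows "\<rho> V (f [^]\<^bsub>A\<^esub> (K + L :: nat)) = \<rho> V (f [^]\<^bsub>A\<^esub> L) \<otimes>\<^bsub>sec OX V\<^esub> \<rho> V (f [^]\<^bsub>A\<^esub> K)"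
  using ring_hom_mult[OF ring_hom_cring.homh[OF \<rho>_hom[OF assms(1,2)]], of "f [^]\<^bsub>A\<^esub> L" "f [^]\<^bsub>A\<^esub> K"] assms
  by (simp add: A.nat_pow_mult add.commute)

text \<open>The restricted basis is again a basis, so the coordinates of \<open>m\<close> restrict
  to zero. The ring case applies to each of them, with one exponent for all.\<close>

lemma free_section_vanish:
  assumes f: "f \<in> carrier A" and g: "g \<in> carrier A" and b: "free_basis X OX M n (D g) e"
    and m: "m \<in> carrier (sec M (D g))"
    and z: "res M (D g) (D (f \<otimes>\<^bsub>A\<^esub> g)) m = \<zero>\<^bsub>sec M (D (f \<otimes>\<^bsub>A\<^esub> g))\<^esub>"
  shows "\<exists>K::nat. act (D g) (f [^]\<^bsub>A\<^esub> K) m = \<zero>\<^bsub>sec M (D g)\<^esub>"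
proof -
  let ?W = "D (f \<otimes>\<^bsub>A\<^esub> g)"
  have fg: "f \<otimes>\<^bsub>A\<^esub> g \<in> carrier A" "?W \<subseteq> D g" using f g D_mult by auto
  note o = D_open[OF g] D_open[OF fg(1)] fg(2)
  note e = free_basis_closed[OF b]
  interpret V: Module.module "sec OX (D g)" "sec M (D g)" by (rule M_module[OF o(1)])
  interpret W: Module.module "sec OX ?W" "sec M ?W" by (rule M_module[OF o(2)])
  interpret r: ring_hom_cring "sec OX (D g)" "sec OX ?W" "res OX (D g) ?W"
    by (rule OX_res_hom[OF o])
  obtain c where c0: "\<forall>i < n. c i \<in> carrier (sec OX (D g))"
    "m = (\<Oplus>\<^bsub>sec M (D g)\<^esub>i \<in> {..<n}. c i \<odot>\<^bsub>sec M (D g)\<^esub> e i)"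
    using free_basis_expand[OF b m] by (elim exE conjE)
  note c = c0(1)[rule_format] c0(2)
  let ?r = "res OX (D g) ?W" and ?e = "\<lambda>i. res M (D g) ?W (e i)"
  note b' = free_basis_restrict[OF b o(2,3)]
  have e': "?e i \<in> carrier (sec M ?W)" if "i < n" for i
    by (rule res_closed[OF o e[OF that]])
  have "(\<Oplus>\<^bsub>sec M ?W\<^esub>i \<in> {..<n}. ?r (c i) \<odot>\<^bsub>sec M ?W\<^esub> ?e i) =
    res M (D g) ?W m"
    unfolding c(2) using c(1) e e' by (subst res_finsum[OF o]) (auto intro!: W.M.finsum_cong' simp: res_smult[OF o])
  also have "\<dots> = (\<Oplus>\<^bsub>sec M ?W\<^esub>i \<in> {..<n}. \<zero>\<^bsub>sec OX ?W\<^esub> \<odot>\<^bsub>sec M ?W\<^esub> ?e i)"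
    unfolding z using e' by (intro W.M.add.finprod_one_eqI[symmetric]) auto
  finally have z': "?r (c i) = \<zero>\<^bsub>sec OX ?W\<^esub>" if "i < n" for i
    using c(1) that by (intro free_basis_unique[OF b', of "\<lambda>i. ?r (c i)"]) auto
  have "\<exists>K::nat. \<forall>i < n. \<rho> (D g) (f [^]\<^bsub>A\<^esub> K) \<otimes>\<^bsub>sec OX (D g)\<^esub> c i = \<zero>\<^bsub>sec OX (D g)\<^esub>"
  proof (rule ex_uniform_bound)
    show "\<exists>K::nat. \<rho> (D g) (f [^]\<^bsub>A\<^esub> K) \<otimes>\<^bsub>sec OX (D g)\<^esub> c i = \<zero>\<^bsub>sec OX (D g)\<^esub>" if "i < n" for i
      by (rule ring_section_vanish[OF f g c(1)[OF that] z'[OF that]])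
    show "\<rho> (D g) (f [^]\<^bsub>A\<^esub> (K + L)) \<otimes>\<^bsub>sec OX (D g)\<^esub> c i = \<zero>\<^bsub>sec OX (D g)\<^esub>"
      if "i < n" "\<rho> (D g) (f [^]\<^bsub>A\<^esub> K) \<otimes>\<^bsub>sec OX (D g)\<^esub> c i = \<zero>\<^bsub>sec OX (D g)\<^esub>" for i and K L :: nat
      using that c(1) f \<rho>_closed[OF o(1) D_sub[OF g]]
      by (simp add: \<rho>_pow_add[OF o(1) D_sub[OF g]] V.R.m_assoc)
  qed
  then obtain K :: nat where K: "\<And>i. i < n \<Longrightarrow> \<rho> (D g) (f [^]\<^bsub>A\<^esub> K) \<otimes>\<^bsub>sec OX (D g)\<^esub> c i = \<zero>\<^bsub>sec OX (D g)\<^esub>"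
    by blast
  have "act (D g) (f [^]\<^bsub>A\<^esub> K) m = (\<Oplus>\<^bsub>sec M (D g)\<^esub>i \<in> {..<n}. (\<rho> (D g) (f [^]\<^bsub>A\<^esub> K) \<otimes>\<^bsub>sec OX (D g)\<^esub> c i) \<odot>\<^bsub>sec M (D g)\<^esub> e i)"
    unfolding c(2) using c(1) e f by (intro act_finsum[OF o(1) D_sub[OF g]]) auto
  also have "\<dots> = \<zero>\<^bsub>sec M (D g)\<^esub>"
    using K e by (intro V.M.add.finprod_one_eqI) auto
  finally show ?thesis by blast
qed

text \<open>The basis elements already live over \<open>D g\<close>; only the coordinates of
  \<open>m\<close> have to be extended, and the ring case does this after a common power of
  \<open>f\<close>.\<close>

lemma free_section_extend:
  assumes f: "f \<in> carrier A" and g: "g \<in> carrier A" and b: "free_basis X OX M n (D g) e"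
    and m: "m \<in> carrier (sec M (D (f \<otimes>\<^bsub>A\<^esub> g)))"
  shows "\<exists>K::nat. \<exists>t \<in> carrier (sec M (D g)).
    res M (D g) (D (f \<otimes>\<^bsub>A\<^esub> g)) t = act (D (f \<otimes>\<^bsub>A\<^esub> g)) (f [^]\<^bsub>A\<^esub> K) m"
proof -
  let ?W = "D (f \<otimes>\<^bsub>A\<^esub> g)"
  have fg: "f \<otimes>\<^bsub>A\<^esub> g \<in> carrier A" "?W \<subseteq> D g" using f g D_mult by auto
  note o = D_open[OF g] D_open[OF fg(1)] fg(2)
  note e = free_basis_closed[OF b]
  interpret V: Module.module "sec OX (D g)" "sec M (D g)" by (rule M_module[OF o(1)])
  interpret W: Module.module "sec OX ?W" "sec M ?W" by (rule M_module[OF o(2)])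
  interpret r: ring_hom_cring "sec OX (D g)" "sec OX ?W" "res OX (D g) ?W"
    by (rule OX_res_hom[OF o])
  let ?r = "res OX (D g) ?W" and ?e = "\<lambda>i. res M (D g) ?W (e i)"
  let ?\<rho> = "\<lambda>K. \<rho> ?W (f [^]\<^bsub>A\<^esub> (K::nat))"
  note b' = free_basis_restrict[OF b o(2,3)]
  have e': "?e i \<in> carrier (sec M ?W)" if "i < n" for i
    by (rule res_closed[OF o e[OF that]])
  obtain c where c0: "\<forall>i < n. c i \<in> carrier (sec OX ?W)"
    "m = (\<Oplus>\<^bsub>sec M ?W\<^esub>i \<in> {..<n}. c i \<odot>\<^bsub>sec M ?W\<^esub> ?e i)"
    using free_basis_expand[OF b' m] by (elim exE conjE)
  note c = c0(1)[rule_format] c0(2)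
  have \<rho>c: "?\<rho> K \<in> carrier (sec OX ?W)" for K
    using \<rho>_closed[OF o(2) D_sub[OF fg(1)]] f by simp
  have "\<exists>K. \<forall>i < n. \<exists>d \<in> carrier (sec OX (D g)). ?r d = ?\<rho> K \<otimes>\<^bsub>sec OX ?W\<^esub> c i"
  proof (rule ex_uniform_bound)
    show "\<exists>K. \<exists>d \<in> carrier (sec OX (D g)). ?r d = ?\<rho> K \<otimes>\<^bsub>sec OX ?W\<^esub> c i" if "i < n" for i
      by (rule ring_section_extend[OF f g c(1)[OF that]])
    show "\<exists>d \<in> carrier (sec OX (D g)). ?r d = ?\<rho> (K + L) \<otimes>\<^bsub>sec OX ?W\<^esub> c i"
      if i: "i < n" and ex: "\<exists>d \<in> carrier (sec OX (D g)). ?r d = ?\<rho> K \<otimes>\<^bsub>sec OX ?W\<^esub> c i" for i K L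
    proof -
      obtain d where d: "d \<in> carrier (sec OX (D g))" "?r d = ?\<rho> K \<otimes>\<^bsub>sec OX ?W\<^esub> c i"
        using ex by blast
      let ?l = "\<rho> (D g) (f [^]\<^bsub>A\<^esub> L)"
      have l: "?l \<in> carrier (sec OX (D g))" using \<rho>_closed[OF o(1) D_sub[OF g]] f by simp
      have "?r (?l \<otimes>\<^bsub>sec OX (D g)\<^esub> d) = ?\<rho> L \<otimes>\<^bsub>sec OX ?W\<^esub> (?\<rho> K \<otimes>\<^bsub>sec OX ?W\<^esub> c i)"
        using l d res_\<rho>[OF o(1,2) D_sub[OF g] o(3), of "f [^]\<^bsub>A\<^esub> L"] f by simp
      also have "\<dots> = ?\<rho> (K + L) \<otimes>\<^bsub>sec OX ?W\<^esub> c i"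
        using c(1)[OF i] \<rho>c f by (simp add: \<rho>_pow_add[OF o(2) D_sub[OF fg(1)]] W.R.m_assoc)
      finally show ?thesis using l d by blast
    qed
  qed
  then obtain K d where d: "\<And>i. i < n \<Longrightarrow> d i \<in> carrier (sec OX (D g))"
    "\<And>i. i < n \<Longrightarrow> ?r (d i) = ?\<rho> K \<otimes>\<^bsub>sec OX ?W\<^esub> c i"
    by metis
  define t where "t = (\<Oplus>\<^bsub>sec M (D g)\<^esub>i \<in> {..<n}. d i \<odot>\<^bsub>sec M (D g)\<^esub> e i)"
  have t: "t \<in> carrier (sec M (D g))" unfolding t_def using d e by (intro V.M.finsum_closed) auto
  have "res M (D g) ?W t = (\<Oplus>\<^bsub>sec M ?W\<^esub>i \<in> {..<n}. (?\<rho> K \<otimes>\<^bsub>sec OX ?W\<^esub> c i) \<odot>\<^bsub>sec M ?W\<^esub> ?e i)"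
    unfolding t_def using d e e' c(1) \<rho>c
    by (subst res_finsum[OF o]) (auto intro!: W.M.finsum_cong' simp: res_smult[OF o])
  also have "\<dots> = act ?W (f [^]\<^bsub>A\<^esub> K) m"
    unfolding c(2) using c(1) e' f by (intro act_finsum[OF o(2) D_sub[OF fg(1)], symmetric]) auto
  finally show ?thesis using t by blast
qed

lemma locally_free_chart:
  assumes lf: "locally_free X OX M n" and W: "openin X W" "W \<subseteq> U" "x \<in> W"
  shows "\<exists>r \<in> carrier A. \<exists>e. x \<in> D r \<and> D r \<subseteq> W \<and> free_basis X OX M n (D r) e"
proof -
  have "x \<in> topspace X" using openin_subset[OF W(1)] W(3) by blast
  then obtain V e where V: "x \<in> V" "free_basis X OX M n V e" using lf unfolding locally_free_def by blast
  have o: "openin X (V \<inter> W)" using free_basis_open[OF V(2)] W(1) by blast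
  obtain r where r: "r \<in> carrier A" "x \<in> D r" "D r \<subseteq> V \<inter> W"
    using D_basis[OF o, of x] V W by blast
  have "free_basis X OX M n (D r) (\<lambda>i. res M V (D r) (e i))"
    using r by (intro free_basis_restrict[OF V(2) D_open]) auto
  then show ?thesis using r by blast
qed

text \<open>Induction over the chart, starting from small basic open sets that carry a basis. When
  two sets are joined, the sum of their exponents works on both, and separation gives vanishing on
  the union.\<close>

lemma section_vanish:
  assumes lf: "locally_free X OX M n" and f: "f \<in> carrier A" and g: "g \<in> carrier A"
    and m: "m \<in> carrier (sec M (D g))"
    and z: "res M (D g) (D (f \<otimes>\<^bsub>A\<^esub> g)) m = \<zero>\<^bsub>sec M (D (f \<otimes>\<^bsub>A\<^esub> g))\<^esub>"
  shows "\<exists>K::nat. act (D g) (f [^]\<^bsub>A\<^esub> K) m = \<zero>\<^bsub>sec M (D g)\<^esub>"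
proof -
  \<comment> \<open>The inclusion belongs to the predicate because \<open>m\<close> lives over
    \<open>D g\<close>; it survives joining since both parts lie in \<open>D g\<close>.\<close>
  define Q where "Q r \<longleftrightarrow> D r \<subseteq> D g \<and>
    (\<exists>K::nat. act (D r) (f [^]\<^bsub>A\<^esub> K) (res M (D g) (D r) m) = \<zero>\<^bsub>sec M (D r)\<^esub>)" for r
  have fK: "f [^]\<^bsub>A\<^esub> (K::nat) \<in> carrier A" for K using f by simp
  have rm: "res M (D g) (D r) m \<in> carrier (sec M (D r))" if "r \<in> carrier A" "D r \<subseteq> D g" for r
    by (rule res_closed[OF D_open[OF g] D_open[OF that(1)] that(2) m])
  have up: "act (D r) (f [^]\<^bsub>A\<^esub> (K + L)) (res M (D g) (D r) m) = \<zero>\<^bsub>sec M (D r)\<^esub>"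
    if r: "r \<in> carrier A" "D r \<subseteq> D g"
      and z: "act (D r) (f [^]\<^bsub>A\<^esub> L) (res M (D g) (D r) m) = \<zero>\<^bsub>sec M (D r)\<^esub>" for r and K L :: nat
    by (simp only: act_pow_add[OF D_open[OF r(1)] D_sub[OF r(1)] f rm[OF r]] z
      act_zero[OF D_open[OF r(1)] D_sub[OF r(1)] fK])
  have "Q g" using g
  proof (induction rule: chart_induct)
    case zero
    \<comment> \<open>\<open>D\<close> of zero is empty, and separation for the empty cover
      identifies all sections over the empty set.\<close>
    have "x = y" if "x \<in> carrier (sec M (D \<zero>\<^bsub>A\<^esub>))" "y \<in> carrier (sec M (D \<zero>\<^bsub>A\<^esub>))" for x y
      by (rule separated[of "{}"]) (use that D_zero in auto)
    moreover have "\<zero>\<^bsub>sec M (D \<zero>\<^bsub>A\<^esub>)\<^esub> \<in> carrier (sec M (D \<zero>\<^bsub>A\<^esub>))"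
    proof -
      interpret Z: Module.module "sec OX (D \<zero>\<^bsub>A\<^esub>)" "sec M (D \<zero>\<^bsub>A\<^esub>)" by (rule M_module[OF D_open]) simp
      show ?thesis by simp
    qed
    moreover have "D \<zero>\<^bsub>A\<^esub> \<subseteq> D g" using D_zero by simp
    ultimately show ?case
      using act_closed[OF D_open D_sub fK[of 0] rm, of "\<zero>\<^bsub>A\<^esub>"] unfolding Q_def by blast
  next
    case (join a b r)
    obtain K L :: nat where K: "act (D a) (f [^]\<^bsub>A\<^esub> K) (res M (D g) (D a) m) = \<zero>\<^bsub>sec M (D a)\<^esub>"
      and L: "act (D b) (f [^]\<^bsub>A\<^esub> L) (res M (D g) (D b) m) = \<zero>\<^bsub>sec M (D b)\<^esub>"
      and ab: "D a \<subseteq> D g" "D b \<subseteq> D g" using join unfolding Q_def by blast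
    have K': "act (D a) (f [^]\<^bsub>A\<^esub> (K + L)) (res M (D g) (D a) m) = \<zero>\<^bsub>sec M (D a)\<^esub>"
      using up[OF join(1) ab(1) K, of L] by (simp add: add.commute)
    have L': "act (D b) (f [^]\<^bsub>A\<^esub> (K + L)) (res M (D g) (D b) m) = \<zero>\<^bsub>sec M (D b)\<^esub>"
      by (rule up[OF join(2) ab(2) L])
    have rg: "D r \<subseteq> D g" using join ab by blast
    let ?x = "act (D r) (f [^]\<^bsub>A\<^esub> (K + L)) (res M (D g) (D r) m)"
    interpret V: Module.module "sec OX (D r)" "sec M (D r)" by (rule M_module[OF D_open[OF join(3)]])
    have x: "?x \<in> carrier (sec M (D r))" using join rm[OF _ rg] fK by (intro act_closed D_open D_sub) auto
    have *: "res M (D r) (D r \<inter> D c) ?x = res M (D r) (D r \<inter> D c) \<zero>\<^bsub>sec M (D r)\<^esub>"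
      if c: "c \<in> carrier A" "D c \<subseteq> D g" "act (D c) (f [^]\<^bsub>A\<^esub> (K + L)) (res M (D g) (D c) m) = \<zero>\<^bsub>sec M (D c)\<^esub>" for c
    proof -
      note o = D_open[OF join(3)] D_open[OF c(1)] openin_Int[OF D_open[OF join(3)] D_open[OF c(1)]]
      have "res M (D r) (D r \<inter> D c) ?x = act (D r \<inter> D c) (f [^]\<^bsub>A\<^esub> (K + L)) (res M (D g) (D r \<inter> D c) m)"
        using res_act[OF o(1,3) D_sub[OF join(3)] Int_lower1 fK rm[OF join(3) rg]]
          res_trans[OF D_open[OF g] o(1,3) Int_lower1 rg m] by simp
      also have "\<dots> = res M (D c) (D r \<inter> D c) (act (D c) (f [^]\<^bsub>A\<^esub> (K + L)) (res M (D g) (D c) m))"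
        using res_act[OF o(2,3) D_sub[OF c(1)] Int_lower2 fK rm[OF c(1,2)]]
          res_trans[OF D_open[OF g] o(2,3) Int_lower2 c(2) m] by simp
      also have "\<dots> = \<zero>\<^bsub>sec M (D r \<inter> D c)\<^esub>" unfolding c(3) by (rule res_zero[OF o(2,3) Int_lower2])
      also have "\<dots> = res M (D r) (D r \<inter> D c) \<zero>\<^bsub>sec M (D r)\<^esub>" by (rule res_zero[OF o(1,3) Int_lower1, symmetric])
      finally show ?thesis .
    qed
    have "?x = \<zero>\<^bsub>sec M (D r)\<^esub>"
      by (rule sheaf_separated2[OF M_sheaf D_open[OF join(3)] D_open[OF join(1)] D_open[OF join(2)] join(4) x V.M.zero_closed
            *[OF join(1) ab(1) K'] *[OF join(2) ab(2) L']])
    then show ?case using rg unfolding Q_def by blast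
  next
    case (local x)
    obtain r e where r: "r \<in> carrier A" "x \<in> D r" "D r \<subseteq> D g" "free_basis X OX M n (D r) e"
      using locally_free_chart[OF lf D_open[OF g] D_sub[OF g] local] by blast
    have fr: "f \<otimes>\<^bsub>A\<^esub> r \<in> carrier A" "D (f \<otimes>\<^bsub>A\<^esub> r) \<subseteq> D r" "D (f \<otimes>\<^bsub>A\<^esub> r) \<subseteq> D (f \<otimes>\<^bsub>A\<^esub> g)"
      "f \<otimes>\<^bsub>A\<^esub> g \<in> carrier A" "D (f \<otimes>\<^bsub>A\<^esub> g) \<subseteq> D g"
      using r f g D_mult by auto
    have "res M (D r) (D (f \<otimes>\<^bsub>A\<^esub> r)) (res M (D g) (D r) m) = res M (D (f \<otimes>\<^bsub>A\<^esub> g)) (D (f \<otimes>\<^bsub>A\<^esub> r)) (res M (D g) (D (f \<otimes>\<^bsub>A\<^esub> g)) m)"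
      using res_trans[OF D_open[OF g] D_open[OF r(1)] D_open[OF fr(1)] fr(2) r(3) m]
        res_trans[OF D_open[OF g] D_open[OF fr(4)] D_open[OF fr(1)] fr(3) fr(5) m] by simp
    also have "\<dots> = \<zero>\<^bsub>sec M (D (f \<otimes>\<^bsub>A\<^esub> r))\<^esub>"
      unfolding z by (rule res_zero[OF D_open[OF fr(4)] D_open[OF fr(1)] fr(3)])
    finally have "Q r" using free_section_vanish[OF f r(1,4) rm[OF r(1,3)]] r(3) unfolding Q_def by blast
    then show ?case using r by blast
  qed
  then show ?thesis unfolding Q_def res_id[OF D_open[OF g] m] by blast
qed

text \<open>Local extensions exist where there is a basis. To join two of them, both are made to
  extend the same multiple of \<open>s\<close>; their difference on the overlap then vanishes where
  \<open>f\<close> is invertible, and \<open>section_vanish\<close> removes it at the cost of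
  another power of \<open>f\<close>.\<close>

proposition section_extend:
  assumes lf: "locally_free X OX M n" and f: "f \<in> carrier A" and s: "s \<in> carrier (sec M (D f))"
  shows "\<exists>K::nat. \<exists>t \<in> carrier (sec M U). res M U (D f) t = act (D f) (f [^]\<^bsub>A\<^esub> K) s"
proof -
  \<comment> \<open>Over \<open>D r\<close> the section \<open>s\<close> is available only on the
    intersection with \<open>D f\<close>, so the extension is compared with it there.\<close>
  define Q where "Q r \<longleftrightarrow> (\<exists>K::nat. \<exists>t \<in> carrier (sec M (D r)). res M (D r) (D f \<inter> D r) t =
    act (D f \<inter> D r) (f [^]\<^bsub>A\<^esub> K) (res M (D f) (D f \<inter> D r) s))" for r
  have fK: "f [^]\<^bsub>A\<^esub> (K::nat) \<in> carrier A" for K using f by simp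
  note fo = D_open[OF f]
  have so: "openin X (D f \<inter> W)" "D f \<inter> W \<subseteq> U" if "openin X W" for W
    using fo D_sub[OF f] that by auto
  have sr: "res M (D f) W s \<in> carrier (sec M W)" if "openin X W" "W \<subseteq> D f" for W
    by (rule res_closed[OF fo that s])
  \<comment> \<open>Bookkeeping of exponents: if \<open>t\<close> extends the multiple of
    \<open>s\<close> with exponent \<open>K\<close>, then its multiple by \<open>f [^] L\<close>
    restricts to the multiple of \<open>s\<close> with exponent \<open>L + K\<close> on every
    smaller open set.\<close>
  have shift: "res M (D a) W (act (D a) (f [^]\<^bsub>A\<^esub> L) t) = act W (f [^]\<^bsub>A\<^esub> (L + K)) (res M (D f) W s)"
    if a: "a \<in> carrier A" and t: "t \<in> carrier (sec M (D a))"
      and eq: "res M (D a) (D f \<inter> D a) t = act (D f \<inter> D a) (f [^]\<^bsub>A\<^esub> K) (res M (D f) (D f \<inter> D a) s)"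
      and W: "openin X W" "W \<subseteq> D f \<inter> D a" for a t W and K L :: nat
  proof -
    note o = D_open[OF a] openin_Int[OF fo D_open[OF a]]
    have Wa: "W \<subseteq> D a" "W \<subseteq> D f" "W \<subseteq> U" using W D_sub[OF a] by auto
    have "res M (D a) W t = res M (D f \<inter> D a) W (res M (D a) (D f \<inter> D a) t)"
      by (rule res_trans[OF o W(1,2) Int_lower2 t, symmetric])
    also have "\<dots> = act W (f [^]\<^bsub>A\<^esub> K) (res M (D f) W s)"
      using res_act[OF o(2) W(1) so(2)[OF o(1)] W(2) fK sr[OF o(2) Int_lower1], of K]
        res_trans[OF fo o(2) W(1,2) Int_lower1 s] by (simp only: eq)
    finally have "res M (D a) W t = act W (f [^]\<^bsub>A\<^esub> K) (res M (D f) W s)" .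
    then show ?thesis
      using res_act[OF o(1) W(1) D_sub[OF a] Wa(1) fK t] act_pow_add[OF W(1) Wa(3) f sr[OF W(1) Wa(2)]] by simp
  qed
  have "Q \<one>\<^bsub>A\<^esub>" using A.one_closed
  proof (induction rule: chart_induct)
    case zero
    have "x = y" if "x \<in> carrier (sec M (D f \<inter> D \<zero>\<^bsub>A\<^esub>))" "y \<in> carrier (sec M (D f \<inter> D \<zero>\<^bsub>A\<^esub>))" for x y
      by (rule separated[of "{}"]) (use that D_zero in auto)
    moreover obtain t where t: "t \<in> carrier (sec M (D \<zero>\<^bsub>A\<^esub>))"
    proof -
      interpret Z: Module.module "sec OX (D \<zero>\<^bsub>A\<^esub>)" "sec M (D \<zero>\<^bsub>A\<^esub>)" by (rule M_module[OF D_open]) simp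
      show ?thesis using that Z.M.zero_closed by blast
    qed
    moreover note o = D_open[OF A.zero_closed]
    moreover have "res M (D \<zero>\<^bsub>A\<^esub>) (D f \<inter> D \<zero>\<^bsub>A\<^esub>) t \<in> carrier (sec M (D f \<inter> D \<zero>\<^bsub>A\<^esub>))"
      by (rule res_closed[OF o so(1)[OF o] Int_lower2 t])
    ultimately show ?case unfolding Q_def
      using act_closed[OF so[OF o] fK[of 0] sr[OF so(1)[OF o] Int_lower1]] by blast
  next
    case (join a b r)
    obtain K L :: nat and ta tb where ta: "ta \<in> carrier (sec M (D a))"
        "res M (D a) (D f \<inter> D a) ta = act (D f \<inter> D a) (f [^]\<^bsub>A\<^esub> K) (res M (D f) (D f \<inter> D a) s)"
      and tb: "tb \<in> carrier (sec M (D b))"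
        "res M (D b) (D f \<inter> D b) tb = act (D f \<inter> D b) (f [^]\<^bsub>A\<^esub> L) (res M (D f) (D f \<inter> D b) s)"
      using join unfolding Q_def by blast
    note oa = D_open[OF join(1)] and ob = D_open[OF join(2)] and or = D_open[OF join(3)]
    define c where "c = a \<otimes>\<^bsub>A\<^esub> b"
    have c: "c \<in> carrier A" "D c = D a \<inter> D b" unfolding c_def using join D_mult by auto
    note oc = D_open[OF c(1)]
    have ca: "D c \<subseteq> D a" "D c \<subseteq> D b" using c by auto
    have fc: "f \<otimes>\<^bsub>A\<^esub> c \<in> carrier A" "D (f \<otimes>\<^bsub>A\<^esub> c) = D f \<inter> D c" using f c D_mult by auto
    have fca: "D (f \<otimes>\<^bsub>A\<^esub> c) \<subseteq> D f \<inter> D a" "D (f \<otimes>\<^bsub>A\<^esub> c) \<subseteq> D f \<inter> D b" "D (f \<otimes>\<^bsub>A\<^esub> c) \<subseteq> D c" using fc ca by auto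
    \<comment> \<open>Crossing over the exponents makes both sections restrict to the multiple of
      \<open>s\<close> by \<open>f [^] (K + L)\<close>.\<close>
    define ua ub where "ua = act (D a) (f [^]\<^bsub>A\<^esub> L) ta" and "ub = act (D b) (f [^]\<^bsub>A\<^esub> K) tb"
    have ua: "ua \<in> carrier (sec M (D a))" unfolding ua_def by (rule act_closed[OF oa D_sub[OF join(1)] fK ta(1)])
    have ub: "ub \<in> carrier (sec M (D b))" unfolding ub_def by (rule act_closed[OF ob D_sub[OF join(2)] fK tb(1)])
    interpret V: Module.module "sec OX (D c)" "sec M (D c)" by (rule M_module[OF oc])
    interpret W: Module.module "sec OX (D (f \<otimes>\<^bsub>A\<^esub> c))" "sec M (D (f \<otimes>\<^bsub>A\<^esub> c))" by (rule M_module[OF D_open[OF fc(1)]])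
    let ?ua = "res M (D a) (D c) ua" and ?ub = "res M (D b) (D c) ub"
    have uac: "?ua \<in> carrier (sec M (D c))" by (rule res_closed[OF oa oc ca(1) ua])
    have ubc: "?ub \<in> carrier (sec M (D c))" by (rule res_closed[OF ob oc ca(2) ub])
    have "res M (D c) (D (f \<otimes>\<^bsub>A\<^esub> c)) ?ua = res M (D c) (D (f \<otimes>\<^bsub>A\<^esub> c)) ?ub"
      unfolding res_trans[OF oa oc D_open[OF fc(1)] fca(3) ca(1) ua] res_trans[OF ob oc D_open[OF fc(1)] fca(3) ca(2) ub]
      unfolding ua_def ub_def shift[OF join(1) ta D_open[OF fc(1)] fca(1)] shift[OF join(2) tb D_open[OF fc(1)] fca(2)]
      by (simp add: add.commute)
    then have "res M (D c) (D (f \<otimes>\<^bsub>A\<^esub> c)) (?ua \<ominus>\<^bsub>sec M (D c)\<^esub> ?ub) = \<zero>\<^bsub>sec M (D (f \<otimes>\<^bsub>A\<^esub> c))\<^esub>"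
      unfolding res_minus[OF oc D_open[OF fc(1)] fca(3) uac ubc]
      using res_closed[OF oc D_open[OF fc(1)] fca(3) ubc] by (simp add: a_minus_def W.M.r_neg)
    \<comment> \<open>The restrictions of \<open>ua\<close> and \<open>ub\<close> agree on the part
      of \<open>D c\<close> inside \<open>D f\<close>; the power \<open>N\<close> makes them agree
      on all of \<open>D c\<close>, the overlap of \<open>D a\<close> and
      \<open>D b\<close>.\<close>
    then obtain N :: nat where "act (D c) (f [^]\<^bsub>A\<^esub> N) (?ua \<ominus>\<^bsub>sec M (D c)\<^esub> ?ub) = \<zero>\<^bsub>sec M (D c)\<^esub>"
      using section_vanish[OF lf f c(1) V.M.minus_closed[OF uac ubc]] by blast
    then have "act (D c) (f [^]\<^bsub>A\<^esub> N) ?ua \<ominus>\<^bsub>sec M (D c)\<^esub> act (D c) (f [^]\<^bsub>A\<^esub> N) ?ub = \<zero>\<^bsub>sec M (D c)\<^esub>"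
      unfolding act_minus[OF oc D_sub[OF c(1)] fK uac ubc] .
    then have eq: "act (D c) (f [^]\<^bsub>A\<^esub> N) ?ua = act (D c) (f [^]\<^bsub>A\<^esub> N) ?ub"
      using act_closed[OF oc D_sub[OF c(1)] fK uac] act_closed[OF oc D_sub[OF c(1)] fK ubc]
      by (simp add: abelian_group.minus_eq_zero_iff[OF V.M.abelian_group_axioms])
    define va vb where "va = act (D a) (f [^]\<^bsub>A\<^esub> (N + L)) ta" and "vb = act (D b) (f [^]\<^bsub>A\<^esub> (N + K)) tb"
    have va: "va = act (D a) (f [^]\<^bsub>A\<^esub> N) ua" "va \<in> carrier (sec M (D a))"
      unfolding va_def ua_def
      by (rule act_pow_add[OF oa D_sub[OF join(1)] f ta(1)], rule act_closed[OF oa D_sub[OF join(1)] fK ta(1)])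
    have vb: "vb = act (D b) (f [^]\<^bsub>A\<^esub> N) ub" "vb \<in> carrier (sec M (D b))"
      unfolding vb_def ub_def
      by (rule act_pow_add[OF ob D_sub[OF join(2)] f tb(1)], rule act_closed[OF ob D_sub[OF join(2)] fK tb(1)])
    have "res M (D a) (D a \<inter> D b) va = res M (D b) (D a \<inter> D b) vb"
      unfolding c(2)[symmetric] va(1) vb(1)
      using eq res_act[OF oa oc D_sub[OF join(1)] ca(1) fK ua] res_act[OF ob oc D_sub[OF join(2)] ca(2) fK ub] by simp
    then obtain t where t: "t \<in> carrier (sec M (D a \<union> D b))" "res M (D a \<union> D b) (D a) t = va" "res M (D a \<union> D b) (D b) t = vb"
      using sheaf_glue2[OF M_sheaf oa ob va(2) vb(2)] by blast
    note ou = openin_Un[OF oa ob]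
    let ?t = "res M (D a \<union> D b) (D r) t" and ?V = "D f \<inter> D r"
    have t': "?t \<in> carrier (sec M (D r))" by (rule res_closed[OF ou or join(4) t(1)])
    note oV = so[OF or]
    have st: "res M (D f) ?V s \<in> carrier (sec M ?V)" by (rule sr[OF oV(1) Int_lower1])
    have rt: "res M (D r) ?V ?t \<in> carrier (sec M ?V)" by (rule res_closed[OF or oV(1) Int_lower2 t'])
    \<comment> \<open>The total exponent \<open>N + L + K\<close> splits into the part
      \<open>I\<close> already applied to the local extension and the part \<open>J\<close>
      contained in it. On \<open>D a\<close> these are \<open>N + L\<close> and \<open>K\<close>, on
      \<open>D b\<close> they are \<open>N + K\<close> and \<open>L\<close>.\<close>
    have loc: "res M ?V (?V \<inter> D d) (res M (D r) ?V ?t) =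
        res M ?V (?V \<inter> D d) (act ?V (f [^]\<^bsub>A\<^esub> (N + L + K)) (res M (D f) ?V s))"
      if d: "d \<in> carrier A" "D d \<subseteq> D a \<union> D b" and x: "x \<in> carrier (sec M (D d))"
        "res M (D a \<union> D b) (D d) t = act (D d) (f [^]\<^bsub>A\<^esub> I) x"
        "res M (D d) (D f \<inter> D d) x = act (D f \<inter> D d) (f [^]\<^bsub>A\<^esub> J) (res M (D f) (D f \<inter> D d) s)"
        "I + J = N + L + K" for d x and I J :: nat
    proof -
      note od = D_open[OF d(1)] openin_Int[OF oV(1) D_open[OF d(1)]]
      have sub: "?V \<inter> D d \<subseteq> D r" "?V \<inter> D d \<subseteq> D f \<inter> D d" "?V \<inter> D d \<subseteq> D a \<union> D b" "?V \<subseteq> D r" "?V \<subseteq> D f"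
        using d by auto
      have "res M ?V (?V \<inter> D d) (res M (D r) ?V ?t) = res M (D d) (?V \<inter> D d) (res M (D a \<union> D b) (D d) t)"
        unfolding res_trans[OF or oV(1) od(2) Int_lower1 sub(4) t'] res_trans[OF ou or od(2) sub(1) join(4) t(1)]
          res_trans[OF ou od Int_lower2 d(2) t(1)] ..
      also have "\<dots> = act (?V \<inter> D d) (f [^]\<^bsub>A\<^esub> (N + L + K)) (res M (D f) (?V \<inter> D d) s)"
        unfolding x(2) using shift[OF d(1) x(1,3) od(2) sub(2), of I] x(4) by simp
      also have "\<dots> = res M ?V (?V \<inter> D d) (act ?V (f [^]\<^bsub>A\<^esub> (N + L + K)) (res M (D f) ?V s))"
        unfolding res_act[OF oV(1) od(2) oV(2) Int_lower1 fK st] res_trans[OF fo oV(1) od(2) Int_lower1 sub(5) s] ..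
      finally show ?thesis .
    qed
    have "res M (D r) ?V ?t = act ?V (f [^]\<^bsub>A\<^esub> (N + L + K)) (res M (D f) ?V s)"
    proof (rule sheaf_separated2[OF M_sheaf oV(1) oa ob _ rt act_closed[OF oV fK st]])
      show "?V \<subseteq> D a \<union> D b" using join(4) by blast
      show "res M ?V (?V \<inter> D a) (res M (D r) ?V ?t) =
        res M ?V (?V \<inter> D a) (act ?V (f [^]\<^bsub>A\<^esub> (N + L + K)) (res M (D f) ?V s))"
        by (rule loc[OF join(1) Un_upper1 ta(1) _ ta(2), of "N + L"]) (simp_all add: t va_def)
      show "res M ?V (?V \<inter> D b) (res M (D r) ?V ?t) =
        res M ?V (?V \<inter> D b) (act ?V (f [^]\<^bsub>A\<^esub> (N + L + K)) (res M (D f) ?V s))"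
        by (rule loc[OF join(2) Un_upper2 tb(1) _ tb(2), of "N + K"]) (simp_all add: t vb_def)
    qed
    then show ?case using t' unfolding Q_def by blast
  next
    case (local x)
    obtain r e where r: "r \<in> carrier A" "x \<in> D r" "free_basis X OX M n (D r) e"
      using locally_free_chart[OF lf D_open[OF A.one_closed] D_sub[OF A.one_closed] local] by blast
    note or = D_open[OF r(1)]
    have eq: "D (f \<otimes>\<^bsub>A\<^esub> r) = D f \<inter> D r" using f r D_mult by simp
    have "Q r" unfolding Q_def
      using free_section_extend[OF f r(1,3), unfolded eq, OF sr[OF so(1)[OF or] Int_lower1]] .
    then show ?case using r by blast
  qed
  \<comment> \<open>The unit has \<open>D\<close> equal to \<open>U\<close>, so the overlap with
    \<open>D f\<close> in the predicate is \<open>D f\<close> itself.\<close>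
  moreover have "D f \<inter> U = D f" using D_sub[OF f] by blast
  ultimately show ?thesis unfolding Q_def D_one res_id[OF fo s] using res_id[OF fo s] by simp
qed

end

section \<open>Two-by-two matrices\<close>

lemma lessThan_2: "{..<2::nat} = {0, 1}"
  by auto

lemma permutes_lessThan_2: "{p. p permutes {..<2::nat}} = {id, transpose 0 1}"
proof (intro equalityI subsetI)
  fix p :: "nat \<Rightarrow> nat" assume "p \<in> {p. p permutes {..<2}}"
  then have p: "p permutes {0, 1}" by (simp add: lessThan_2)
  have v: "p 0 \<in> {0, 1}" "p 1 \<in> {0, 1}" "p 0 \<noteq> p 1"
    using permutes_in_image[OF p] permutes_inj[OF p] by (auto dest: injD)
  have o: "p x = x" if "x \<notin> {0, 1}" for x using permutes_not_in[OF p that] .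
  show "p \<in> {id, transpose 0 1}"
  proof (cases "p 0 = 0")
    case True
    then have "p x = id x" for x using v o[of x] by (cases "x \<in> {0, 1}") auto
    then show ?thesis by auto
  next
    case False
    then have "p x = transpose 0 1 x" for x
      using v o[of x] by (cases "x \<in> {0, 1}") (auto simp: transpose_def)
    then show ?thesis by auto
  qed
next
  fix p :: "nat \<Rightarrow> nat" assume "p \<in> {id, transpose 0 1}"
  then show "p \<in> {p. p permutes {..<2}}"
    by (auto simp: permutes_id intro: permutes_swap_id)
qed

text \<open>The coefficient sequence of \<open>T^2 - t T + d\<close>. Elements of
  \<open>UP R\<close> are functions on the naturals, so this sequence is itself the
  polynomial.\<close>

definition quad_poly :: "('r, 'x) ring_scheme \<Rightarrow> 'r \<Rightarrow> 'r \<Rightarrow> nat \<Rightarrow> 'r" where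
  "quad_poly R t d k = (if k = 0 then d else if k = 1 then \<ominus>\<^bsub>R\<^esub> t else if k = 2 then \<one>\<^bsub>R\<^esub> else \<zero>\<^bsub>R\<^esub>)"

context cring
begin

lemma matrix_trace_2:
  assumes "B 0 0 \<in> carrier R" "B 1 1 \<in> carrier R"
  shows "matrix_trace R 2 B = B 0 0 \<oplus> B 1 1"
  using assms by (simp add: matrix_trace_def lessThan_2)

lemma matrix_det_2:
  assumes "B 0 0 \<in> carrier R" "B 0 1 \<in> carrier R" "B 1 0 \<in> carrier R" "B 1 1 \<in> carrier R"
  shows "matrix_det R 2 B = B 0 0 \<otimes> B 1 1 \<ominus> B 0 1 \<otimes> B 1 0"
proof -
  \<comment> \<open>Distinctness of the two permutations is what gives the sum over the set exactly
    two terms.\<close>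
  have ne: "id \<noteq> transpose 0 (1::nat)" by (metis id_apply transpose_apply_first zero_neq_one)
  have "matrix_det R 2 B = B 0 0 \<otimes> B 1 1 \<oplus> \<ominus> \<one> \<otimes> (B 0 1 \<otimes> B 1 0)"
    unfolding matrix_det_def permutes_lessThan_2 using assms ne
    by (simp add: lessThan_2 evenperm_swap evenperm_id)
  then show ?thesis using assms by (simp add: a_minus_def l_minus)
qed

lemma quad_poly_closed:
  assumes "t \<in> carrier R" "d \<in> carrier R"
  shows "quad_poly R t d \<in> carrier (UP R)"
proof -
  have "bound \<zero> 2 (quad_poly R t d)" by (auto simp: quad_poly_def)
  then show ?thesis using assms by (auto simp: UP_def quad_poly_def intro!: mem_upI)
qed

lemma coeff_UP: "p \<in> carrier (UP R) \<Longrightarrow> coeff (UP R) p k = p k"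
  by (simp add: UP_def)

lemma quad_poly_eqD:
  assumes "quad_poly R t d = quad_poly R t' d'" "t \<in> carrier R" "t' \<in> carrier R"
  shows "t = t'" "d = d'"
proof -
  have "\<ominus> t = \<ominus> t'" using fun_cong[OF assms(1), of 1] by (simp add: quad_poly_def)
  then show "t = t'" using assms(2,3) by (metis minus_minus)
  show "d = d'" using fun_cong[OF assms(1), of 0] by (simp add: quad_poly_def)
qed

text \<open>Meant for the ring \<open>UP R\<close>, with \<open>x\<close> the indeterminate and the
  other elements constants.\<close>

lemma charpoly_expand_2:
  assumes "x \<in> carrier R" "a \<in> carrier R" "b \<in> carrier R" "c \<in> carrier R" "d \<in> carrier R"
  shows "(x \<ominus> a) \<otimes> (x \<ominus> d) \<ominus> (\<zero> \<ominus> b) \<otimes> (\<zero> \<ominus> c) = x \<otimes> x \<ominus> (a \<oplus> d) \<otimes> x \<oplus> (a \<otimes> d \<ominus> b \<otimes> c)"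
  using assms by algebra

lemma coeff_matrix_charpoly_2:
  assumes B: "B 0 0 \<in> carrier R" "B 0 1 \<in> carrier R" "B 1 0 \<in> carrier R" "B 1 1 \<in> carrier R"
  shows "coeff (UP R) (matrix_charpoly R 2 B) k = quad_poly R (matrix_trace R 2 B) (matrix_det R 2 B) k"
proof -
  interpret P: UP_cring R "UP R" by (rule UP_cring.intro) (rule is_cring)
  let ?m = "monom (UP R)"
  have mc: "?m (B 0 0) 0 \<in> carrier (UP R)" "?m (B 0 1) 0 \<in> carrier (UP R)" "?m (B 1 0) 0 \<in> carrier (UP R)"
    "?m (B 1 1) 0 \<in> carrier (UP R)" "?m \<one> 1 \<in> carrier (UP R)"
    using B by auto
  interpret U: cring "UP R" by (rule P.UP_cring)
  have "matrix_charpoly R 2 B = (?m \<one> 1 \<ominus>\<^bsub>UP R\<^esub> ?m (B 0 0) 0) \<otimes>\<^bsub>UP R\<^esub> (?m \<one> 1 \<ominus>\<^bsub>UP R\<^esub> ?m (B 1 1) 0)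
    \<ominus>\<^bsub>UP R\<^esub> (\<zero>\<^bsub>UP R\<^esub> \<ominus>\<^bsub>UP R\<^esub> ?m (B 0 1) 0) \<otimes>\<^bsub>UP R\<^esub> (\<zero>\<^bsub>UP R\<^esub> \<ominus>\<^bsub>UP R\<^esub> ?m (B 1 0) 0)"
    unfolding matrix_charpoly_def by (subst cring.matrix_det_2[OF P.UP_cring]) (use mc in auto)
  also have "\<dots> = ?m \<one> 1 \<otimes>\<^bsub>UP R\<^esub> ?m \<one> 1 \<ominus>\<^bsub>UP R\<^esub> (?m (B 0 0) 0 \<oplus>\<^bsub>UP R\<^esub> ?m (B 1 1) 0) \<otimes>\<^bsub>UP R\<^esub> ?m \<one> 1
    \<oplus>\<^bsub>UP R\<^esub> (?m (B 0 0) 0 \<otimes>\<^bsub>UP R\<^esub> ?m (B 1 1) 0 \<ominus>\<^bsub>UP R\<^esub> ?m (B 0 1) 0 \<otimes>\<^bsub>UP R\<^esub> ?m (B 1 0) 0)"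
    by (rule cring.charpoly_expand_2[OF P.UP_cring mc(5,1,2,3,4)])
  also have "\<dots> = ?m \<one> 2 \<ominus>\<^bsub>UP R\<^esub> ?m (B 0 0 \<oplus> B 1 1) 1
    \<oplus>\<^bsub>UP R\<^esub> ?m (B 0 0 \<otimes> B 1 1 \<ominus> B 0 1 \<otimes> B 1 0) 0"
    using B P.monom_mult[of \<one> \<one> 1 1] P.monom_mult[of "B 0 0 \<oplus> B 1 1" \<one> 0 1]
      P.monom_mult[of "B 0 0" "B 1 1" 0 0] P.monom_mult[of "B 0 1" "B 1 0" 0 0]
    by (simp add: a_minus_def P.monom_add P.monom_a_inv numeral_2_eq_2)
  finally have "coeff (UP R) (matrix_charpoly R 2 B) k =
    coeff (UP R) (?m \<one> 2 \<ominus>\<^bsub>UP R\<^esub> ?m (B 0 0 \<oplus> B 1 1) 1 \<oplus>\<^bsub>UP R\<^esub> ?m (B 0 0 \<otimes> B 1 1 \<ominus> B 0 1 \<otimes> B 1 0) 0) k"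
    by (rule arg_cong)
  also have "\<dots> = quad_poly R (B 0 0 \<oplus> B 1 1) (B 0 0 \<otimes> B 1 1 \<ominus> B 0 1 \<otimes> B 1 0) k"
    using B by (auto simp: a_minus_def[of "UP R"] quad_poly_def)
  finally show ?thesis using B by (simp add: matrix_trace_2 matrix_det_2)
qed

text \<open>
  In matrix form the hypotheses say \<open>P C = B P\<close> and \<open>P Q = Q P = 1\<close>.
\<close>

lemma similar_trace_det_2:
  assumes c: "p1 \<in> carrier R" "p2 \<in> carrier R" "p3 \<in> carrier R" "p4 \<in> carrier R"
    "q1 \<in> carrier R" "q2 \<in> carrier R" "q3 \<in> carrier R" "q4 \<in> carrier R"
    "b1 \<in> carrier R" "b2 \<in> carrier R" "b3 \<in> carrier R" "b4 \<in> carrier R"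
    "c1 \<in> carrier R" "c2 \<in> carrier R" "c3 \<in> carrier R" "c4 \<in> carrier R"
    and PC: "p1 \<otimes> c1 \<oplus> p2 \<otimes> c3 = b1 \<otimes> p1 \<oplus> b2 \<otimes> p3" "p1 \<otimes> c2 \<oplus> p2 \<otimes> c4 = b1 \<otimes> p2 \<oplus> b2 \<otimes> p4"
      "p3 \<otimes> c1 \<oplus> p4 \<otimes> c3 = b3 \<otimes> p1 \<oplus> b4 \<otimes> p3" "p3 \<otimes> c2 \<oplus> p4 \<otimes> c4 = b3 \<otimes> p2 \<oplus> b4 \<otimes> p4"
    and PQ: "p1 \<otimes> q1 \<oplus> p2 \<otimes> q3 = \<one>" "p1 \<otimes> q2 \<oplus> p2 \<otimes> q4 = \<zero>"
      "p3 \<otimes> q1 \<oplus> p4 \<otimes> q3 = \<zero>" "p3 \<otimes> q2 \<oplus> p4 \<otimes> q4 = \<one>"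
    and QP: "q1 \<otimes> p1 \<oplus> q2 \<otimes> p3 = \<one>" "q1 \<otimes> p2 \<oplus> q2 \<otimes> p4 = \<zero>"
      "q3 \<otimes> p1 \<oplus> q4 \<otimes> p3 = \<zero>" "q3 \<otimes> p2 \<oplus> q4 \<otimes> p4 = \<one>"
  shows "c1 \<oplus> c4 = b1 \<oplus> b4" and "c1 \<otimes> c4 \<ominus> c2 \<otimes> c3 = b1 \<otimes> b4 \<ominus> b2 \<otimes> b3"
proof -
  \<comment> \<open>In matrix form, the trace of \<open>C = Q P C\<close> is that of
    \<open>Q B P\<close>, and moving \<open>Q\<close> to the right end gives that of
    \<open>B P Q = B\<close>.\<close>
  have "c1 \<oplus> c4 = ((q1 \<otimes> p1 \<oplus> q2 \<otimes> p3) \<otimes> c1 \<oplus> (q1 \<otimes> p2 \<oplus> q2 \<otimes> p4) \<otimes> c3)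
      \<oplus> ((q3 \<otimes> p1 \<oplus> q4 \<otimes> p3) \<otimes> c2 \<oplus> (q3 \<otimes> p2 \<oplus> q4 \<otimes> p4) \<otimes> c4)"
    unfolding QP using c by simp
  also have "\<dots> = (q1 \<otimes> (p1 \<otimes> c1 \<oplus> p2 \<otimes> c3) \<oplus> q2 \<otimes> (p3 \<otimes> c1 \<oplus> p4 \<otimes> c3))
      \<oplus> (q3 \<otimes> (p1 \<otimes> c2 \<oplus> p2 \<otimes> c4) \<oplus> q4 \<otimes> (p3 \<otimes> c2 \<oplus> p4 \<otimes> c4))"
    using c by algebra
  also have "\<dots> = (q1 \<otimes> (b1 \<otimes> p1 \<oplus> b2 \<otimes> p3) \<oplus> q2 \<otimes> (b3 \<otimes> p1 \<oplus> b4 \<otimes> p3))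
      \<oplus> (q3 \<otimes> (b1 \<otimes> p2 \<oplus> b2 \<otimes> p4) \<oplus> q4 \<otimes> (b3 \<otimes> p2 \<oplus> b4 \<otimes> p4))"
    unfolding PC ..
  also have "\<dots> = (b1 \<otimes> (p1 \<otimes> q1 \<oplus> p2 \<otimes> q3) \<oplus> b2 \<otimes> (p3 \<otimes> q1 \<oplus> p4 \<otimes> q3))
      \<oplus> (b3 \<otimes> (p1 \<otimes> q2 \<oplus> p2 \<otimes> q4) \<oplus> b4 \<otimes> (p3 \<otimes> q2 \<oplus> p4 \<otimes> q4))"
    using c by algebra
  also have "\<dots> = b1 \<oplus> b4" unfolding PQ using c by simp
  finally show "c1 \<oplus> c4 = b1 \<oplus> b4" .
next
  \<comment> \<open>The product of the determinants of \<open>Q\<close> and \<open>P\<close>,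
    expanded as the determinant of \<open>P Q\<close>; hence the determinant of \<open>P\<close> is
    a unit.\<close>
  have u: "(q1 \<otimes> q4 \<ominus> q2 \<otimes> q3) \<otimes> (p1 \<otimes> p4 \<ominus> p2 \<otimes> p3) = \<one>"
  proof -
    have "(q1 \<otimes> q4 \<ominus> q2 \<otimes> q3) \<otimes> (p1 \<otimes> p4 \<ominus> p2 \<otimes> p3) =
      (p1 \<otimes> q1 \<oplus> p2 \<otimes> q3) \<otimes> (p3 \<otimes> q2 \<oplus> p4 \<otimes> q4) \<ominus> (p1 \<otimes> q2 \<oplus> p2 \<otimes> q4) \<otimes> (p3 \<otimes> q1 \<oplus> p4 \<otimes> q3)"
      using c by algebra
    then show ?thesis unfolding PQ by (simp add: a_minus_def)
  qed
  \<comment> \<open>Multiplicativity of the determinant on both sides of \<open>P C = B P\<close>.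
    The common factor is cancelled by means of \<open>u\<close>.\<close>
  have d: "(p1 \<otimes> p4 \<ominus> p2 \<otimes> p3) \<otimes> (c1 \<otimes> c4 \<ominus> c2 \<otimes> c3) = (p1 \<otimes> p4 \<ominus> p2 \<otimes> p3) \<otimes> (b1 \<otimes> b4 \<ominus> b2 \<otimes> b3)"
  proof -
    have "(p1 \<otimes> p4 \<ominus> p2 \<otimes> p3) \<otimes> (c1 \<otimes> c4 \<ominus> c2 \<otimes> c3) =
      (p1 \<otimes> c1 \<oplus> p2 \<otimes> c3) \<otimes> (p3 \<otimes> c2 \<oplus> p4 \<otimes> c4) \<ominus> (p1 \<otimes> c2 \<oplus> p2 \<otimes> c4) \<otimes> (p3 \<otimes> c1 \<oplus> p4 \<otimes> c3)"
      using c by algebra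
    also have "\<dots> = (b1 \<otimes> p1 \<oplus> b2 \<otimes> p3) \<otimes> (b3 \<otimes> p2 \<oplus> b4 \<otimes> p4) \<ominus> (b1 \<otimes> p2 \<oplus> b2 \<otimes> p4) \<otimes> (b3 \<otimes> p1 \<oplus> b4 \<otimes> p3)"
      unfolding PC ..
    also have "\<dots> = (p1 \<otimes> p4 \<ominus> p2 \<otimes> p3) \<otimes> (b1 \<otimes> b4 \<ominus> b2 \<otimes> b3)"
      using c by algebra
    finally show ?thesis .
  qed
  have cc: "q1 \<otimes> q4 \<ominus> q2 \<otimes> q3 \<in> carrier R" "p1 \<otimes> p4 \<ominus> p2 \<otimes> p3 \<in> carrier R"
    "c1 \<otimes> c4 \<ominus> c2 \<otimes> c3 \<in> carrier R" "b1 \<otimes> b4 \<ominus> b2 \<otimes> b3 \<in> carrier R"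
    using c by auto
  have "(q1 \<otimes> q4 \<ominus> q2 \<otimes> q3) \<otimes> ((p1 \<otimes> p4 \<ominus> p2 \<otimes> p3) \<otimes> (c1 \<otimes> c4 \<ominus> c2 \<otimes> c3)) =
    (q1 \<otimes> q4 \<ominus> q2 \<otimes> q3) \<otimes> ((p1 \<otimes> p4 \<ominus> p2 \<otimes> p3) \<otimes> (b1 \<otimes> b4 \<ominus> b2 \<otimes> b3))"
    unfolding d ..
  then show "c1 \<otimes> c4 \<ominus> c2 \<otimes> c3 = b1 \<otimes> b4 \<ominus> b2 \<otimes> b3"
    using m_assoc[OF cc(1,2,3)] m_assoc[OF cc(1,2,4)] u cc(3,4) by simp
qed

end

section \<open>Endomorphisms of free modules of rank two\<close>

locale module_basis = Module.module R M
  for R :: "('r, 'x) ring_scheme" (structure) and M :: "('r, 'm) module" (structure) +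
  fixes n :: nat and e :: "nat \<Rightarrow> 'm"
  assumes e_closed: "i < n \<Longrightarrow> e i \<in> carrier M"
    and coords_ex1: "m \<in> carrier M \<Longrightarrow>
      \<exists>!c. c \<in> {..<n} \<rightarrow>\<^sub>E carrier R \<and> m = (\<Oplus>\<^bsub>M\<^esub>i \<in> {..<n}. c i \<odot>\<^bsub>M\<^esub> e i)"
begin

abbreviation "coords \<equiv> basis_coords R M n e"

lemma coords_spec:
  assumes "m \<in> carrier M"
  shows "coords m \<in> {..<n} \<rightarrow>\<^sub>E carrier R \<and> m = (\<Oplus>\<^bsub>M\<^esub>i \<in> {..<n}. coords m i \<odot>\<^bsub>M\<^esub> e i)"
  unfolding basis_coords_def by (rule theI'[OF coords_ex1[OF assms]])

lemma coords_closed: "m \<in> carrier M \<Longrightarrow> i < n \<Longrightarrow> coords m i \<in> carrier R"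
  using coords_spec by (auto dest: PiE_mem)

lemma coords_sum: "m \<in> carrier M \<Longrightarrow> (\<Oplus>\<^bsub>M\<^esub>i \<in> {..<n}. coords m i \<odot>\<^bsub>M\<^esub> e i) = m"
  using coords_spec[of m] by simp

lemma coords_eqI:
  assumes c: "\<And>i. i < n \<Longrightarrow> c i \<in> carrier R" and m: "m = (\<Oplus>\<^bsub>M\<^esub>i \<in> {..<n}. c i \<odot>\<^bsub>M\<^esub> e i)" and i: "i < n"
  shows "coords m i = c i"
proof -
  have mc: "m \<in> carrier M" unfolding m using c e_closed by (intro M.finsum_closed) auto
  have "m = (\<Oplus>\<^bsub>M\<^esub>i \<in> {..<n}. restrict c {..<n} i \<odot>\<^bsub>M\<^esub> e i)"
    unfolding m using c e_closed by (intro M.finsum_cong') auto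
  then have r: "restrict c {..<n} \<in> {..<n} \<rightarrow>\<^sub>E carrier R \<and> m = (\<Oplus>\<^bsub>M\<^esub>i \<in> {..<n}. restrict c {..<n} i \<odot>\<^bsub>M\<^esub> e i)"
    using c by auto
  have "coords m = restrict c {..<n}"
    by (rule ex1_unique[OF coords_ex1[OF mc]]) (rule coords_spec[OF mc] r)+
  then show ?thesis using i by simp
qed

lemma coords_add:
  assumes "x \<in> carrier M" "y \<in> carrier M" "i < n"
  shows "coords (x \<oplus>\<^bsub>M\<^esub> y) i = coords x i \<oplus> coords y i"
proof (rule coords_eqI[OF _ _ assms(3)])
  have "x \<oplus>\<^bsub>M\<^esub> y = (\<Oplus>\<^bsub>M\<^esub>i \<in> {..<n}. coords x i \<odot>\<^bsub>M\<^esub> e i) \<oplus>\<^bsub>M\<^esub> (\<Oplus>\<^bsub>M\<^esub>i \<in> {..<n}. coords y i \<odot>\<^bsub>M\<^esub> e i)"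
    using assms coords_sum by simp
  also have "\<dots> = (\<Oplus>\<^bsub>M\<^esub>i \<in> {..<n}. (coords x i \<odot>\<^bsub>M\<^esub> e i) \<oplus>\<^bsub>M\<^esub> (coords y i \<odot>\<^bsub>M\<^esub> e i))"
    using assms coords_closed e_closed by (intro M.finsum_addf[symmetric]) auto
  also have "\<dots> = (\<Oplus>\<^bsub>M\<^esub>i \<in> {..<n}. (coords x i \<oplus> coords y i) \<odot>\<^bsub>M\<^esub> e i)"
    using assms coords_closed e_closed by (intro M.finsum_cong') (auto simp: smult_l_distr)
  finally show "x \<oplus>\<^bsub>M\<^esub> y = (\<Oplus>\<^bsub>M\<^esub>i \<in> {..<n}. (coords x i \<oplus> coords y i) \<odot>\<^bsub>M\<^esub> e i)" .
qed (use assms coords_closed in auto)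

lemma coords_smult:
  assumes "r \<in> carrier R" "x \<in> carrier M" "i < n"
  shows "coords (r \<odot>\<^bsub>M\<^esub> x) i = r \<otimes> coords x i"
proof (rule coords_eqI[OF _ _ assms(3)])
  have "r \<odot>\<^bsub>M\<^esub> x = r \<odot>\<^bsub>M\<^esub> (\<Oplus>\<^bsub>M\<^esub>i \<in> {..<n}. coords x i \<odot>\<^bsub>M\<^esub> e i)"
    using assms coords_sum by simp
  also have "\<dots> = (\<Oplus>\<^bsub>M\<^esub>i \<in> {..<n}. r \<odot>\<^bsub>M\<^esub> (coords x i \<odot>\<^bsub>M\<^esub> e i))"
    using assms coords_closed e_closed by (intro finsum_smult_ldistr) auto
  also have "\<dots> = (\<Oplus>\<^bsub>M\<^esub>i \<in> {..<n}. (r \<otimes> coords x i) \<odot>\<^bsub>M\<^esub> e i)"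
    using assms coords_closed e_closed by (intro M.finsum_cong') (auto simp: smult_assoc1)
  finally show "r \<odot>\<^bsub>M\<^esub> x = (\<Oplus>\<^bsub>M\<^esub>i \<in> {..<n}. (r \<otimes> coords x i) \<odot>\<^bsub>M\<^esub> e i)" .
qed (use assms coords_closed in auto)

lemma coords_inject:
  assumes "x \<in> carrier M" "y \<in> carrier M" "\<And>i. i < n \<Longrightarrow> coords x i = coords y i"
  shows "x = y"
proof -
  have "(\<Oplus>\<^bsub>M\<^esub>i \<in> {..<n}. coords x i \<odot>\<^bsub>M\<^esub> e i) = (\<Oplus>\<^bsub>M\<^esub>i \<in> {..<n}. coords y i \<odot>\<^bsub>M\<^esub> e i)"
    using assms coords_closed e_closed by (intro M.finsum_cong') auto
  then show ?thesis using coords_sum assms by simp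
qed

lemma coords_basis:
  assumes "i < n" "j < n" shows "coords (e j) i = (if i = j then \<one> else \<zero>)"
proof (rule coords_eqI[OF _ _ assms(1)])
  have "(\<Oplus>\<^bsub>M\<^esub>i \<in> {..<n}. (if i = j then \<one> else \<zero>) \<odot>\<^bsub>M\<^esub> e i) = (\<Oplus>\<^bsub>M\<^esub>i \<in> {..<n}. if i = j then e i else \<zero>\<^bsub>M\<^esub>)"
    using e_closed by (intro M.finsum_cong') auto
  also have "\<dots> = e j"
    using assms e_closed M.finsum_singleton[of j "{..<n}" e] by (simp add: eq_commute[of _ j])
  finally show "e j = (\<Oplus>\<^bsub>M\<^esub>i \<in> {..<n}. (if i = j then \<one> else \<zero>) \<odot>\<^bsub>M\<^esub> e i)" ..
qed auto

end

locale rank_two_basis = module_basis R M 2 e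
  for R :: "('r, 'x) ring_scheme" (structure) and M :: "('r, 'm) module" (structure) and e
begin

lemma e01: "e 0 \<in> carrier M" "e 1 \<in> carrier M" using e_closed by auto

lemma expand: "x \<in> carrier M \<Longrightarrow> x = coords x 0 \<odot>\<^bsub>M\<^esub> e 0 \<oplus>\<^bsub>M\<^esub> coords x 1 \<odot>\<^bsub>M\<^esub> e 1"
  using coords_sum[of x] coords_closed[of x] e01 by (simp add: lessThan_2)

lemma expand_ex: "x \<in> carrier M \<Longrightarrow> \<exists>a \<in> carrier R. \<exists>b \<in> carrier R. x = a \<odot>\<^bsub>M\<^esub> e 0 \<oplus>\<^bsub>M\<^esub> b \<odot>\<^bsub>M\<^esub> e 1"
  using expand coords_closed by (metis one_less_numeral_iff pos2 semiring_norm(76))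

text \<open>A basis vector has zero annihilator. This is how freeness enters when two determinants
  acting equally are to be identified.\<close>

lemma smult_e0_cancel:
  assumes "a \<in> carrier R" "b \<in> carrier R" "a \<odot>\<^bsub>M\<^esub> e 0 = b \<odot>\<^bsub>M\<^esub> e 0"
  shows "a = b"
proof -
  have "coords (a \<odot>\<^bsub>M\<^esub> e 0) 0 = coords (b \<odot>\<^bsub>M\<^esub> e 0) 0" unfolding assms(3) ..
  then show ?thesis using assms(1,2) e01 by (simp add: coords_smult coords_basis)
qed

abbreviation "tr \<phi> \<equiv> matrix_trace R 2 (endo_matrix R M 2 e \<phi>)"
abbreviation "dt \<phi> \<equiv> matrix_det R 2 (endo_matrix R M 2 e \<phi>)"

lemma endo_matrix_closed:
  assumes "\<phi> \<in> carrier M \<rightarrow> carrier M" "i < 2" "j < 2"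
  shows "endo_matrix R M 2 e \<phi> i j \<in> carrier R"
  unfolding endo_matrix_def using assms e_closed by (intro coords_closed) auto

lemma trace_eq:
  assumes "\<phi> \<in> carrier M \<rightarrow> carrier M"
  shows "tr \<phi> = coords (\<phi> (e 0)) 0 \<oplus> coords (\<phi> (e 1)) 1"
  using endo_matrix_closed[OF assms] by (subst matrix_trace_2) (auto simp: endo_matrix_def)

lemma det_eq:
  assumes "\<phi> \<in> carrier M \<rightarrow> carrier M"
  shows "dt \<phi> = coords (\<phi> (e 0)) 0 \<otimes> coords (\<phi> (e 1)) 1 \<ominus> coords (\<phi> (e 1)) 0 \<otimes> coords (\<phi> (e 0)) 1"
  using endo_matrix_closed[OF assms] by (subst matrix_det_2) (auto simp: endo_matrix_def)

lemma trace_closed: "\<phi> \<in> carrier M \<rightarrow> carrier M \<Longrightarrow> tr \<phi> \<in> carrier R"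
  using e01 by (subst trace_eq) (auto intro!: coords_closed)

lemma det_closed: "\<phi> \<in> carrier M \<rightarrow> carrier M \<Longrightarrow> dt \<phi> \<in> carrier R"
  using e01 by (subst det_eq) (auto intro!: coords_closed minus_closed m_closed)

text \<open>\<open>\<chi>\<close> is a separate map tied to the other two only on the carrier, since
  multiplication by a sum of algebra elements is a sum of multiplications only there.\<close>

lemma trace_add:
  assumes "\<phi> \<in> carrier M \<rightarrow> carrier M" "\<psi> \<in> carrier M \<rightarrow> carrier M" "\<chi> \<in> carrier M \<rightarrow> carrier M"
    "\<And>m. m \<in> carrier M \<Longrightarrow> \<chi> m = \<phi> m \<oplus>\<^bsub>M\<^esub> \<psi> m"
  shows "tr \<chi> = tr \<phi> \<oplus> tr \<psi>"
proof -
  have c: "\<phi> (e 0) \<in> carrier M" "\<phi> (e 1) \<in> carrier M" "\<psi> (e 0) \<in> carrier M" "\<psi> (e 1) \<in> carrier M"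
    using assms(1,2) e01 by auto
  have d: "coords (\<phi> (e 0)) 0 \<in> carrier R" "coords (\<phi> (e 1)) 1 \<in> carrier R"
    "coords (\<psi> (e 0)) 0 \<in> carrier R" "coords (\<psi> (e 1)) 1 \<in> carrier R"
    using c by (auto intro: coords_closed)
  show ?thesis unfolding trace_eq[OF assms(1)] trace_eq[OF assms(2)] trace_eq[OF assms(3)]
    using c d e01 by (simp add: assms(4) coords_add R.add.m_ac)
qed

lemma trace_smult:
  assumes "r \<in> carrier R" "\<phi> \<in> carrier M \<rightarrow> carrier M" "\<chi> \<in> carrier M \<rightarrow> carrier M"
    "\<And>m. m \<in> carrier M \<Longrightarrow> \<chi> m = r \<odot>\<^bsub>M\<^esub> \<phi> m"
  shows "tr \<chi> = r \<otimes> tr \<phi>"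
proof -
  have c: "\<phi> (e 0) \<in> carrier M" "\<phi> (e 1) \<in> carrier M" using assms(2) e01 by auto
  have d: "coords (\<phi> (e 0)) 0 \<in> carrier R" "coords (\<phi> (e 1)) 1 \<in> carrier R"
    using c by (auto intro: coords_closed)
  show ?thesis unfolding trace_eq[OF assms(2)] trace_eq[OF assms(3)]
    using c d e01 assms(1) by (simp add: assms(4) coords_smult R.r_distr)
qed

end

section \<open>Change of basis and the Cayley-Hamilton identity\<close>

definition linear_endo :: "('r, 'x) ring_scheme \<Rightarrow> ('r, 'm) module \<Rightarrow> ('m \<Rightarrow> 'm) \<Rightarrow> bool" where
  "linear_endo R M \<phi> \<longleftrightarrow> \<phi> \<in> carrier M \<rightarrow> carrier M \<and>
    (\<forall>x \<in> carrier M. \<forall>y \<in> carrier M. \<phi> (x \<oplus>\<^bsub>M\<^esub> y) = \<phi> x \<oplus>\<^bsub>M\<^esub> \<phi> y) \<and>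
    (\<forall>r \<in> carrier R. \<forall>x \<in> carrier M. \<phi> (r \<odot>\<^bsub>M\<^esub> x) = r \<odot>\<^bsub>M\<^esub> \<phi> x)"

context rank_two_basis
begin

lemma coords_linear_endo:
  assumes \<phi>: "linear_endo R M \<phi>" and x: "x \<in> carrier M" and i: "i < 2"
  shows "coords (\<phi> x) i = coords (\<phi> (e 0)) i \<otimes> coords x 0 \<oplus> coords (\<phi> (e 1)) i \<otimes> coords x 1"
proof -
  have fc: "\<phi> y \<in> carrier M" if "y \<in> carrier M" for y using \<phi> that unfolding linear_endo_def by auto
  have xc: "coords x 0 \<in> carrier R" "coords x 1 \<in> carrier R" using x by (auto intro: coords_closed)
  have "\<phi> x = \<phi> (coords x 0 \<odot>\<^bsub>M\<^esub> e 0 \<oplus>\<^bsub>M\<^esub> coords x 1 \<odot>\<^bsub>M\<^esub> e 1)" using expand[OF x] by simp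
  also have "\<dots> = coords x 0 \<odot>\<^bsub>M\<^esub> \<phi> (e 0) \<oplus>\<^bsub>M\<^esub> coords x 1 \<odot>\<^bsub>M\<^esub> \<phi> (e 1)"
    using \<phi> xc e01 by (simp add: linear_endo_def)
  finally show ?thesis
    using xc fc[OF e01(1)] fc[OF e01(2)] i by (simp add: coords_add coords_smult coords_closed R.m_comm)
qed

lemma coords_change:
  assumes b: "rank_two_basis R M f" and x: "x \<in> carrier M" and i: "i < 2"
  shows "coords x i = coords (f 0) i \<otimes> basis_coords R M 2 f x 0 \<oplus> coords (f 1) i \<otimes> basis_coords R M 2 f x 1"
proof -
  interpret f: rank_two_basis R M f by (rule b)
  have xc: "f.coords x 0 \<in> carrier R" "f.coords x 1 \<in> carrier R" using x by (auto intro: f.coords_closed)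
  have "coords x i = coords (f.coords x 0 \<odot>\<^bsub>M\<^esub> f 0 \<oplus>\<^bsub>M\<^esub> f.coords x 1 \<odot>\<^bsub>M\<^esub> f 1) i"
    using f.expand[OF x] by simp
  then show ?thesis
    using xc f.e01 i by (simp add: coords_add coords_smult coords_closed R.m_comm)
qed

text \<open>The matrix \<open>P\<close> has as columns the coordinates of the new basis in the old
  one, \<open>Q\<close> those of the old basis in the new one; the matrices of \<open>\<phi>\<close>
  in the two bases are conjugate through them.\<close>

lemma trace_det_basis_independent:
  assumes b: "rank_two_basis R M f" and \<phi>: "linear_endo R M \<phi>"
  shows "matrix_trace R 2 (endo_matrix R M 2 f \<phi>) = tr \<phi>"
    and "matrix_det R 2 (endo_matrix R M 2 f \<phi>) = dt \<phi>"
proof -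
  interpret f: rank_two_basis R M f by (rule b)
  have pi: "\<phi> \<in> carrier M \<rightarrow> carrier M" using \<phi> unfolding linear_endo_def by simp
  have fc: "\<phi> (f 0) \<in> carrier M" "\<phi> (f 1) \<in> carrier M" "\<phi> (e 0) \<in> carrier M" "\<phi> (e 1) \<in> carrier M"
    using pi e01 f.e01 by auto
  have eb: "rank_two_basis R M e" by (rule rank_two_basis_axioms)
  \<comment> \<open>Both sides are the \<open>i\<close>-th old coordinate of
    \<open>\<phi> (f j)\<close>: once by changing basis after applying \<open>\<phi>\<close>, once
    by applying the old matrix to the coordinates of \<open>f j\<close>.\<close>
  have comm: "coords (f 0) i \<otimes> f.coords (\<phi> (f j)) 0 \<oplus> coords (f 1) i \<otimes> f.coords (\<phi> (f j)) 1 =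
      coords (\<phi> (e 0)) i \<otimes> coords (f j) 0 \<oplus> coords (\<phi> (e 1)) i \<otimes> coords (f j) 1"
    if "i < 2" "j < 2" for i j
    using coords_change[OF b _ that(1), of "\<phi> (f j)"] coords_linear_endo[OF \<phi> f.e_closed[OF that(2)] that(1)]
      funcset_mem[OF pi f.e_closed[OF that(2)]] by simp
  \<comment> \<open>Changing the basis forth and back fixes the coordinates of a basis vector;
    \<open>inv1\<close> and \<open>inv2\<close> are the entries of \<open>P Q = 1\<close> and
    \<open>Q P = 1\<close>.\<close>
  have inv1: "coords (f 0) i \<otimes> f.coords (e j) 0 \<oplus> coords (f 1) i \<otimes> f.coords (e j) 1 = (if i = j then \<one> else \<zero>)"
    if "i < 2" "j < 2" for i j
    using coords_change[OF b e_closed[OF that(2)] that(1)] coords_basis[OF that] by simp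
  have inv2: "f.coords (e 0) i \<otimes> coords (f j) 0 \<oplus> f.coords (e 1) i \<otimes> coords (f j) 1 = (if i = j then \<one> else \<zero>)"
    if "i < 2" "j < 2" for i j
    using f.coords_change[OF eb f.e_closed[OF that(2)] that(1)] f.coords_basis[OF that] by simp
  have cl: "coords (f j) i \<in> carrier R" "f.coords (e j) i \<in> carrier R" "coords (\<phi> (e j)) i \<in> carrier R"
    "f.coords (\<phi> (f j)) i \<in> carrier R" if "i < 2" "j < 2" for i j
    using that pi e_closed[OF that(2)] f.e_closed[OF that(2)] by (auto intro: coords_closed f.coords_closed)
  have lt: "0 < (2::nat)" "1 < (2::nat)" by auto
  note S = R.similar_trace_det_2[OF cl(1)[OF lt(1,1)] cl(1)[OF lt(1,2)] cl(1)[OF lt(2,1)] cl(1)[OF lt(2,2)]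
      cl(2)[OF lt(1,1)] cl(2)[OF lt(1,2)] cl(2)[OF lt(2,1)] cl(2)[OF lt(2,2)]
      cl(3)[OF lt(1,1)] cl(3)[OF lt(1,2)] cl(3)[OF lt(2,1)] cl(3)[OF lt(2,2)]
      cl(4)[OF lt(1,1)] cl(4)[OF lt(1,2)] cl(4)[OF lt(2,1)] cl(4)[OF lt(2,2)]
      comm[OF lt(1,1)] comm[OF lt(1,2)] comm[OF lt(2,1)] comm[OF lt(2,2)]]
  show "matrix_trace R 2 (endo_matrix R M 2 f \<phi>) = tr \<phi>"
    unfolding trace_eq[OF pi] f.trace_eq[OF pi]
    by (rule S(1)) (use inv1[OF lt(1,1)] inv1[OF lt(1,2)] inv1[OF lt(2,1)] inv1[OF lt(2,2)]
        inv2[OF lt(1,1)] inv2[OF lt(1,2)] inv2[OF lt(2,1)] inv2[OF lt(2,2)] in simp_all)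
  show "matrix_det R 2 (endo_matrix R M 2 f \<phi>) = dt \<phi>"
    unfolding det_eq[OF pi] f.det_eq[OF pi]
    by (rule S(2)) (use inv1[OF lt(1,1)] inv1[OF lt(1,2)] inv1[OF lt(2,1)] inv1[OF lt(2,2)]
        inv2[OF lt(1,1)] inv2[OF lt(1,2)] inv2[OF lt(2,1)] inv2[OF lt(2,2)] in simp_all)
qed

text \<open>In rank two each of the two coordinates of the claim is a polynomial identity in the
  matrix entries and the coordinates of \<open>x\<close>.\<close>

lemma cayley_hamilton_2:
  assumes \<phi>: "linear_endo R M \<phi>" and x: "x \<in> carrier M"
  shows "\<phi> (\<phi> x) = tr \<phi> \<odot>\<^bsub>M\<^esub> \<phi> x \<ominus>\<^bsub>M\<^esub> dt \<phi> \<odot>\<^bsub>M\<^esub> x"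
proof -
  have pi: "\<phi> \<in> carrier M \<rightarrow> carrier M" using \<phi> unfolding linear_endo_def by simp
  have fc: "\<phi> y \<in> carrier M" if "y \<in> carrier M" for y using pi that by auto
  define a b c d x0 x1 where p: "a = coords (\<phi> (e 0)) 0" "b = coords (\<phi> (e 1)) 0" "c = coords (\<phi> (e 0)) 1"
    "d = coords (\<phi> (e 1)) 1" "x0 = coords x 0" "x1 = coords x 1"
  have pc: "a \<in> carrier R" "b \<in> carrier R" "c \<in> carrier R" "d \<in> carrier R" "x0 \<in> carrier R" "x1 \<in> carrier R"
    using coords_closed[OF x] coords_closed[OF fc[OF e01(1)]] coords_closed[OF fc[OF e01(2)]]
    by (simp_all add: p)
  have t: "tr \<phi> = a \<oplus> d" "dt \<phi> = a \<otimes> d \<ominus> b \<otimes> c" by (simp_all add: trace_eq[OF pi] det_eq[OF pi] p)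
  have f0: "coords (\<phi> x) 0 = a \<otimes> x0 \<oplus> b \<otimes> x1" "coords (\<phi> x) 1 = c \<otimes> x0 \<oplus> d \<otimes> x1"
    using coords_linear_endo[OF \<phi> x] by (simp_all add: p)
  have f1: "coords (\<phi> (\<phi> x)) 0 = a \<otimes> (a \<otimes> x0 \<oplus> b \<otimes> x1) \<oplus> b \<otimes> (c \<otimes> x0 \<oplus> d \<otimes> x1)"
    "coords (\<phi> (\<phi> x)) 1 = c \<otimes> (a \<otimes> x0 \<oplus> b \<otimes> x1) \<oplus> d \<otimes> (c \<otimes> x0 \<oplus> d \<otimes> x1)"
  proof -
    have "coords (\<phi> (\<phi> x)) 0 = a \<otimes> coords (\<phi> x) 0 \<oplus> b \<otimes> coords (\<phi> x) 1"
      "coords (\<phi> (\<phi> x)) 1 = c \<otimes> coords (\<phi> x) 0 \<oplus> d \<otimes> coords (\<phi> x) 1"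
      using coords_linear_endo[OF \<phi> fc[OF x]] by (simp_all add: p(1-4))
    then show "coords (\<phi> (\<phi> x)) 0 = a \<otimes> (a \<otimes> x0 \<oplus> b \<otimes> x1) \<oplus> b \<otimes> (c \<otimes> x0 \<oplus> d \<otimes> x1)"
      "coords (\<phi> (\<phi> x)) 1 = c \<otimes> (a \<otimes> x0 \<oplus> b \<otimes> x1) \<oplus> d \<otimes> (c \<otimes> x0 \<oplus> d \<otimes> x1)"
      unfolding f0 by simp_all
  qed
  have tc: "a \<oplus> d \<in> carrier R" "\<ominus> (a \<otimes> d \<ominus> b \<otimes> c) \<in> carrier R" "a \<otimes> d \<ominus> b \<otimes> c \<in> carrier R" using pc by auto
  \<comment> \<open>The difference is rewritten as a sum with a negated scalar, so that coordinates
    can be taken termwise.\<close>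
  have rhs: "tr \<phi> \<odot>\<^bsub>M\<^esub> \<phi> x \<ominus>\<^bsub>M\<^esub> dt \<phi> \<odot>\<^bsub>M\<^esub> x = (a \<oplus> d) \<odot>\<^bsub>M\<^esub> \<phi> x \<oplus>\<^bsub>M\<^esub> (\<ominus> (a \<otimes> d \<ominus> b \<otimes> c)) \<odot>\<^bsub>M\<^esub> x"
    unfolding t a_minus_def[of M] using smult_l_minus[OF tc(3) x] by simp
  have g: "coords ((a \<oplus> d) \<odot>\<^bsub>M\<^esub> \<phi> x \<oplus>\<^bsub>M\<^esub> (\<ominus> (a \<otimes> d \<ominus> b \<otimes> c)) \<odot>\<^bsub>M\<^esub> x) i =
      (a \<oplus> d) \<otimes> coords (\<phi> x) i \<oplus> (\<ominus> (a \<otimes> d \<ominus> b \<otimes> c)) \<otimes> coords x i" if "i < 2" for i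
    using tc fc[OF x] x that by (simp add: coords_add coords_smult)
  have i0: "a \<otimes> (a \<otimes> x0 \<oplus> b \<otimes> x1) \<oplus> b \<otimes> (c \<otimes> x0 \<oplus> d \<otimes> x1) =
      (a \<oplus> d) \<otimes> (a \<otimes> x0 \<oplus> b \<otimes> x1) \<oplus> (\<ominus> (a \<otimes> d \<ominus> b \<otimes> c)) \<otimes> x0"
    and i1: "c \<otimes> (a \<otimes> x0 \<oplus> b \<otimes> x1) \<oplus> d \<otimes> (c \<otimes> x0 \<oplus> d \<otimes> x1) =
      (a \<oplus> d) \<otimes> (c \<otimes> x0 \<oplus> d \<otimes> x1) \<oplus> (\<ominus> (a \<otimes> d \<ominus> b \<otimes> c)) \<otimes> x1"
    using pc by algebra+
  show ?thesis unfolding rhs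
  proof (rule coords_inject)
    show "\<phi> (\<phi> x) \<in> carrier M" "(a \<oplus> d) \<odot>\<^bsub>M\<^esub> \<phi> x \<oplus>\<^bsub>M\<^esub> (\<ominus> (a \<otimes> d \<ominus> b \<otimes> c)) \<odot>\<^bsub>M\<^esub> x \<in> carrier M"
      using x fc tc by auto
    have lt: "0 < (2::nat)" "1 < (2::nat)" by auto
    fix i :: nat assume "i < 2"
    then have "i = 0 \<or> i = 1" by auto
    then show "coords (\<phi> (\<phi> x)) i = coords ((a \<oplus> d) \<odot>\<^bsub>M\<^esub> \<phi> x \<oplus>\<^bsub>M\<^esub> (\<ominus> (a \<otimes> d \<ominus> b \<otimes> c)) \<odot>\<^bsub>M\<^esub> x) i"
    proof (elim disjE)
      show ?thesis if "i = 0"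
        unfolding that f1(1) i0 g[OF lt(1)] f0(1) p(5)[symmetric] ..
      show ?thesis if "i = 1"
        unfolding that f1(2) i1 g[OF lt(2)] f0(2) p(6)[symmetric] ..
    qed
  qed
qed

end

section \<open>Traces and characteristic polynomials of sheaf endomorphisms\<close>

context module_sheaf
begin

abbreviation "basis_trace V e \<phi> \<equiv> matrix_trace (sec OX V) 2 (endo_matrix (sec OX V) (sec M V) 2 e (\<phi> V))"
abbreviation "basis_det V e \<phi> \<equiv> matrix_det (sec OX V) 2 (endo_matrix (sec OX V) (sec M V) 2 e (\<phi> V))"

text \<open>\<open>endo_trace\<close> and \<open>endo_charpoly\<close> accept any family of maps;
  this singles out the families that are morphisms of sheaves of modules, for which the matrices in
  different bases are compatible.\<close>

definition sheaf_endo :: "'p set \<Rightarrow> ('p set \<Rightarrow> 'm \<Rightarrow> 'm) \<Rightarrow> bool" where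
  "sheaf_endo U \<phi> \<longleftrightarrow>
    (\<forall>V. openin X V \<and> V \<subseteq> U \<longrightarrow> linear_endo (sec OX V) (sec M V) (\<phi> V)) \<and>
    (\<forall>V W m. openin X V \<and> openin X W \<and> W \<subseteq> V \<and> V \<subseteq> U \<and> m \<in> carrier (sec M V) \<longrightarrow>
      res M V W (\<phi> V m) = \<phi> W (res M V W m))"

lemma sheaf_endo_linear:
  "\<lbrakk>sheaf_endo U \<phi>; openin X V; V \<subseteq> U\<rbrakk> \<Longrightarrow> linear_endo (sec OX V) (sec M V) (\<phi> V)"
  unfolding sheaf_endo_def by simp

lemma sheaf_endo_closed:
  "\<lbrakk>sheaf_endo U \<phi>; openin X V; V \<subseteq> U\<rbrakk> \<Longrightarrow> \<phi> V \<in> carrier (sec M V) \<rightarrow> carrier (sec M V)"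
  by (rule sheaf_endo_linear[unfolded linear_endo_def, THEN conjunct1])

lemma sheaf_endo_res:
  "\<lbrakk>sheaf_endo U \<phi>; openin X V; openin X W; W \<subseteq> V; V \<subseteq> U; m \<in> carrier (sec M V)\<rbrakk> \<Longrightarrow>
    res M V W (\<phi> V m) = \<phi> W (res M V W m)"
  unfolding sheaf_endo_def by simp

lemma free_basis_module_basis:
  assumes "free_basis X OX M n V e" shows "module_basis (sec OX V) (sec M V) n e"
  by (intro module_basis.intro module_basis_axioms.intro M_module[OF free_basis_open[OF assms]]
      free_basis_closed[OF assms] free_basis_coords[OF assms])

lemma free_basis_rank_two:
  assumes "free_basis X OX M 2 V e" shows "rank_two_basis (sec OX V) (sec M V) e"
  by (rule rank_two_basis.intro[OF free_basis_module_basis[OF assms]])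

text \<open>Restricting the expansion of \<open>m\<close> gives an expansion of its restriction in
  the restricted basis, and coordinates are unique.\<close>

lemma coords_res:
  assumes b: "free_basis X OX M n V e" and W: "openin X W" "W \<subseteq> V"
    and m: "m \<in> carrier (sec M V)" and i: "i < n"
  shows "basis_coords (sec OX W) (sec M W) n (\<lambda>i. res M V W (e i)) (res M V W m) i =
    res OX V W (basis_coords (sec OX V) (sec M V) n e m i)"
proof -
  note V = free_basis_open[OF b]
  interpret V: module_basis "sec OX V" "sec M V" n e by (rule free_basis_module_basis[OF b])
  interpret W: module_basis "sec OX W" "sec M W" n "\<lambda>i. res M V W (e i)"
    by (rule free_basis_module_basis[OF free_basis_restrict[OF b W]])
  show ?thesis
  proof (rule W.coords_eqI[OF _ _ i])
    show "res OX V W (V.coords m i) \<in> carrier (sec OX W)" if "i < n" for i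
      by (rule OX_res_closed[OF V W V.coords_closed[OF m that]])
    have "res M V W m = res M V W (\<Oplus>\<^bsub>sec M V\<^esub>i\<in>{..<n}. V.coords m i \<odot>\<^bsub>sec M V\<^esub> e i)"
      by (simp only: V.coords_sum[OF m])
    also have "\<dots> = (\<Oplus>\<^bsub>sec M W\<^esub>i\<in>{..<n}. res M V W (V.coords m i \<odot>\<^bsub>sec M V\<^esub> e i))"
      using V.coords_closed[OF m] V.e_closed by (intro res_finsum[OF V W]) auto
    also have "\<dots> = (\<Oplus>\<^bsub>sec M W\<^esub>i\<in>{..<n}. res OX V W (V.coords m i) \<odot>\<^bsub>sec M W\<^esub> res M V W (e i))"
      using V.coords_closed[OF m] V.e_closed W.e_closed OX_res_closed[OF V W]
      by (intro W.M.finsum_cong') (auto simp: res_smult[OF V W])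
    finally show "res M V W m = (\<Oplus>\<^bsub>sec M W\<^esub>i\<in>{..<n}. res OX V W (V.coords m i) \<odot>\<^bsub>sec M W\<^esub> res M V W (e i))" .
  qed
qed

text \<open>The matrix entries restrict to matrix entries, because \<open>\<phi>\<close> commutes
  with restriction; trace and determinant are polynomials in them.\<close>

lemma trace_det_res:
  assumes \<phi>: "sheaf_endo U \<phi>" and VU: "V \<subseteq> U" and b: "free_basis X OX M 2 V e" and W: "openin X W" "W \<subseteq> V"
  shows "basis_trace W (\<lambda>i. res M V W (e i)) \<phi> =
      res OX V W (basis_trace V e \<phi>)"
    and "basis_det W (\<lambda>i. res M V W (e i)) \<phi> =
      res OX V W (basis_det V e \<phi>)"
proof -
  note V = free_basis_open[OF b]
  have WU: "W \<subseteq> U" using W VU by blast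
  interpret V: rank_two_basis "sec OX V" "sec M V" e by (rule free_basis_rank_two[OF b])
  interpret W: rank_two_basis "sec OX W" "sec M W" "\<lambda>i. res M V W (e i)"
    by (rule free_basis_rank_two[OF free_basis_restrict[OF b W]])
  interpret r: ring_hom_cring "sec OX V" "sec OX W" "res OX V W" by (rule OX_res_hom[OF V W])
  note fV = sheaf_endo_closed[OF \<phi> V VU] and fW = sheaf_endo_closed[OF \<phi> W(1) WU]
  have c: "V.coords (\<phi> V (e j)) i \<in> carrier (sec OX V)" if "i < 2" "j < 2" for i j
    by (rule V.coords_closed[OF funcset_mem[OF fV V.e_closed[OF that(2)]] that(1)])
  have eq: "W.coords (\<phi> W (res M V W (e j))) i = res OX V W (V.coords (\<phi> V (e j)) i)" if "i < 2" "j < 2" for i j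
    using coords_res[OF b W funcset_mem[OF fV V.e_closed[OF that(2)]] that(1)]
      sheaf_endo_res[OF \<phi> V W VU V.e_closed[OF that(2)]] by simp
  have lt: "0 < (2::nat)" "1 < (2::nat)" by auto
  show "basis_trace W (\<lambda>i. res M V W (e i)) \<phi> =
      res OX V W (basis_trace V e \<phi>)"
    unfolding V.trace_eq[OF fV] W.trace_eq[OF fW] eq[OF lt(1,1)] eq[OF lt(2,2)]
    by (rule r.hom_add[OF c[OF lt(1,1)] c[OF lt(2,2)], symmetric])
  show "basis_det W (\<lambda>i. res M V W (e i)) \<phi> =
      res OX V W (basis_det V e \<phi>)"
    unfolding V.det_eq[OF fV] W.det_eq[OF fW] eq[OF lt(1,1)] eq[OF lt(2,2)] eq[OF lt(1,2)] eq[OF lt(2,1)]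
    using c[OF lt(1,1)] c[OF lt(1,2)] c[OF lt(2,1)] c[OF lt(2,2)] by (simp add: a_minus_def)
qed

lemma locally_free_cover:
  assumes lf: "locally_free X OX M n" and U: "openin X U"
  shows "\<Union>{V. V \<subseteq> U \<and> (\<exists>e. free_basis X OX M n V e)} = U"
proof (intro equalityI subsetI)
  fix x assume x: "x \<in> U"
  then obtain V e where V: "x \<in> V" "free_basis X OX M n V e"
    using lf openin_subset[OF U] unfolding locally_free_def by blast
  have "free_basis X OX M n (V \<inter> U) (\<lambda>i. res M V (V \<inter> U) (e i))"
    by (rule free_basis_restrict[OF V(2) openin_Int[OF free_basis_open[OF V(2)] U] Int_lower1])
  then show "x \<in> \<Union>{V. V \<subseteq> U \<and> (\<exists>e. free_basis X OX M n V e)}" using x V by blast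
qed blast

lemma locally_free_local_eq:
  assumes lf: "locally_free X OX M n" and U: "openin X U"
    and st: "s \<in> carrier (sec OX U)" "t \<in> carrier (sec OX U)"
    and eq: "\<And>V e. V \<subseteq> U \<Longrightarrow> free_basis X OX M n V e \<Longrightarrow> res OX U V s = res OX U V t"
  shows "s = t"
  by (rule OX_separated[OF _ locally_free_cover[OF lf U, symmetric] st]) (use eq free_basis_open in blast)+

text \<open>Trace and determinant glue for the same reason, so the argument is made for any quantity
  \<open>T\<close> attached to a local basis. On the overlap of two sets the two restricted bases
  are bases of the same module, and \<open>ind\<close> identifies their values.\<close>

lemma glue_basis_invariant:
  assumes lf: "locally_free X OX M n" and U: "openin X U"
    and closed: "\<And>V e. V \<subseteq> U \<Longrightarrow> free_basis X OX M n V e \<Longrightarrow> T V e \<in> carrier (sec OX V)"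
    and res: "\<And>V W e. \<lbrakk>V \<subseteq> U; free_basis X OX M n V e; openin X W; W \<subseteq> V\<rbrakk> \<Longrightarrow>
      T W (\<lambda>i. res M V W (e i)) = res OX V W (T V e)"
    and ind: "\<And>V e f. \<lbrakk>V \<subseteq> U; free_basis X OX M n V e; free_basis X OX M n V f\<rbrakk> \<Longrightarrow> T V e = T V f"
  shows "\<exists>!t. t \<in> carrier (sec OX U) \<and> (\<forall>V e. V \<subseteq> U \<and> free_basis X OX M n V e \<longrightarrow> res OX U V t = T V e)"
proof -
  define \<U> where "\<U> = {V. V \<subseteq> U \<and> (\<exists>e. free_basis X OX M n V e)}"
  \<comment> \<open>Glueing asks for one section per open set, so a basis is chosen on each; by
    \<open>ind\<close> the choice does not affect the value.\<close>
  define s where "s V = T V (SOME e. free_basis X OX M n V e)" for V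
  have s: "s V = T V e" if "V \<subseteq> U" "free_basis X OX M n V e" for V e
    unfolding s_def using someI[of "free_basis X OX M n V" e] that by (intro ind) auto
  have cover: "\<Union>\<U> = U" unfolding \<U>_def by (rule locally_free_cover[OF lf U])
  have "\<exists>!t. t \<in> carrier (sec OX (\<Union>\<U>)) \<and> (\<forall>V \<in> \<U>. res OX (\<Union>\<U>) V t = s V)"
  proof (rule sheaf_glue[OF OX_sheaf])
    show "openin X V" if "V \<in> \<U>" for V using that free_basis_open unfolding \<U>_def by blast
    show "s V \<in> carrier (sec OX V)" if "V \<in> \<U>" for V
      using that closed s unfolding \<U>_def by fastforce
    show "res OX V (V \<inter> W) (s V) = res OX W (V \<inter> W) (s W)" if VW: "V \<in> \<U>" "W \<in> \<U>" for V W
    proof -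
      obtain e f where e: "V \<subseteq> U" "free_basis X OX M n V e" and f: "W \<subseteq> U" "free_basis X OX M n W f"
        using VW unfolding \<U>_def by blast
      note o = openin_Int[OF free_basis_open[OF e(2)] free_basis_open[OF f(2)]]
      have "T (V \<inter> W) (\<lambda>i. res M V (V \<inter> W) (e i)) = T (V \<inter> W) (\<lambda>i. res M W (V \<inter> W) (f i))"
        using e(1) by (intro ind free_basis_restrict[OF e(2) o] free_basis_restrict[OF f(2) o]) auto
      then show ?thesis
        unfolding s[OF e] s[OF f] using res[OF e o] res[OF f o] by simp
    qed
  qed
  moreover have "(\<forall>V \<in> \<U>. res OX U V t = s V) \<longleftrightarrow>
    (\<forall>V e. V \<subseteq> U \<and> free_basis X OX M n V e \<longrightarrow> res OX U V t = T V e)" for t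
    unfolding \<U>_def using s by (auto; metis)
  ultimately show ?thesis unfolding cover by simp
qed

end

text \<open>Auxiliary, parallel to \<open>endo_trace\<close>: in rank two it is the constant
  coefficient of \<open>endo_charpoly\<close>.\<close>

definition endo_det ::
  "'p topology \<Rightarrow> ('p, 'r) ring_presheaf \<Rightarrow> ('p, 'r, 'm) module_presheaf \<Rightarrow> nat \<Rightarrow> 'p set \<Rightarrow>
   ('p set \<Rightarrow> 'm \<Rightarrow> 'm) \<Rightarrow> 'r" where
  "endo_det X OX M n U \<phi> =
     (THE t. t \<in> carrier (sec OX U) \<and>
        (\<forall>V e. V \<subseteq> U \<and> free_basis X OX M n V e \<longrightarrow>
           res OX U V t = matrix_det (sec OX V) n
             (endo_matrix (sec OX V) (sec M V) n e (\<phi> V))))"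

section \<open>Existence of the glued trace, determinant and characteristic polynomial\<close>

context module_sheaf
begin

context
  fixes U \<phi>
  assumes lf: "locally_free X OX M 2" and U: "openin X U" and \<phi>: "sheaf_endo U \<phi>"
begin

lemma endo_trace_ex1:
  "\<exists>!t. t \<in> carrier (sec OX U) \<and> (\<forall>V e. V \<subseteq> U \<and> free_basis X OX M 2 V e \<longrightarrow>
    res OX U V t = basis_trace V e \<phi>)"
proof (rule glue_basis_invariant[OF lf U])
  fix V e assume V: "V \<subseteq> U" "free_basis X OX M 2 V e"
  note o = free_basis_open[OF V(2)]
  show "basis_trace V e \<phi> \<in> carrier (sec OX V)"
    by (rule rank_two_basis.trace_closed[OF free_basis_rank_two[OF V(2)] sheaf_endo_closed[OF \<phi> o V(1)]])
  show "basis_trace V e \<phi> =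
      basis_trace V f \<phi>"
    if "free_basis X OX M 2 V f" for f
    by (rule rank_two_basis.trace_det_basis_independent(1)[OF free_basis_rank_two[OF that]
          free_basis_rank_two[OF V(2)] sheaf_endo_linear[OF \<phi> o V(1)]])
qed (rule trace_det_res(1)[OF \<phi>])

lemma endo_det_ex1:
  "\<exists>!t. t \<in> carrier (sec OX U) \<and> (\<forall>V e. V \<subseteq> U \<and> free_basis X OX M 2 V e \<longrightarrow>
    res OX U V t = basis_det V e \<phi>)"
proof (rule glue_basis_invariant[OF lf U])
  fix V e assume V: "V \<subseteq> U" "free_basis X OX M 2 V e"
  note o = free_basis_open[OF V(2)]
  show "basis_det V e \<phi> \<in> carrier (sec OX V)"
    by (rule rank_two_basis.det_closed[OF free_basis_rank_two[OF V(2)] sheaf_endo_closed[OF \<phi> o V(1)]])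
  show "basis_det V e \<phi> =
      basis_det V f \<phi>"
    if "free_basis X OX M 2 V f" for f
    by (rule rank_two_basis.trace_det_basis_independent(2)[OF free_basis_rank_two[OF that]
          free_basis_rank_two[OF V(2)] sheaf_endo_linear[OF \<phi> o V(1)]])
qed (rule trace_det_res(2)[OF \<phi>])

lemma endo_trace_closed: "endo_trace X OX M 2 U \<phi> \<in> carrier (sec OX U)"
  unfolding endo_trace_def by (rule theI'[OF endo_trace_ex1, THEN conjunct1])

lemma res_endo_trace: "V \<subseteq> U \<Longrightarrow> free_basis X OX M 2 V e \<Longrightarrow>
    res OX U V (endo_trace X OX M 2 U \<phi>) =
    basis_trace V e \<phi>"
  unfolding endo_trace_def by (rule theI'[OF endo_trace_ex1, THEN conjunct2, rule_format]) simp

lemma endo_det_closed: "endo_det X OX M 2 U \<phi> \<in> carrier (sec OX U)"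
  unfolding endo_det_def by (rule theI'[OF endo_det_ex1, THEN conjunct1])

lemma res_endo_det: "V \<subseteq> U \<Longrightarrow> free_basis X OX M 2 V e \<Longrightarrow>
    res OX U V (endo_det X OX M 2 U \<phi>) =
    basis_det V e \<phi>"
  unfolding endo_det_def by (rule theI'[OF endo_det_ex1, THEN conjunct2, rule_format]) simp

text \<open>The quadratic polynomial built from the glued trace and determinant has the defining
  property, because restriction is a ring homomorphism and carries the coefficients along.\<close>

lemma endo_charpoly_eq:
  "endo_charpoly X OX M 2 U \<phi> =
    quad_poly (sec OX U) (endo_trace X OX M 2 U \<phi>) (endo_det X OX M 2 U \<phi>)"
proof -
  interpret U: cring "sec OX U" by (rule OX_cring[OF U])
  let ?p = "quad_poly (sec OX U) (endo_trace X OX M 2 U \<phi>) (endo_det X OX M 2 U \<phi>)"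
  have pc: "?p \<in> carrier (UP (sec OX U))" by (rule U.quad_poly_closed[OF endo_trace_closed endo_det_closed])
  have res: "res OX U V (?p k) = coeff (UP (sec OX V)) (matrix_charpoly (sec OX V) 2
      (endo_matrix (sec OX V) (sec M V) 2 e (\<phi> V))) k"
    if V: "V \<subseteq> U" "free_basis X OX M 2 V e" for V e k
  proof -
    note o = free_basis_open[OF V(2)]
    interpret V: rank_two_basis "sec OX V" "sec M V" e by (rule free_basis_rank_two[OF V(2)])
    interpret r: ring_hom_cring "sec OX U" "sec OX V" "res OX U V" by (rule OX_res_hom[OF U o V(1)])
    note B = V.endo_matrix_closed[OF sheaf_endo_closed[OF \<phi> o V(1)]]
    have "res OX U V (?p k) = quad_poly (sec OX V) (res OX U V (endo_trace X OX M 2 U \<phi>)) (res OX U V (endo_det X OX M 2 U \<phi>)) k"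
      using endo_trace_closed by (simp add: quad_poly_def)
    also have "\<dots> = coeff (UP (sec OX V)) (matrix_charpoly (sec OX V) 2
      (endo_matrix (sec OX V) (sec M V) 2 e (\<phi> V))) k"
      unfolding res_endo_trace[OF V] res_endo_det[OF V]
      by (rule V.R.coeff_matrix_charpoly_2[symmetric]) (rule B; simp)+
    finally show ?thesis .
  qed
  show ?thesis unfolding endo_charpoly_def
  proof (rule the_equality)
    show "?p \<in> carrier (UP (sec OX U)) \<and> (\<forall>V e. V \<subseteq> U \<and> free_basis X OX M 2 V e \<longrightarrow>
        (\<forall>k. res OX U V (coeff (UP (sec OX U)) ?p k) = coeff (UP (sec OX V)) (matrix_charpoly (sec OX V) 2
          (endo_matrix (sec OX V) (sec M V) 2 e (\<phi> V))) k))"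
      using pc res by (simp add: U.coeff_UP)
    fix q assume q: "q \<in> carrier (UP (sec OX U)) \<and> (\<forall>V e. V \<subseteq> U \<and> free_basis X OX M 2 V e \<longrightarrow>
        (\<forall>k. res OX U V (coeff (UP (sec OX U)) q k) = coeff (UP (sec OX V)) (matrix_charpoly (sec OX V) 2
          (endo_matrix (sec OX V) (sec M V) 2 e (\<phi> V))) k))"
    \<comment> \<open>Uniqueness is checked for each coefficient: a section over \<open>U\<close> is
      determined by its restrictions to the sets that carry a basis.\<close>
    have "q k = ?p k" for k
    proof (rule locally_free_local_eq[OF lf U])
      show "q k \<in> carrier (sec OX U)" "?p k \<in> carrier (sec OX U)"
        using q pc by (auto simp: UP_def)
      show "res OX U V (q k) = res OX U V (?p k)" if "V \<subseteq> U" "free_basis X OX M 2 V e" for V e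
        unfolding res[OF that] using q that U.coeff_UP by metis
    qed
    then show "q = ?p" by blast
  qed
qed

end

end

section \<open>Modules over a sheaf of algebras\<close>

lemma restrict_scalars_simps [simp]:
  "carrier (sec (restrict_scalars B M) U) = carrier (sec M U)"
  "ring.add (sec (restrict_scalars B M) U) = ring.add (sec M U)"
  "ring.zero (sec (restrict_scalars B M) U) = ring.zero (sec M U)"
  "smult (sec (restrict_scalars B M) U) r m = (r \<odot>\<^bsub>sec B U\<^esub> \<one>\<^bsub>sec B U\<^esub>) \<odot>\<^bsub>sec M U\<^esub> m"
  "res (restrict_scalars B M) = res M"
  unfolding restrict_scalars_def by simp_all

text \<open>Negation depends only on carrier, addition and zero, which restriction of scalars leaves
  alone.\<close>

lemma restrict_scalars_minus: "x \<ominus>\<^bsub>sec (restrict_scalars B M) U\<^esub> y = x \<ominus>\<^bsub>sec M U\<^esub> y"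
  by (simp add: a_minus_def a_inv_def m_inv_def)

context algebra
begin

lemma smult_one_mult: "\<lbrakk>r \<in> carrier R; x \<in> carrier M\<rbrakk> \<Longrightarrow> (r \<odot>\<^bsub>M\<^esub> \<one>\<^bsub>M\<^esub>) \<otimes>\<^bsub>M\<^esub> x = r \<odot>\<^bsub>M\<^esub> x"
  using smult_assoc2[of r "\<one>\<^bsub>M\<^esub>" x] one_closed l_one by simp

lemma smult_one_closed: "r \<in> carrier R \<Longrightarrow> r \<odot>\<^bsub>M\<^esub> \<one>\<^bsub>M\<^esub> \<in> carrier M"
  using smult_closed one_closed by blast

end

locale algebra_module_sheaf = module_sheaf X OX OY
  for X :: "'p topology" and OX :: "('p, 'r) ring_presheaf" and OY :: "('p, 'r, 's) module_presheaf" +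
  fixes I :: "('p, 's, 'm) module_presheaf"
  assumes OY_algebras: "sheaf_of_algebras X OX OY" and I_modules: "sheaf_of_modules X OY I"
begin

abbreviation "J \<equiv> restrict_scalars OY I"

text \<open>These traces and determinants belong to a section \<open>y\<close> over \<open>V\<close>
  itself, whereas \<open>algebra_mult\<close> and \<open>module_mult\<close> start from a section
  over a larger open set and restrict it. Sections that do not extend are covered as well.\<close>

abbreviation "mult_trace V e y \<equiv>
  matrix_trace (sec OX V) 2 (endo_matrix (sec OX V) (sec OY V) 2 e ((\<otimes>\<^bsub>sec OY V\<^esub>) y))"
abbreviation "mult_det V e y \<equiv>
  matrix_det (sec OX V) 2 (endo_matrix (sec OX V) (sec OY V) 2 e ((\<otimes>\<^bsub>sec OY V\<^esub>) y))"
abbreviation "act_trace V b y \<equiv>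
  matrix_trace (sec OX V) 2 (endo_matrix (sec OX V) (sec J V) 2 b ((\<odot>\<^bsub>sec I V\<^esub>) y))"
abbreviation "act_det V b y \<equiv>
  matrix_det (sec OX V) 2 (endo_matrix (sec OX V) (sec J V) 2 b ((\<odot>\<^bsub>sec I V\<^esub>) y))"

lemma OY_algebra: "openin X V \<Longrightarrow> algebra (sec OX V) (sec OY V)"
  using OY_algebras unfolding sheaf_of_algebras_def by (elim conjE) simp

lemma OY_res_hom:
  assumes "openin X U" "openin X V" "V \<subseteq> U"
  shows "res OY U V \<in> ring_hom (sec OY U) (sec OY V)"
  using OY_algebras assms unfolding sheaf_of_algebras_def sheaf_of_rings_def by (elim conjE) simp

lemma I_module: "openin X V \<Longrightarrow> Module.module (sec OY V) (sec I V)"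
  using I_modules unfolding sheaf_of_modules_def by (elim conjE) simp

lemma I_res_smult:
  "\<lbrakk>openin X U; openin X V; V \<subseteq> U; a \<in> carrier (sec OY U); m \<in> carrier (sec I U)\<rbrakk> \<Longrightarrow>
    res I U V (a \<odot>\<^bsub>sec I U\<^esub> m) = res OY U V a \<odot>\<^bsub>sec I V\<^esub> res I U V m"
  using I_modules unfolding sheaf_of_modules_def by (elim conjE) simp

lemma I_sheaf: "sheaf X I" using I_modules unfolding sheaf_of_modules_def by (elim conjE)

lemma J_module:
  assumes V: "openin X V" shows "Module.module (sec OX V) (sec J V)"
proof -
  interpret B: algebra "sec OX V" "sec OY V" by (rule OY_algebra[OF V])
  interpret N: Module.module "sec OY V" "sec I V" by (rule I_module[OF V])
  have "abelian_group (sec J V)"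
  proof (rule abelian_groupI)
    show "\<exists>y\<in>carrier (sec J V). y \<oplus>\<^bsub>sec J V\<^esub> x = \<zero>\<^bsub>sec J V\<^esub>" if "x \<in> carrier (sec J V)" for x
      using that by (intro bexI[of _ "\<ominus>\<^bsub>sec I V\<^esub> x"]) (simp_all add: N.M.l_neg)
  qed (simp_all add: N.M.a_ac)
  then show ?thesis
    by (intro moduleI B.R.is_cring)
      (simp_all add: B.smult_one_closed B.smult_l_distr N.smult_l_distr N.smult_r_distr
        N.smult_assoc1[symmetric] B.smult_one_mult B.smult_assoc1)
qed

text \<open>Restriction is compatible with the induced scalars because the algebra restrictions
  preserve the unit and are compatible with scalars.\<close>

lemma J_modules: "sheaf_of_modules X OX J"
  unfolding sheaf_of_modules_def
proof (intro conjI allI impI)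
  show "sheaf X J" using I_sheaf unfolding sheaf_def restrict_scalars_simps .
  show "Module.module (sec OX U) (sec J U)" if "openin X U" for U by (rule J_module[OF that])
  fix U V assume "openin X U \<and> openin X V \<and> V \<subseteq> U"
  then have o: "openin X U" "openin X V" "V \<subseteq> U" by auto
  interpret B: algebra "sec OX U" "sec OY U" by (rule OY_algebra[OF o(1)])
  have one: "\<one>\<^bsub>sec OY U\<^esub> \<in> carrier (sec OY U)" "res OY U V \<one>\<^bsub>sec OY U\<^esub> = \<one>\<^bsub>sec OY V\<^esub>"
    using ring_hom_one[OF OY_res_hom[OF o]] B.one_closed by auto
  show "\<forall>x\<in>carrier (sec J U). \<forall>y\<in>carrier (sec J U).
      res J U V (x \<oplus>\<^bsub>sec J U\<^esub> y) = res J U V x \<oplus>\<^bsub>sec J V\<^esub> res J U V y"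
    using I_modules o unfolding sheaf_of_modules_def by (elim conjE) simp
  show "\<forall>r\<in>carrier (sec OX U). \<forall>x\<in>carrier (sec J U).
      res J U V (r \<odot>\<^bsub>sec J U\<^esub> x) = res OX U V r \<odot>\<^bsub>sec J V\<^esub> res J U V x"
    using I_res_smult[OF o] res_smult[OF o _ one(1)] B.smult_one_closed by (simp add: one(2))
qed

sublocale J: module_sheaf X OX J
  by (intro module_sheaf.intro ring_sheaf_axioms module_sheaf_axioms.intro J_modules)

text \<open>A base scalar can be moved into the algebra element from either side of its action; from
  the inside this uses commutativity of the algebra. Linearity of the action follows by comparing
  the two forms.\<close>

lemma J_smult:
  assumes V: "openin X V" and c: "c \<in> carrier (sec OX V)" "y \<in> carrier (sec OY V)" "m \<in> carrier (sec I V)"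
  shows "c \<odot>\<^bsub>sec J V\<^esub> (y \<odot>\<^bsub>sec I V\<^esub> m) = (c \<odot>\<^bsub>sec OY V\<^esub> y) \<odot>\<^bsub>sec I V\<^esub> m"
    and "y \<odot>\<^bsub>sec I V\<^esub> (c \<odot>\<^bsub>sec J V\<^esub> m) = (c \<odot>\<^bsub>sec OY V\<^esub> y) \<odot>\<^bsub>sec I V\<^esub> m"
proof -
  interpret B: algebra "sec OX V" "sec OY V" by (rule OY_algebra[OF V])
  interpret N: Module.module "sec OY V" "sec I V" by (rule I_module[OF V])
  note o = B.smult_one_closed[OF c(1)]
  show "c \<odot>\<^bsub>sec J V\<^esub> (y \<odot>\<^bsub>sec I V\<^esub> m) = (c \<odot>\<^bsub>sec OY V\<^esub> y) \<odot>\<^bsub>sec I V\<^esub> m"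
    using N.smult_assoc1[OF o c(2,3)] by (simp add: B.smult_one_mult[OF c(1,2)])
  show "y \<odot>\<^bsub>sec I V\<^esub> (c \<odot>\<^bsub>sec J V\<^esub> m) = (c \<odot>\<^bsub>sec OY V\<^esub> y) \<odot>\<^bsub>sec I V\<^esub> m"
    using N.smult_assoc1[OF c(2) o c(3)] B.m_comm[OF c(2) o] by (simp add: B.smult_one_mult[OF c(1,2)])
qed

lemma mult_linear_endo:
  assumes V: "openin X V" and y: "y \<in> carrier (sec OY V)"
  shows "linear_endo (sec OX V) (sec OY V) ((\<otimes>\<^bsub>sec OY V\<^esub>) y)"
    and "linear_endo (sec OX V) (sec J V) ((\<odot>\<^bsub>sec I V\<^esub>) y)"
proof -
  interpret B: algebra "sec OX V" "sec OY V" by (rule OY_algebra[OF V])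
  interpret N: Module.module "sec OY V" "sec I V" by (rule I_module[OF V])
  have "y \<otimes>\<^bsub>sec OY V\<^esub> (r \<odot>\<^bsub>sec OY V\<^esub> x) = r \<odot>\<^bsub>sec OY V\<^esub> (y \<otimes>\<^bsub>sec OY V\<^esub> x)"
    if "r \<in> carrier (sec OX V)" "x \<in> carrier (sec OY V)" for r x
    using B.smult_assoc2[OF that(1,2) y] that y by (simp add: B.m_comm[of y])
  then show "linear_endo (sec OX V) (sec OY V) ((\<otimes>\<^bsub>sec OY V\<^esub>) y)"
    unfolding linear_endo_def using y by (simp add: B.r_distr)
  show "linear_endo (sec OX V) (sec J V) ((\<odot>\<^bsub>sec I V\<^esub>) y)"
    unfolding linear_endo_def
  proof (intro conjI ballI)
    show "(\<odot>\<^bsub>sec I V\<^esub>) y \<in> carrier (sec J V) \<rightarrow> carrier (sec J V)" using y by simp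
    show "y \<odot>\<^bsub>sec I V\<^esub> (m \<oplus>\<^bsub>sec J V\<^esub> m') = y \<odot>\<^bsub>sec I V\<^esub> m \<oplus>\<^bsub>sec J V\<^esub> y \<odot>\<^bsub>sec I V\<^esub> m'"
      if "m \<in> carrier (sec J V)" "m' \<in> carrier (sec J V)" for m m'
      using that y by (simp add: N.smult_r_distr)
    show "y \<odot>\<^bsub>sec I V\<^esub> (r \<odot>\<^bsub>sec J V\<^esub> m) = r \<odot>\<^bsub>sec J V\<^esub> (y \<odot>\<^bsub>sec I V\<^esub> m)"
      if "r \<in> carrier (sec OX V)" "m \<in> carrier (sec J V)" for r m
      using J_smult[OF V that(1) y, of m] that(2) by simp
  qed
qed

lemma algebra_mult_endo:
  assumes U: "openin X U" and a: "a \<in> carrier (sec OY U)"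
  shows "sheaf_endo U (algebra_mult OY U a)"
  unfolding sheaf_endo_def algebra_mult_def
proof (intro conjI allI impI)
  show "linear_endo (sec OX V) (sec OY V) ((\<otimes>\<^bsub>sec OY V\<^esub>) (res OY U V a))" if "openin X V \<and> V \<subseteq> U" for V
    using mult_linear_endo(1)[OF _ res_closed[OF U _ _ a]] that by simp
  fix V W m assume "openin X V \<and> openin X W \<and> W \<subseteq> V \<and> V \<subseteq> U \<and> m \<in> carrier (sec OY V)"
  then have o: "openin X V" "openin X W" "W \<subseteq> V" "V \<subseteq> U" "m \<in> carrier (sec OY V)" by auto
  show "res OY V W (res OY U V a \<otimes>\<^bsub>sec OY V\<^esub> m) = res OY U W a \<otimes>\<^bsub>sec OY W\<^esub> res OY V W m"
    using ring_hom_mult[OF OY_res_hom[OF o(1-3)] res_closed[OF U o(1,4) a] o(5)]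
      res_trans[OF U o(1-4) a] by simp
qed

lemma module_mult_endo:
  assumes U: "openin X U" and a: "a \<in> carrier (sec OY U)"
  shows "J.sheaf_endo U (module_mult OY I U a)"
  unfolding J.sheaf_endo_def module_mult_def
proof (intro conjI allI impI)
  show "linear_endo (sec OX V) (sec J V) ((\<odot>\<^bsub>sec I V\<^esub>) (res OY U V a))" if "openin X V \<and> V \<subseteq> U" for V
    using mult_linear_endo(2)[OF _ res_closed[OF U _ _ a]] that by simp
  fix V W m assume "openin X V \<and> openin X W \<and> W \<subseteq> V \<and> V \<subseteq> U \<and> m \<in> carrier (sec J V)"
  then have o: "openin X V" "openin X W" "W \<subseteq> V" "V \<subseteq> U" "m \<in> carrier (sec I V)" by auto
  show "res J V W (res OY U V a \<odot>\<^bsub>sec I V\<^esub> m) = res OY U W a \<odot>\<^bsub>sec I W\<^esub> res J V W m"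
    using I_res_smult[OF o(1-3) res_closed[OF U o(1,4) a] o(5)] res_trans[OF U o(1-4) a] by simp
qed


lemma det_eq_of_trace_eq:
  assumes e: "free_basis X OX OY 2 V e" and b: "free_basis X OX J 2 V b" and y: "y \<in> carrier (sec OY V)"
    and tr: "mult_trace V e y =
      act_trace V b y"
  shows "mult_det V e y =
      act_det V b y"
proof -
  note V = free_basis_open[OF e]
  interpret B: algebra "sec OX V" "sec OY V" by (rule OY_algebra[OF V])
  interpret N: Module.module "sec OY V" "sec I V" by (rule I_module[OF V])
  interpret e: rank_two_basis "sec OX V" "sec OY V" e by (rule free_basis_rank_two[OF e])
  interpret b: rank_two_basis "sec OX V" "sec J V" b by (rule J.free_basis_rank_two[OF b])
  note le = mult_linear_endo(1)[OF V y] and lb = mult_linear_endo(2)[OF V y]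
  let ?\<phi> = "(\<otimes>\<^bsub>sec OY V\<^esub>) y" and ?\<psi> = "(\<odot>\<^bsub>sec I V\<^esub>) y"
  define t d d' where "t = e.tr ?\<phi>" and "d = e.dt ?\<phi>" and "d' = b.dt ?\<psi>"
  have t': "b.tr ?\<psi> = t" unfolding t_def tr ..
  have c: "t \<in> carrier (sec OX V)" "d \<in> carrier (sec OX V)" "d' \<in> carrier (sec OX V)"
    unfolding t_def d_def d'_def using le lb
    by (auto intro!: e.trace_closed e.det_closed b.det_closed simp: linear_endo_def)
  define m where "m = b 0"
  have m: "m \<in> carrier (sec I V)" using b.e01 unfolding m_def by simp
  note one = B.one_closed
  \<comment> \<open>Cayley-Hamilton for multiplication by \<open>y\<close>, evaluated at the unit,
    is a relation between elements of the algebra, and hence valid on every module over it.\<close>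
  have y2: "y \<otimes>\<^bsub>sec OY V\<^esub> y = t \<odot>\<^bsub>sec OY V\<^esub> y \<ominus>\<^bsub>sec OY V\<^esub> d \<odot>\<^bsub>sec OY V\<^esub> \<one>\<^bsub>sec OY V\<^esub>"
    using e.cayley_hamilton_2[OF le one] y unfolding t_def[symmetric] d_def[symmetric] by simp
  have yc: "t \<odot>\<^bsub>sec OY V\<^esub> y \<in> carrier (sec OY V)" "d \<odot>\<^bsub>sec OY V\<^esub> \<one>\<^bsub>sec OY V\<^esub> \<in> carrier (sec OY V)"
    using c y by auto
  \<comment> \<open>The vector obtained by acting twice with \<open>y\<close> on \<open>m\<close> is
    computed in two ways: from the module's own characteristic equation and from \<open>y2\<close>.
    The trace terms coincide by assumption and cancel.\<close>
  have "t \<odot>\<^bsub>sec J V\<^esub> (y \<odot>\<^bsub>sec I V\<^esub> m) \<ominus>\<^bsub>sec I V\<^esub> d' \<odot>\<^bsub>sec J V\<^esub> m = y \<odot>\<^bsub>sec I V\<^esub> (y \<odot>\<^bsub>sec I V\<^esub> m)"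
    using b.cayley_hamilton_2[OF lb b.e01(1)] unfolding m_def[symmetric] t' d'_def[symmetric] restrict_scalars_minus ..
  also have "\<dots> = (y \<otimes>\<^bsub>sec OY V\<^esub> y) \<odot>\<^bsub>sec I V\<^esub> m" using N.smult_assoc1[OF y y m] ..
  also have "\<dots> = (t \<odot>\<^bsub>sec OY V\<^esub> y) \<odot>\<^bsub>sec I V\<^esub> m \<ominus>\<^bsub>sec I V\<^esub> (d \<odot>\<^bsub>sec OY V\<^esub> \<one>\<^bsub>sec OY V\<^esub>) \<odot>\<^bsub>sec I V\<^esub> m"
    unfolding y2 a_minus_def using yc m N.smult_l_minus[OF yc(2) m] by (subst N.smult_l_distr) auto
  also have "\<dots> = t \<odot>\<^bsub>sec J V\<^esub> (y \<odot>\<^bsub>sec I V\<^esub> m) \<ominus>\<^bsub>sec I V\<^esub> d \<odot>\<^bsub>sec J V\<^esub> m"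
    unfolding J_smult(1)[OF V c(1) y m] by simp
  finally have eq: "t \<odot>\<^bsub>sec J V\<^esub> (y \<odot>\<^bsub>sec I V\<^esub> m) \<ominus>\<^bsub>sec I V\<^esub> d' \<odot>\<^bsub>sec J V\<^esub> m =
      t \<odot>\<^bsub>sec J V\<^esub> (y \<odot>\<^bsub>sec I V\<^esub> m) \<ominus>\<^bsub>sec I V\<^esub> d \<odot>\<^bsub>sec J V\<^esub> m" .
  have jc: "r \<odot>\<^bsub>sec J V\<^esub> m' \<in> carrier (sec I V)" if "r \<in> carrier (sec OX V)" "m' \<in> carrier (sec I V)" for r m'
    using b.smult_closed[OF that(1), of m'] that(2) by simp
  have ym: "y \<odot>\<^bsub>sec I V\<^esub> m \<in> carrier (sec I V)" by (rule N.smult_closed[OF y m])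
  have "\<ominus>\<^bsub>sec I V\<^esub> (d' \<odot>\<^bsub>sec J V\<^esub> m) = \<ominus>\<^bsub>sec I V\<^esub> (d \<odot>\<^bsub>sec J V\<^esub> m)"
    by (rule N.M.add.l_cancel[OF eq[unfolded a_minus_def] N.M.a_inv_closed[OF jc[OF c(3) m]]
          N.M.a_inv_closed[OF jc[OF c(2) m]] jc[OF c(1) ym]])
  then have "d' \<odot>\<^bsub>sec J V\<^esub> m = d \<odot>\<^bsub>sec J V\<^esub> m"
    using N.M.minus_minus[OF jc[OF c(3) m]] N.M.minus_minus[OF jc[OF c(2) m]] by metis
  \<comment> \<open>\<open>m\<close> is the basis vector \<open>b 0\<close>, so equal multiples of
    it have equal scalars.\<close>
  then show ?thesis
    using b.smult_e0_cancel[OF c(3,2)] unfolding m_def d_def d'_def by simp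
qed

text \<open>With its counterpart for the module, this makes both traces linear forms in the algebra
  element, so they can be compared on a basis of the algebra and after multiplication by an
  invertible scalar.\<close>

lemma trace_mult_add_smult:
  assumes e: "free_basis X OX OY 2 V e" and c: "c \<in> carrier (sec OX V)"
    and y: "y \<in> carrier (sec OY V)" "y' \<in> carrier (sec OY V)"
  shows "mult_trace V e (y \<oplus>\<^bsub>sec OY V\<^esub> y') =
      mult_trace V e y \<oplus>\<^bsub>sec OX V\<^esub>
      mult_trace V e y'"
    and "mult_trace V e (c \<odot>\<^bsub>sec OY V\<^esub> y) =
      c \<otimes>\<^bsub>sec OX V\<^esub> mult_trace V e y"
proof -
  note V = free_basis_open[OF e]
  interpret B: algebra "sec OX V" "sec OY V" by (rule OY_algebra[OF V])
  interpret e: rank_two_basis "sec OX V" "sec OY V" e by (rule free_basis_rank_two[OF e])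
  show "e.tr ((\<otimes>\<^bsub>sec OY V\<^esub>) (y \<oplus>\<^bsub>sec OY V\<^esub> y')) = e.tr ((\<otimes>\<^bsub>sec OY V\<^esub>) y) \<oplus>\<^bsub>sec OX V\<^esub> e.tr ((\<otimes>\<^bsub>sec OY V\<^esub>) y')"
    by (rule e.trace_add) (use y in \<open>auto simp: B.l_distr\<close>)
  show "e.tr ((\<otimes>\<^bsub>sec OY V\<^esub>) (c \<odot>\<^bsub>sec OY V\<^esub> y)) = c \<otimes>\<^bsub>sec OX V\<^esub> e.tr ((\<otimes>\<^bsub>sec OY V\<^esub>) y)"
    by (rule e.trace_smult) (use y c in \<open>auto simp: B.smult_assoc2\<close>)
qed

lemma trace_act_add_smult:
  assumes b: "free_basis X OX J 2 V b" and c: "c \<in> carrier (sec OX V)"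
    and y: "y \<in> carrier (sec OY V)" "y' \<in> carrier (sec OY V)"
  shows "act_trace V b (y \<oplus>\<^bsub>sec OY V\<^esub> y') =
      act_trace V b y \<oplus>\<^bsub>sec OX V\<^esub>
      act_trace V b y'"
    and "act_trace V b (c \<odot>\<^bsub>sec OY V\<^esub> y) =
      c \<otimes>\<^bsub>sec OX V\<^esub> act_trace V b y"
proof -
  note V = J.free_basis_open[OF b]
  interpret B: algebra "sec OX V" "sec OY V" by (rule OY_algebra[OF V])
  interpret N: Module.module "sec OY V" "sec I V" by (rule I_module[OF V])
  interpret b: rank_two_basis "sec OX V" "sec J V" b by (rule J.free_basis_rank_two[OF b])
  show "b.tr ((\<odot>\<^bsub>sec I V\<^esub>) (y \<oplus>\<^bsub>sec OY V\<^esub> y')) = b.tr ((\<odot>\<^bsub>sec I V\<^esub>) y) \<oplus>\<^bsub>sec OX V\<^esub> b.tr ((\<odot>\<^bsub>sec I V\<^esub>) y')"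
    by (rule b.trace_add) (use y in \<open>auto simp: N.smult_l_distr\<close>)
  show "b.tr ((\<odot>\<^bsub>sec I V\<^esub>) (c \<odot>\<^bsub>sec OY V\<^esub> y)) = c \<otimes>\<^bsub>sec OX V\<^esub> b.tr ((\<odot>\<^bsub>sec I V\<^esub>) y)"
    by (rule b.trace_smult[OF c])
      (use y c in \<open>auto simp: J_smult(1)[OF V c y(1), symmetric] simp del: restrict_scalars_simps(4)\<close>)
qed

lemma OX_local_eq:
  assumes U: "openin X U" and st: "s \<in> carrier (sec OX U)" "t \<in> carrier (sec OX U)"
    and eq: "\<And>x. x \<in> U \<Longrightarrow> \<exists>V. x \<in> V \<and> openin X V \<and> V \<subseteq> U \<and> res OX U V s = res OX U V t"
  shows "s = t"
  by (rule OX_separated[of "{V. openin X V \<and> V \<subseteq> U \<and> res OX U V s = res OX U V t}", OF _ _ st])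
    (use eq in blast)+

section \<open>Comparison of the two traces on open sets\<close>

context
  assumes lfY: "locally_free X OX OY 2" and lfJ: "locally_free X OX J 2"
begin

lemma common_basis:
  assumes W: "openin X W" "x \<in> W"
  shows "\<exists>V e b. x \<in> V \<and> V \<subseteq> W \<and> free_basis X OX OY 2 V e \<and> free_basis X OX J 2 V b"
proof -
  have x: "x \<in> topspace X" using openin_subset[OF W(1)] W(2) by blast
  obtain V1 e where e: "x \<in> V1" "free_basis X OX OY 2 V1 e" using lfY x unfolding locally_free_def by blast
  obtain V2 b where b: "x \<in> V2" "free_basis X OX J 2 V2 b" using lfJ x unfolding locally_free_def by blast
  have o: "openin X (V1 \<inter> V2 \<inter> W)" using free_basis_open[OF e(2)] J.free_basis_open[OF b(2)] W(1) by blast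
  have sub: "V1 \<inter> V2 \<inter> W \<subseteq> V1" "V1 \<inter> V2 \<inter> W \<subseteq> V2" by auto
  show ?thesis
  proof (intro exI[of _ "V1 \<inter> V2 \<inter> W"] exI conjI)
    show "x \<in> V1 \<inter> V2 \<inter> W" "V1 \<inter> V2 \<inter> W \<subseteq> W" using e(1) b(1) W(2) by auto
  qed (rule free_basis_restrict[OF e(2) o sub(1)] J.free_basis_restrict[OF b(2) o sub(2)])+
qed

lemma endo_det_eq:
  assumes U: "openin X U" and a: "a \<in> carrier (sec OY U)"
    and tr: "endo_trace X OX OY 2 U (algebra_mult OY U a) = endo_trace X OX J 2 U (module_mult OY I U a)"
  shows "endo_det X OX OY 2 U (algebra_mult OY U a) = endo_det X OX J 2 U (module_mult OY I U a)"
proof -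
  note Y = lfY U algebra_mult_endo[OF U a] and J = lfJ U module_mult_endo[OF U a]
  show ?thesis
  proof (rule OX_local_eq[OF U endo_det_closed[OF Y] J.endo_det_closed[OF J]])
    fix x assume x: "x \<in> U"
    obtain V e b where V: "x \<in> V" "V \<subseteq> U" "free_basis X OX OY 2 V e" "free_basis X OX J 2 V b"
      using common_basis[OF U x] by (elim exE conjE)
    note o = free_basis_open[OF V(3)]
    have "res OX U V (endo_det X OX OY 2 U (algebra_mult OY U a)) =
        res OX U V (endo_det X OX J 2 U (module_mult OY I U a))"
      unfolding res_endo_det[OF Y V(2,3)] J.res_endo_det[OF J V(2,4)]
      unfolding algebra_mult_def module_mult_def
      using res_endo_trace[OF Y V(2,3)] J.res_endo_trace[OF J V(2,4)] tr
      by (intro det_eq_of_trace_eq[OF V(3,4) res_closed[OF U o V(2) a]])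
        (simp add: algebra_mult_def module_mult_def)
    then show "\<exists>V. x \<in> V \<and> openin X V \<and> V \<subseteq> U \<and>
        res OX U V (endo_det X OX OY 2 U (algebra_mult OY U a)) =
        res OX U V (endo_det X OX J 2 U (module_mult OY I U a))"
      by (intro exI[of _ V] conjI V(1,2) o)
  qed
qed

text \<open>Holds for each section separately and over any open set; affineness enters only when
  passing to sections that do not extend.\<close>

lemma endo_charpoly_eq_iff:
  assumes U: "openin X U" and a: "a \<in> carrier (sec OY U)"
  shows "endo_charpoly X OX OY 2 U (algebra_mult OY U a) = endo_charpoly X OX J 2 U (module_mult OY I U a) \<longleftrightarrow>
    endo_trace X OX OY 2 U (algebra_mult OY U a) = endo_trace X OX J 2 U (module_mult OY I U a)"
proof -
  note Y = lfY U algebra_mult_endo[OF U a] and J = lfJ U module_mult_endo[OF U a]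
  interpret U: cring "sec OX U" by (rule OX_cring[OF U])
  show ?thesis
    unfolding endo_charpoly_eq[OF Y] J.endo_charpoly_eq[OF J]
    using U.quad_poly_eqD(1)[OF _ endo_trace_closed[OF Y] J.endo_trace_closed[OF J]] endo_det_eq[OF U a] by metis
qed


text \<open>The hypothesis concerns sections over all of \<open>W\<close>, the conclusion all
  sections over a small \<open>V\<close>, extendable or not. \<open>V\<close> is a basic open set of
  the chart, which makes extension available, and lies in a set carrying bases of both
  modules.\<close>

lemma trace_eq_on_chart:
  assumes aff: "affine_open X OX W"
    and eq: "\<forall>a \<in> carrier (sec OY W).
      endo_trace X OX OY 2 W (algebra_mult OY W a) = endo_trace X OX J 2 W (module_mult OY I W a)"
    and V0: "openin X V0" "V0 \<subseteq> W" "x \<in> V0"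
  shows "\<exists>V e b. x \<in> V \<and> V \<subseteq> V0 \<and> free_basis X OX OY 2 V e \<and> free_basis X OX J 2 V b \<and>
    (\<forall>y \<in> carrier (sec OY V).
      mult_trace V e y =
      act_trace V b y)"
proof -
  have W: "openin X W" using aff unfolding affine_open_def by (elim conjE)
  obtain A D \<phi> where chart: "affine_chart X OX W A D \<phi>" using affine_open_chart[OF OX_rings aff] by blast
  interpret C: chart_module X OX W A D \<phi> OY
    by (rule chart_module.intro[OF chart module_sheaf_axioms])
  obtain V1 e1 b1 where V1: "x \<in> V1" "V1 \<subseteq> V0" "free_basis X OX OY 2 V1 e1" "free_basis X OX J 2 V1 b1"
    using common_basis[OF V0(1,3)] by (elim exE conjE)
  obtain r where r: "r \<in> carrier A" "x \<in> D r" "D r \<subseteq> V1"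
    using C.D_basis[OF free_basis_open[OF V1(3)], of x] V1(1,2) V0(2) by blast
  define V where "V = D r"
  have V: "openin X V" "V \<subseteq> V1" "V \<subseteq> W" using C.D_open[OF r(1)] r(3) V1 V0 unfolding V_def by auto
  define e b where "e = (\<lambda>i. res OY V1 V (e1 i))" and "b = (\<lambda>i. res J V1 V (b1 i))"
  have e: "free_basis X OX OY 2 V e" unfolding e_def by (rule free_basis_restrict[OF V1(3) V(1,2)])
  have b: "free_basis X OX J 2 V b" unfolding b_def by (rule J.free_basis_restrict[OF V1(4) V(1,2)])
  interpret B: algebra "sec OX V" "sec OY V" by (rule OY_algebra[OF V(1)])
  interpret e: rank_two_basis "sec OX V" "sec OY V" e by (rule free_basis_rank_two[OF e])
  interpret b: rank_two_basis "sec OX V" "sec J V" b by (rule J.free_basis_rank_two[OF b])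
  let ?t = "\<lambda>y. e.tr ((\<otimes>\<^bsub>sec OY V\<^esub>) y)" and ?s = "\<lambda>y. b.tr ((\<odot>\<^bsub>sec I V\<^esub>) y)"
  have tc: "?t y \<in> carrier (sec OX V)" "?s y \<in> carrier (sec OX V)" if "y \<in> carrier (sec OY V)" for y
    using mult_linear_endo[OF V(1) that] by (auto intro!: e.trace_closed b.trace_closed simp: linear_endo_def)
  \<comment> \<open>A multiple of \<open>e i\<close> by a power \<open>g\<close> of \<open>r\<close>
    is the restriction of a section \<open>a\<close> over \<open>W\<close>. The hypothesis applies
    to \<open>a\<close>, the scalar \<open>g\<close> comes out of both traces, and it is invertible
    over \<open>V\<close>.\<close>
  have basis: "?t (e i) = ?s (e i)" if i: "i < 2" for i
  proof -
    note ei = e.e_closed[OF i]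
    obtain K :: nat and a where a: "a \<in> carrier (sec OY W)" "res OY W V a = C.act V (r [^]\<^bsub>A\<^esub> K) (e i)"
      using C.section_extend[OF lfY r(1)] ei unfolding V_def by blast
    define g where "g = C.\<rho> V (r [^]\<^bsub>A\<^esub> K)"
    have g: "g \<in> carrier (sec OX V)" unfolding g_def using C.\<rho>_closed[OF V(1,3)] r(1) by simp
    obtain u where u: "u \<in> carrier (sec OX V)" "u \<otimes>\<^bsub>sec OX V\<^esub> g = \<one>\<^bsub>sec OX V\<^esub>"
      using C.\<rho>_unit[OF r(1)] unfolding g_def V_def by blast
    have ag: "res OY W V a = g \<odot>\<^bsub>sec OY V\<^esub> e i" using a(2) unfolding C.act_def g_def .
    have "?t (res OY W V a) = ?s (res OY W V a)"
      using eq[rule_format, OF a(1)] res_endo_trace[OF lfY W algebra_mult_endo[OF W a(1)] V(3) e]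
        J.res_endo_trace[OF lfJ W module_mult_endo[OF W a(1)] V(3) b]
      by (simp add: algebra_mult_def module_mult_def)
    then have "g \<otimes>\<^bsub>sec OX V\<^esub> ?t (e i) = g \<otimes>\<^bsub>sec OX V\<^esub> ?s (e i)"
      unfolding ag trace_mult_add_smult(2)[OF e g ei ei] trace_act_add_smult(2)[OF b g ei ei] .
    then have "u \<otimes>\<^bsub>sec OX V\<^esub> (g \<otimes>\<^bsub>sec OX V\<^esub> ?t (e i)) = u \<otimes>\<^bsub>sec OX V\<^esub> (g \<otimes>\<^bsub>sec OX V\<^esub> ?s (e i))"
      by simp
    then show ?thesis
      using B.R.m_assoc[OF u(1) g tc(1)[OF ei]] B.R.m_assoc[OF u(1) g tc(2)[OF ei]] tc[OF ei] u(2) by simp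
  qed
  \<comment> \<open>Both traces are linear over the base and agree on the two basis
    elements.\<close>
  have "?t y = ?s y" if y: "y \<in> carrier (sec OY V)" for y
  proof -
    obtain c d where c: "c \<in> carrier (sec OX V)" "d \<in> carrier (sec OX V)"
      "y = c \<odot>\<^bsub>sec OY V\<^esub> e 0 \<oplus>\<^bsub>sec OY V\<^esub> d \<odot>\<^bsub>sec OY V\<^esub> e 1" using e.expand_ex[OF y] by blast
    note cc = B.smult_closed[OF c(1) e.e01(1)] B.smult_closed[OF c(2) e.e01(2)]
    have lt: "0 < (2::nat)" "1 < (2::nat)" by auto
    show ?thesis
      unfolding c(3) trace_mult_add_smult(1)[OF e c(1) cc] trace_act_add_smult(1)[OF b c(1) cc]
        trace_mult_add_smult(2)[OF e c(1) e.e01(1,1)] trace_mult_add_smult(2)[OF e c(2) e.e01(2,2)]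
        trace_act_add_smult(2)[OF b c(1) e.e01(1,1)] trace_act_add_smult(2)[OF b c(2) e.e01(2,2)]
        basis[OF lt(1)] basis[OF lt(2)] ..
  qed
  moreover have "x \<in> V" "V \<subseteq> V0" using r V V1 unfolding V_def by auto
  ultimately show ?thesis
    by (intro exI[of _ V] exI[of _ e] exI[of _ b] conjI ballI e b)
qed

end

end

theorem proposition3p2p11:
  fixes X :: "'p topology"
    and OX :: "('p, 'r) ring_presheaf"
    and OY :: "('p, 'r, 's) module_presheaf"
    and I :: "('p, 's, 'm) module_presheaf"
  assumes "scheme X OX"
    and "quadratic_algebra X OX OY"
    and "rank_balanced X OX OY I"
  shows "pseudoregular X OX OY I \<longleftrightarrow>
    (\<forall>U \<alpha>. openin X U \<and> \<alpha> \<in> carrier (sec OY U) \<longrightarrow>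
       endo_trace X OX OY 2 U (algebra_mult OY U \<alpha>) =
       endo_trace X OX (restrict_scalars OY I) 2 U (module_mult OY I U \<alpha>))"
proof -
  have OX: "sheaf_of_rings X OX" and cover: "\<And>x. x \<in> topspace X \<Longrightarrow> \<exists>U. affine_open X OX U \<and> x \<in> U"
    using assms(1) unfolding scheme_def by auto
  have OY: "sheaf_of_algebras X OX OY" and lfY: "locally_free X OX OY 2"
    using assms(2) unfolding quadratic_algebra_def by auto
  have OY_modules: "sheaf_of_modules X OX OY" using OY unfolding sheaf_of_algebras_def by (elim conjE)
  have I: "sheaf_of_modules X OY I" and lfJ: "locally_free X OX (restrict_scalars OY I) 2"
    using assms(3) unfolding rank_balanced_def by auto
  interpret algebra_module_sheaf X OX OY I
    by (intro algebra_module_sheaf.intro module_sheaf.intro ring_sheaf.intro module_sheaf_axioms.intro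
        algebra_module_sheaf_axioms.intro OX OY OY_modules I)
  have aff_open: "openin X U" if "affine_open X OX U" for U
    using that unfolding affine_open_def by (elim conjE)
  show ?thesis
  proof (intro iffI allI impI)
    assume "pseudoregular X OX OY I"
    then obtain \<U> where \<U>: "\<forall>U \<in> \<U>. affine_open X OX U" "\<Union>\<U> = topspace X"
      and cp: "\<forall>U \<in> \<U>. \<forall>\<alpha> \<in> carrier (sec OY U). endo_charpoly X OX OY 2 U (algebra_mult OY U \<alpha>) =
           endo_charpoly X OX J 2 U (module_mult OY I U \<alpha>)"
      unfolding pseudoregular_def by (elim exE conjE)
    fix U \<alpha> assume "openin X U \<and> \<alpha> \<in> carrier (sec OY U)"
    then have U: "openin X U" and \<alpha>: "\<alpha> \<in> carrier (sec OY U)" by auto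
    note Y = lfY U algebra_mult_endo[OF U \<alpha>] and J = lfJ U module_mult_endo[OF U \<alpha>]
    show "endo_trace X OX OY 2 U (algebra_mult OY U \<alpha>) = endo_trace X OX J 2 U (module_mult OY I U \<alpha>)"
    proof (rule OX_local_eq[OF U endo_trace_closed[OF Y] J.endo_trace_closed[OF J]])
      fix x assume x: "x \<in> U"
      then obtain W where W: "W \<in> \<U>" "x \<in> W" using \<U>(2) openin_subset[OF U] by blast
      have aff: "affine_open X OX W" using \<U>(1) W(1) by blast
      have tr: "\<forall>a \<in> carrier (sec OY W).
          endo_trace X OX OY 2 W (algebra_mult OY W a) = endo_trace X OX J 2 W (module_mult OY I W a)"
        using cp W(1) endo_charpoly_eq_iff[OF lfY lfJ aff_open[OF aff]] by simp
      \<comment> \<open>The set is taken inside \<open>U \<inter> W\<close>. The equality holds for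
        every section of the algebra over \<open>V\<close>, in particular for the restriction of
        \<open>\<alpha>\<close>, which need not come from a section over \<open>W\<close>.\<close>
      obtain V e b where V: "x \<in> V" "V \<subseteq> U \<inter> W" "free_basis X OX OY 2 V e" "free_basis X OX J 2 V b"
        and eq: "\<forall>y \<in> carrier (sec OY V).
          mult_trace V e y =
          act_trace V b y"
        using trace_eq_on_chart[OF lfY lfJ aff tr openin_Int[OF U aff_open[OF aff]] Int_lower2 IntI[OF x W(2)]]
        by (elim exE conjE)
      note o = free_basis_open[OF V(3)]
      have VU: "V \<subseteq> U" using V(2) by blast
      have "res OX U V (endo_trace X OX OY 2 U (algebra_mult OY U \<alpha>)) =
          res OX U V (endo_trace X OX J 2 U (module_mult OY I U \<alpha>))"
        unfolding res_endo_trace[OF Y VU V(3)] J.res_endo_trace[OF J VU V(4)]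
        unfolding algebra_mult_def module_mult_def
        by (rule eq[rule_format, OF res_closed[OF U o VU \<alpha>]])
      then show "\<exists>V. x \<in> V \<and> openin X V \<and> V \<subseteq> U \<and>
          res OX U V (endo_trace X OX OY 2 U (algebra_mult OY U \<alpha>)) =
          res OX U V (endo_trace X OX J 2 U (module_mult OY I U \<alpha>))"
        by (intro exI[of _ V] conjI V(1) o VU)
    qed
  next
    assume tr: "\<forall>U \<alpha>. openin X U \<and> \<alpha> \<in> carrier (sec OY U) \<longrightarrow>
       endo_trace X OX OY 2 U (algebra_mult OY U \<alpha>) = endo_trace X OX J 2 U (module_mult OY I U \<alpha>)"
    show "pseudoregular X OX OY I"
      unfolding pseudoregular_def
    proof (intro exI conjI)
      \<comment> \<open>Trace equality over all open sets gives equality of characteristic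
        polynomials on every affine open set, so all of these may be put into the cover.\<close>
      let ?\<U> = "{U. affine_open X OX U}"
      show "\<forall>U \<in> ?\<U>. affine_open X OX U" by simp
      show "\<Union>?\<U> = topspace X"
        using cover aff_open openin_subset by blast
      show "\<forall>U \<in> ?\<U>. \<forall>\<alpha> \<in> carrier (sec OY U). endo_charpoly X OX OY 2 U (algebra_mult OY U \<alpha>) =
           endo_charpoly X OX J 2 U (module_mult OY I U \<alpha>)"
        using tr endo_charpoly_eq_iff[OF lfY lfJ aff_open] aff_open by simp
    qed
  qed
qed

end
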